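(* Let $\mathbb I\subset R\times\mathbb R$ be an idealistic filtration. If $\mathbb I$ is of r.f.g. type, then so is its $\mathfrak R$-saturation $\mathfrak R(\mathbb I)$.
   Context: $k$ is an algebraically closed field of arbitrary characteristic. $R$ is the coordinate ring of an affine open subset of a variety $W$ smooth over $k$, or its localization by some multiplicative set. Idealistic filtration: for $T\subset R\times\mathbb R$ and $a\in\mathbb R$ write $T_a=\{f\in R:(f,a)\in T\}$. A subset $\mathbb I\subset R\times\mathbb R$ is an idealistic filtration if $\mathbb I_0=R$; each $\mathbb I_a$ is an ideal of $R$; $\mathbb I_a\mathbb I_b\subset\mathbb I_{a+b}$ for all $a,b$; and $\mathbb I_b\supset\mathbb I_a$ whenever $b\le a$. $G(T)$ denotes the smallest idealistic filtration containing $T$. $\mathbb I$ is of r.f.g. type if $\mathbb I=G(T)$ for some finite $T\subset R\times\mathbb Q$. $\mathbb I$ is $\mathfrak R$-saturated if (radical) $(f^n,na)\in\mathbb I$, $f\in R$, $n\in\mathbb Z_{>0}$ imply $(f,a)\in\mathbb I$, and (continuity) $(f,a_l)\in\mathbb I$ for a sequence $a_l\to a$ implies $(f,a)\in\mathbb I$. $\mathfrak R(\mathbb I)$ is the smallest $\mathfrak R$-saturated idealistic filtration containing $\mathbb I$. *)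

theory Defs
  imports
    Complex_Main
    "HOL-Library.Poly_Mapping"
    "HOL-Library.Extended_Nat"
    "HOL-Algebra.Algebraic_Closure_Type"
    "Jordan_Normal_Form.DL_Rank"
begin

section \<open>Smooth affine varieties and localizations\<close>

text \<open>
  A polynomial in the variables \<open>X 0, X 1, \<dots>\<close> over \<open>'k\<close> is a finitely supported function
  from exponent vectors to coefficients; \<open>k[X 0, \<dots>, X (n - 1)]\<close> is the subset \<open>mpoly_ring n\<close>.
\<close>

type_synonym 'k mpol = "(nat \<Rightarrow>\<^sub>0 nat) \<Rightarrow>\<^sub>0 'k"

definition mpoly_ring :: "nat \<Rightarrow> 'k::zero mpol set" where
  "mpoly_ring n = {p. \<forall>m \<in> Poly_Mapping.keys p. Poly_Mapping.keys m \<subseteq> {..<n}}"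

text \<open>Evaluation at \<open>x\<close>, the coefficients being mapped to the target ring by \<open>\<phi>\<close>.\<close>

definition mpoly_eval :: "('k::zero \<Rightarrow> 'a::comm_ring_1) \<Rightarrow> (nat \<Rightarrow> 'a) \<Rightarrow> 'k mpol \<Rightarrow> 'a" where
  "mpoly_eval \<phi> x p = (\<Sum>m \<in> Poly_Mapping.keys p. \<phi> (Poly_Mapping.lookup p m) * (\<Prod>i \<in> Poly_Mapping.keys m. x i ^ Poly_Mapping.lookup m i))"

text \<open>
  Formal partial derivative with respect to \<open>X j\<close>. The exponent subtraction is truncated, but
  it only truncates on monomials not involving \<open>X j\<close>, where the coefficient vanishes.
\<close>

definition mpoly_pderiv :: "nat \<Rightarrow> 'k::comm_ring_1 mpol \<Rightarrow> 'k mpol" where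
  "mpoly_pderiv j p = (\<Sum>m \<in> Poly_Mapping.keys p.
     Poly_Mapping.single (m - Poly_Mapping.single j 1) (of_nat (Poly_Mapping.lookup m j) * Poly_Mapping.lookup p m))"

definition jacobian :: "nat \<Rightarrow> 'k::comm_ring_1 mpol list \<Rightarrow> (nat \<Rightarrow> 'k) \<Rightarrow> 'k mat" where
  "jacobian n fs a =
     mat (length fs) n (\<lambda>(i, j). mpoly_eval (\<lambda>c. c) a (mpoly_pderiv j (fs ! i)))"

text \<open>
  The \<open>k\<close>-algebra \<open>'a\<close>, with structure map \<open>\<phi>\<close>, is
  \<open>k[X 0, \<dots>, X (n - 1)] / (fs)\<close>, where \<open>X i\<close> is sent to \<open>x i\<close>.
\<close>

definition affine_presentation ::
  "('k::comm_ring_1 \<Rightarrow> 'a::comm_ring_1) \<Rightarrow> nat \<Rightarrow> (nat \<Rightarrow> 'a) \<Rightarrow> 'k mpol list \<Rightarrow> bool" where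
  "affine_presentation \<phi> n x fs \<longleftrightarrow>
     comm_ring_hom \<phi> \<and>
     set fs \<subseteq> mpoly_ring n \<and>
     mpoly_eval \<phi> x ` mpoly_ring n = UNIV \<and>
     (\<forall>p \<in> mpoly_ring n. mpoly_eval \<phi> x p = 0 \<longleftrightarrow>
        (\<exists>g. (\<forall>i < length fs. g i \<in> mpoly_ring n) \<and> p = (\<Sum>i < length fs. g i * fs ! i)))"

definition krull_dim :: "'a::comm_ring_1 itself \<Rightarrow> enat" where
  "krull_dim _ = Sup {enat d | d. \<exists>P :: nat \<Rightarrow> 'a set.
     (\<forall>i \<le> d. primeideal (P i) (ring_of_type_algebra :: 'a ring)) \<and> (\<forall>i < d. P i \<subset> P (Suc i))}"

text \<open>
  The domain \<open>'a\<close> is, via \<open>\<phi>\<close>, the coordinate ring of an affine variety smooth over the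
  algebraically closed field \<open>'k\<close>: at every closed point, the Jacobian matrix of defining
  equations in affine \<open>n\<close>-space has rank \<open>n - dim\<close>.
  A nonempty affine open subset of a smooth variety is itself a smooth affine variety, so these
  are exactly the coordinate rings of nonempty affine open subsets of smooth varieties.
\<close>

definition smooth_affine_coordinate_ring :: "('k::alg_closed_field \<Rightarrow> 'a::idom) \<Rightarrow> bool" where
  "smooth_affine_coordinate_ring \<phi> \<longleftrightarrow> (\<exists>n x fs. affine_presentation \<phi> n x fs \<and>
     (\<forall>a. (\<forall>f \<in> set fs. mpoly_eval (\<lambda>c. c) a f = 0) \<longrightarrow>
        enat (vec_space.rank (length fs) (jacobian n fs a)) + krull_dim TYPE('a) = enat n))"

definition multiplicative_set :: "'a::comm_ring_1 set \<Rightarrow> bool" where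
  "multiplicative_set S \<longleftrightarrow> 1 \<in> S \<and> (\<forall>s \<in> S. \<forall>t \<in> S. s * t \<in> S)"

text \<open>\<open>\<iota>\<close> exhibits \<open>'r\<close> as the localization of \<open>'a\<close> by \<open>S\<close>: every element of \<open>'r\<close> is a
  fraction \<open>a / s\<close>, and \<open>a / 1 = 0\<close> iff \<open>a\<close> is annihilated by some element of \<open>S\<close>.\<close>

definition is_localization :: "'a::comm_ring_1 set \<Rightarrow> ('a \<Rightarrow> 'r::comm_ring_1) \<Rightarrow> bool" where
  "is_localization S \<iota> \<longleftrightarrow>
     comm_ring_hom \<iota> \<and>
     (\<forall>s \<in> S. \<iota> s dvd 1) \<and>
     (\<forall>r. \<exists>a. \<exists>s \<in> S. r * \<iota> s = \<iota> a) \<and>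
     (\<forall>a. \<iota> a = 0 \<longleftrightarrow> (\<exists>s \<in> S. s * a = 0))"


section \<open>Idealistic filtrations\<close>

definition level :: "('r \<times> real) set \<Rightarrow> real \<Rightarrow> 'r set" where
  "level T a = {f. (f, a) \<in> T}"

definition idealistic_filtration :: "('r::comm_ring_1 \<times> real) set \<Rightarrow> bool" where
  "idealistic_filtration I \<longleftrightarrow>
     level I 0 = UNIV \<and>
     (\<forall>a. ideal (level I a) (ring_of_type_algebra :: 'r ring)) \<and>
     (\<forall>a b. \<forall>f \<in> level I a. \<forall>g \<in> level I b. f * g \<in> level I (a + b)) \<and>
     (\<forall>a b. b \<le> a \<longrightarrow> level I a \<subseteq> level I b)"

definition generated_filtration :: "('r::comm_ring_1 \<times> real) set \<Rightarrow> ('r \<times> real) set" where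
  "generated_filtration T = \<Inter>{I. idealistic_filtration I \<and> T \<subseteq> I}"

definition rfg_type :: "('r::comm_ring_1 \<times> real) set \<Rightarrow> bool" where
  "rfg_type I \<longleftrightarrow> (\<exists>T. finite T \<and> T \<subseteq> UNIV \<times> \<rat> \<and> I = generated_filtration T)"

definition R_saturated :: "('r::comm_ring_1 \<times> real) set \<Rightarrow> bool" where
  "R_saturated I \<longleftrightarrow>
     (\<forall>f n a. n > 0 \<longrightarrow> (f ^ n, real n * a) \<in> I \<longrightarrow> (f, a) \<in> I) \<and>
     (\<forall>f s a. (\<forall>l::nat. (f, s l) \<in> I) \<longrightarrow> s \<longlonglongrightarrow> a \<longrightarrow> (f, a) \<in> I)"

definition R_saturation :: "('r::comm_ring_1 \<times> real) set \<Rightarrow> ('r \<times> real) set" where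
  "R_saturation I = \<Inter>{J. idealistic_filtration J \<and> R_saturated J \<and> I \<subseteq> J}"

text \<open>The two intersections above are the smallest objects of their kind.\<close>

lemma idealistic_filtration_UNIV: "idealistic_filtration (UNIV :: ('r::comm_ring_1 \<times> real) set)"
proof -
  interpret R: ring "ring_of_type_algebra :: 'r ring" by rule
  show ?thesis
    using R.oneideal by (simp add: idealistic_filtration_def level_def ring_of_type_algebra_def)
qed

lemma idealistic_filtration_Inter:
  fixes \<I> :: "('r::comm_ring_1 \<times> real) set set"
  assumes "\<I> \<noteq> {}" and "\<And>I. I \<in> \<I> \<Longrightarrow> idealistic_filtration I"
  shows "idealistic_filtration (\<Inter>\<I>)"
proof -
  interpret R: ring "ring_of_type_algebra :: 'r ring" by rule
  have level: "level (\<Inter>\<I>) a = (\<Inter>I\<in>\<I>. level I a)" for a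
    by (auto simp: level_def)
  have id: "ideal (level (\<Inter>\<I>) a) (ring_of_type_algebra :: 'r ring)" for a
    unfolding level using assms
    by (intro R.i_Intersect) (auto simp: idealistic_filtration_def)
  have lv: "level I 0 = UNIV" "\<forall>a b. \<forall>f \<in> level I a. \<forall>g \<in> level I b. f * g \<in> level I (a + b)"
    "\<forall>a b. b \<le> a \<longrightarrow> level I a \<subseteq> level I b" if "I \<in> \<I>" for I
    using assms(2)[OF that] unfolding idealistic_filtration_def by blast+
  show ?thesis
    unfolding idealistic_filtration_def
  proof (intro conjI allI ballI impI id)
    show "level (\<Inter>\<I>) 0 = UNIV" using lv(1) by (auto simp: level)
    show "f * g \<in> level (\<Inter>\<I>) (a + b)" if "f \<in> level (\<Inter>\<I>) a" "g \<in> level (\<Inter>\<I>) b" for f g a b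
      using that lv(2) by (auto simp: level)
    show "level (\<Inter>\<I>) a \<subseteq> level (\<Inter>\<I>) b" if "b \<le> a" for a b
      using that lv(3) unfolding level by blast
  qed
qed

lemma idealistic_filtration_generated: "idealistic_filtration (generated_filtration T)"
  unfolding generated_filtration_def
  using idealistic_filtration_UNIV by (intro idealistic_filtration_Inter) auto

lemma idealistic_filtration_R_saturation: "idealistic_filtration (R_saturation I)"
  unfolding R_saturation_def using idealistic_filtration_UNIV
  by (intro idealistic_filtration_Inter) (auto simp: R_saturated_def)

lemma R_saturated_R_saturation: "R_saturated (R_saturation I)"
  unfolding R_saturated_def
proof (intro conjI allI impI)
  fix f :: 'a and n :: nat and a
  assume "0 < n" "(f ^ n, real n * a) \<in> R_saturation I"
  then show "(f, a) \<in> R_saturation I"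
    unfolding R_saturation_def R_saturated_def by blast
next
  fix f :: 'a and s a
  assume *: "\<forall>l::nat. (f, s l) \<in> R_saturation I" "s \<longlonglongrightarrow> a"
  show "(f, a) \<in> R_saturation I"
    unfolding R_saturation_def
  proof (rule InterI, clarify)
    fix J assume "idealistic_filtration J" and J: "R_saturated J" and "I \<subseteq> J"
    then have "\<forall>l. (f, s l) \<in> J" using *(1) unfolding R_saturation_def by blast
    with *(2) J show "(f, a) \<in> J" unfolding R_saturated_def by blast
  qed
qed

end

theory Submission
  imports Defs
begin

text \<open>
  After raising generators to powers and multiplying by units, the positive-level generators may be
  replaced by elements \<open>g\<close> of the affine algebra \<open>R0\<close> of one common level \<open>\<nu>\<close>. Let
  \<open>B = R0[g t, 1 / t]\<close> be the extended Rees algebra. A homogeneous element \<open>f t ^ p\<close> that is integral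
  over \<open>B\<close> lies in the saturation at level \<open>p * \<nu>\<close>, because an integral equation improves the level of
  \<open>f\<close> step by step. The integral closure of \<open>B\<close> in its fraction field is a finite \<open>B\<close>-module, hence
  Noetherian and normal, so the order along \<open>1 / t\<close> is a minimum of normalized discrete valuations and
  takes values with a bounded denominator \<open>e\<close>. Adjoining an \<open>e\<close>-th root \<open>s\<close> of \<open>t\<close>, the condition that
  \<open>f s ^ k\<close> with \<open>k = \<lceil>a * e / \<nu>\<rceil>\<close> is integral over \<open>B\<close> defines a saturated filtration, which is
  therefore the saturation; finiteness of the integral closure of \<open>B[1 / s]\<close> yields finitely many
  homogeneous generators of rational level.
\<close>

section \<open>Finitely generated modules over subrings\<close>

text \<open>All rings occur as subsets of one algebraically closed field, the algebraic closure of
  the fraction field of \<open>R[t]\<close>. Passing to fraction fields, conjugates, the root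
  \<open>s\<close> or an integral closure only changes the subset. Three obstacles shape the proof.
  Radicality speaks about all powers of \<open>f\<close>, and \<open>f\<close> may have a level that
  is a proper fraction of \<nu>. A denominator \<open>e\<close> that serves all \<open>f\<close> at
  once reduces this to one exponent; with levels rounded up to multiples of \<nu> /
  \<open>e\<close>, the filtration depends on the level only through an integer that is constant on
  half-open intervals closed on the right, and this yields continuity. In positive characteristic
  the extension of a Noether normalization, or the one by \<open>s\<close>, may be inseparable. The
  derivative argument covers the separable case only; the rest is reached by \<open>q\<close>-th
  powers and uses that \<open>q\<close>-th roots exist in \<open>k\<close>. Finally \<open>R\<close>
  need not be finitely generated over \<open>k\<close>. So \<open>B\<close> is built from the affine
  algebra, and the denominators of \<open>R\<close> are absorbed by unit factors, which do not
  affect membership in a filtration.\<close>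

definition subring_set :: "'a::comm_ring_1 set \<Rightarrow> bool" where
  "subring_set D \<longleftrightarrow> 1 \<in> D \<and> (\<forall>x\<in>D. \<forall>y\<in>D. x - y \<in> D \<and> x * y \<in> D)"

lemma subring_set_one: "subring_set D \<Longrightarrow> 1 \<in> D"
  and subring_set_diff: "subring_set D \<Longrightarrow> x \<in> D \<Longrightarrow> y \<in> D \<Longrightarrow> x - y \<in> D"
  and subring_set_mult: "subring_set D \<Longrightarrow> x \<in> D \<Longrightarrow> y \<in> D \<Longrightarrow> x * y \<in> D"
  by (auto simp: subring_set_def)

lemma subring_set_zero: "subring_set D \<Longrightarrow> 0 \<in> D"
  using subring_set_diff[of D 1 1] subring_set_one by auto

lemma subring_set_uminus: "subring_set D \<Longrightarrow> x \<in> D \<Longrightarrow> - x \<in> D"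
  using subring_set_diff[of D 0 x] subring_set_zero by auto

lemma subring_set_add: "subring_set D \<Longrightarrow> x \<in> D \<Longrightarrow> y \<in> D \<Longrightarrow> x + y \<in> D"
  using subring_set_diff[of D x "- y"] subring_set_uminus by auto

lemma subring_set_power: "subring_set D \<Longrightarrow> x \<in> D \<Longrightarrow> x ^ n \<in> D"
  by (induction n) (auto intro: subring_set_one subring_set_mult)

lemma subring_set_sum: "subring_set D \<Longrightarrow> (\<And>i. i \<in> A \<Longrightarrow> f i \<in> D) \<Longrightarrow> sum f A \<in> D"
  by (induction A rule: infinite_finite_induct) (auto intro: subring_set_zero subring_set_add)

lemma subring_set_prod: "subring_set D \<Longrightarrow> (\<And>i. i \<in> A \<Longrightarrow> f i \<in> D) \<Longrightarrow> prod f A \<in> D"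
  by (induction A rule: infinite_finite_induct) (auto intro: subring_set_one subring_set_mult)

lemma subring_set_of_nat: "subring_set D \<Longrightarrow> of_nat n \<in> D"
  by (induction n) (auto intro: subring_set_zero subring_set_one subring_set_add)

lemmas subring_intros = subring_set_zero subring_set_one subring_set_diff subring_set_mult
  subring_set_uminus subring_set_add subring_set_power subring_set_sum subring_set_prod
  subring_set_of_nat

lemma subring_setI:
  assumes "1 \<in> D" "\<And>x. x \<in> D \<Longrightarrow> - x \<in> D" "\<And>x y. x \<in> D \<Longrightarrow> y \<in> D \<Longrightarrow> x + y \<in> D"
    "\<And>x y. x \<in> D \<Longrightarrow> y \<in> D \<Longrightarrow> x * y \<in> D"
  shows "subring_set D"
  unfolding subring_set_def using assms by (metis add_uminus_conv_diff)

text \<open>The coefficient set and the generators are independent of each other, so the same notion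
  serves for ideals, for modules in a larger field and for a change of base ring.\<close>

inductive_set lin_span :: "'a::comm_ring_1 set \<Rightarrow> 'a set \<Rightarrow> 'a set" for D V where
  zero: "0 \<in> lin_span D V"
| step: "c \<in> D \<Longrightarrow> x \<in> V \<Longrightarrow> y \<in> lin_span D V \<Longrightarrow> c * x + y \<in> lin_span D V"

lemma lin_span_base: "subring_set D \<Longrightarrow> x \<in> V \<Longrightarrow> x \<in> lin_span D V"
  using lin_span.step[of 1 D x V 0] by (auto intro: lin_span.zero subring_set_one)

lemma lin_span_least:
  assumes "V \<subseteq> M" "0 \<in> M" "\<And>x y. x \<in> M \<Longrightarrow> y \<in> M \<Longrightarrow> x + y \<in> M"
    "\<And>c x. c \<in> D \<Longrightarrow> x \<in> M \<Longrightarrow> c * x \<in> M"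
  shows "lin_span D V \<subseteq> M"
proof
  fix x assume "x \<in> lin_span D V"
  then show "x \<in> M" by induction (use assms in auto)
qed

lemma lin_span_add:
  assumes "x \<in> lin_span D V" "y \<in> lin_span D V"
  shows "x + y \<in> lin_span D V"
  using assms by (induction) (auto simp: add.assoc intro: lin_span.intros)

lemma lin_span_scale:
  assumes "subring_set D" "c \<in> D" "x \<in> lin_span D V"
  shows "c * x \<in> lin_span D V"
  using assms(3)
proof induction
  case (step d x y)
  have "(c * d) * x + c * y \<in> lin_span D V"
    using step assms by (intro lin_span.step) (auto intro: subring_intros)
  then show ?case by (simp add: algebra_simps)
qed (simp add: lin_span.zero)

lemma lin_span_uminus: "subring_set D \<Longrightarrow> x \<in> lin_span D V \<Longrightarrow> - x \<in> lin_span D V"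
  using lin_span_scale[of D "-1" x V] by (auto intro: subring_intros)

lemma lin_span_diff:
  "subring_set D \<Longrightarrow> x \<in> lin_span D V \<Longrightarrow> y \<in> lin_span D V \<Longrightarrow> x - y \<in> lin_span D V"
  using lin_span_add[of x D V "- y"] lin_span_uminus by auto

lemma lin_span_sum: "(\<And>i. i \<in> A \<Longrightarrow> f i \<in> lin_span D V) \<Longrightarrow> sum f A \<in> lin_span D V"
  by (induction A rule: infinite_finite_induct) (auto intro: lin_span.zero lin_span_add)

lemma lin_span_trans: "subring_set D \<Longrightarrow> V \<subseteq> lin_span D Y \<Longrightarrow> lin_span D V \<subseteq> lin_span D Y"
  by (rule lin_span_least) (auto intro: lin_span.zero lin_span_add lin_span_scale)

lemma lin_span_mono:
  assumes "D \<subseteq> D'" "V \<subseteq> V'"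
  shows "lin_span D V \<subseteq> lin_span D' V'"
proof
  fix x assume "x \<in> lin_span D V"
  then show "x \<in> lin_span D' V'" by induction (use assms in \<open>auto intro: lin_span.intros\<close>)
qed

lemma lin_span_self: "subring_set D \<Longrightarrow> V \<subseteq> D \<Longrightarrow> lin_span D V \<subseteq> D"
  by (rule lin_span_least) (auto intro: subring_intros)

lemma lin_span_insert:
  assumes "subring_set D" "y \<in> lin_span D (insert x V)"
  obtains c where "c \<in> D" "y - c * x \<in> lin_span D V"
proof -
  have "\<exists>c\<in>D. y - c * x \<in> lin_span D V" using assms(2)
  proof induction
    case zero
    then show ?case using assms(1) by (intro bexI[of _ 0]) (auto intro: lin_span.zero subring_intros)
  next
    case (step d z y)
    then obtain c where c: "c \<in> D" "y - c * x \<in> lin_span D V" by auto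
    show ?case
    proof (cases "z \<in> V")
      case True
      then have "d * z + (y - c * x) \<in> lin_span D V" using c step by (auto intro: lin_span.step)
      then show ?thesis using c by (intro bexI[of _ c]) (auto simp: algebra_simps)
    next
      case False
      then have "z = x" using step by auto
      then have "d * z + y - (d + c) * x = y - c * x" by (simp add: algebra_simps)
      then have "d * z + y - (d + c) * x \<in> lin_span D V" by (metis c(2))
      then show ?thesis using c step assms(1) by (intro bexI[of _ "d + c"] subring_set_add)
    qed
  qed
  then show ?thesis using that by auto
qed

lemma lin_span_finite_witness:
  assumes "y \<in> lin_span D V"
  shows "\<exists>X0\<subseteq>V. finite X0 \<and> y \<in> lin_span D X0"
  using assms
proof induction
  case zero
  then show ?case by (auto intro: lin_span.zero)
next
  case (step c x y)
  then obtain X0 where "X0 \<subseteq> V" "finite X0" "y \<in> lin_span D X0" by auto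
  then show ?case using step(1,2) lin_span_mono[of D D X0 "insert x X0"]
    by (intro exI[of _ "insert x X0"]) (auto intro!: lin_span.step)
qed

lemma lin_span_finite_subset_witness:
  assumes "finite Y" "Y \<subseteq> lin_span D V"
  shows "\<exists>X0\<subseteq>V. finite X0 \<and> Y \<subseteq> lin_span D X0"
  using assms
proof (induction Y)
  case (insert y Y)
  then obtain X0 where X0: "X0 \<subseteq> V" "finite X0" "Y \<subseteq> lin_span D X0" by auto
  obtain X1 where X1: "X1 \<subseteq> V" "finite X1" "y \<in> lin_span D X1"
    using insert lin_span_finite_witness[of y D V] by auto
  show ?case using X0 X1 lin_span_mono[of D D X0 "X0 \<union> X1"] lin_span_mono[of D D X1 "X0 \<union> X1"]
    by (intro exI[of _ "X0 \<union> X1"]) auto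
qed auto

lemma lin_span_tower:
  assumes "subring_set D" "E \<subseteq> lin_span D G"
  shows "lin_span E P \<subseteq> lin_span D {g * p | g p. g \<in> G \<and> p \<in> P}"
proof
  fix x assume "x \<in> lin_span E P"
  then show "x \<in> lin_span D {g * p | g p. g \<in> G \<and> p \<in> P}"
  proof induction
    case (step c x y)
    have "c \<in> lin_span D G" using step assms by auto
    then have "c * x \<in> lin_span D {g * p | g p. g \<in> G \<and> p \<in> P}"
    proof induction
      case (step d g z)
      have "d * (g * x) + z * x \<in> lin_span D {g * p | g p. g \<in> G \<and> p \<in> P}"
        using step \<open>x \<in> P\<close> by (intro lin_span.step) auto
      then show ?case by (simp add: algebra_simps)
    qed (auto intro: lin_span.zero)
    then show ?case using step by (auto intro: lin_span_add)
  qed (auto intro: lin_span.zero)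
qed

text \<open>Stated for arbitrary subsets, with generators drawn from the given subset itself. Hence
  the property passes at once to subsets of \<open>M\<close> and to larger coefficient sets, and
  generators can be chosen with any property that all elements of \<open>V\<close> share.\<close>

definition noetherian_on :: "'a::comm_ring_1 set \<Rightarrow> 'a set \<Rightarrow> bool" where
  "noetherian_on D M \<longleftrightarrow> (\<forall>V\<subseteq>M. \<exists>X0\<subseteq>V. finite X0 \<and> V \<subseteq> lin_span D X0)"

lemma noetherian_onE:
  assumes "noetherian_on D M" "V \<subseteq> M"
  obtains X0 where "X0 \<subseteq> V" "finite X0" "V \<subseteq> lin_span D X0"
  using assms(1)[unfolded noetherian_on_def, rule_format, OF assms(2)] that by blast

lemma noetherian_on_subset: "noetherian_on D M \<Longrightarrow> N \<subseteq> M \<Longrightarrow> noetherian_on D N"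
  unfolding noetherian_on_def by blast

lemma noetherian_on_mono: "noetherian_on D M \<Longrightarrow> D \<subseteq> D' \<Longrightarrow> noetherian_on D' M"
  unfolding noetherian_on_def using lin_span_mono by (meson order_refl subset_trans)

text \<open>Induction on the number of generators: \<open>L\<close> collects the coefficients of
  \<open>g\<close> in elements of the span of \<open>V\<close>. Lifts of generators of
  \<open>L\<close>, together with generators of the part of the span lying in \<open>M\<close>, span
  everything.\<close>

lemma noetherian_on_lin_span:
  assumes D: "subring_set D" and N: "noetherian_on D D" and "finite G"
  shows "noetherian_on D (lin_span D G)"
  using \<open>finite G\<close>
proof induction
  case empty
  have "lin_span D {} \<subseteq> {0}" by (rule lin_span_least) auto
  then show ?case unfolding noetherian_on_def
    by (intro allI impI exI[of _ "{}"]) (auto intro: lin_span.zero)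
next
  case (insert g G)
  show ?case unfolding noetherian_on_def
  proof (intro allI impI)
    fix V assume V: "V \<subseteq> lin_span D (insert g G)"
    define M where "M = lin_span D G"
    define L where "L = {c \<in> D. \<exists>m\<in>M. c * g + m \<in> lin_span D V}"
    obtain C where C: "C \<subseteq> L" "finite C" "L \<subseteq> lin_span D C"
      using noetherian_onE[OF N, of L] unfolding L_def by blast
    have "\<forall>c\<in>C. \<exists>m\<in>M. c * g + m \<in> lin_span D V" using C unfolding L_def by auto
    then obtain m where m: "\<And>c. c \<in> C \<Longrightarrow> m c \<in> M" "\<And>c. c \<in> C \<Longrightarrow> c * g + m c \<in> lin_span D V"
      by metis
    obtain Y where Y: "Y \<subseteq> lin_span D V \<inter> M" "finite Y" "lin_span D V \<inter> M \<subseteq> lin_span D Y"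
      using noetherian_onE[OF insert.IH, of "lin_span D V \<inter> M"] unfolding M_def by blast
    define Z where "Z = (\<lambda>c. c * g + m c) ` C \<union> Y"
    have ZX: "Z \<subseteq> lin_span D V" using m Y unfolding Z_def by auto
    have lift: "\<exists>z\<in>lin_span D Z. z - c * g \<in> M" if "c \<in> lin_span D C" for c using that
    proof induction
      case zero
      then show ?case unfolding M_def by (intro bexI[of _ 0]) (auto intro: lin_span.zero)
    next
      case (step d x y)
      then obtain z where z: "z \<in> lin_span D Z" "z - y * g \<in> M" by auto
      have "d * (x * g + m x) + z \<in> lin_span D Z"
        using step z by (intro lin_span.step) (auto simp: Z_def)
      moreover have "d * m x + (z - y * g) \<in> M"
        using z m[OF step(2)] D step(1) unfolding M_def by (intro lin_span_add lin_span_scale) auto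
      ultimately show ?case
        by (intro bexI[of _ "d * (x * g + m x) + z"]) (auto simp: algebra_simps)
    qed
    have "V \<subseteq> lin_span D Z"
    proof
      fix x assume x: "x \<in> V"
      obtain c where c: "c \<in> D" "x - c * g \<in> M"
        using lin_span_insert[OF D, of x g G] x V unfolding M_def by blast
      have "c \<in> L" unfolding L_def using c x D by (auto intro!: bexI[of _ "x - c * g"] lin_span_base)
      then obtain z where z: "z \<in> lin_span D Z" "z - c * g \<in> M" using lift C by blast
      have "x - z = (x - c * g) - (z - c * g)" by simp
      then have "x - z \<in> M" using c z D unfolding M_def by (metis lin_span_diff)
      moreover have "x - z \<in> lin_span D V"
        using x z lin_span_trans[OF D ZX] D by (auto intro: lin_span_diff lin_span_base)
      ultimately have "x - z \<in> lin_span D Z"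
        using Y(3) lin_span_mono[of D D Y Z] unfolding Z_def by blast
      from lin_span_add[OF this z(1)] show "x \<in> lin_span D Z" by simp
    qed
    moreover have "finite Z" using C Y unfolding Z_def by auto
    \<comment> \<open>\<open>Z\<close> lies in the span of \<open>V\<close>, not in
      \<open>V\<close>; each of its finitely many elements involves only finitely many elements of
      \<open>V\<close>.\<close>
    ultimately show "\<exists>X0\<subseteq>V. finite X0 \<and> V \<subseteq> lin_span D X0"
      using lin_span_finite_subset_witness[OF _ ZX] lin_span_trans[OF D] by (meson subset_trans)
  qed
qed

section \<open>Polynomials over a subring and Hilbert's basis theorem\<close>

definition poly_set :: "'a::comm_ring_1 set \<Rightarrow> 'a poly set" where
  "poly_set D = {p. \<forall>i. coeff p i \<in> D}"

lemma subring_poly_set: "subring_set D \<Longrightarrow> subring_set (poly_set D)"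
  by (rule subring_setI) (auto simp: poly_set_def coeff_mult coeff_1 intro!: subring_intros)

lemma poly_set_mono: "D \<subseteq> E \<Longrightarrow> poly_set D \<subseteq> poly_set E"
  by (auto simp: poly_set_def)

lemma monom_in_poly_set: "subring_set D \<Longrightarrow> c \<in> D \<Longrightarrow> monom c n \<in> poly_set D"
  by (auto simp: poly_set_def intro: subring_intros)

lemma pCons_in_poly_set_iff: "pCons c p \<in> poly_set D \<longleftrightarrow> c \<in> D \<and> p \<in> poly_set D"
proof -
  have "(\<forall>i. coeff (pCons c p) i \<in> D) \<longleftrightarrow>
      coeff (pCons c p) 0 \<in> D \<and> (\<forall>i. coeff (pCons c p) (Suc i) \<in> D)"
    by (metis not0_implies_Suc)
  then show ?thesis by (simp add: poly_set_def)
qed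

lemmas pCons_in_poly_set = pCons_in_poly_set_iff[THEN iffD2, OF conjI]

lemma const_in_poly_set: "subring_set D \<Longrightarrow> c \<in> D \<Longrightarrow> [:c:] \<in> poly_set D"
  using monom_in_poly_set[of D c 0] by (simp add: monom_0)

lemma smult_in_poly_set: "subring_set D \<Longrightarrow> c \<in> D \<Longrightarrow> p \<in> poly_set D \<Longrightarrow> smult c p \<in> poly_set D"
  by (auto simp: poly_set_def intro: subring_intros)

lemma pderiv_in_poly_set: "subring_set D \<Longrightarrow> p \<in> poly_set D \<Longrightarrow> pderiv p \<in> poly_set D"
  by (auto simp: poly_set_def coeff_pderiv intro!: subring_intros simp del: of_nat_Suc)

lemma poly_in_subring:
  assumes "subring_set D" "p \<in> poly_set D" "x \<in> D"
  shows "poly p x \<in> D"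
  using assms by (auto simp: poly_altdef poly_set_def intro!: subring_intros)

lemma pcompose_in_poly_set:
  assumes "subring_set D" "p \<in> poly_set D" "q \<in> poly_set D"
  shows "pcompose p q \<in> poly_set D"
  using assms(2)
proof (induction p)
  case (pCons c p)
  have "c \<in> D" "p \<in> poly_set D"
    using pCons.prems by (simp_all add: pCons_in_poly_set_iff)
  then show ?case using pCons.IH assms subring_poly_set[OF assms(1)]
    by (auto simp: pcompose_pCons intro!: subring_set_add subring_set_mult const_in_poly_set)
qed (use assms in \<open>auto simp: poly_set_def intro: subring_intros\<close>)

lemma poly_set_span_low_degree:
  assumes "subring_set D" "p \<in> poly_set D" "\<And>i. i \<ge> n \<Longrightarrow> coeff p i = 0"
  shows "p \<in> lin_span (poly_set D \<inter> {p. degree p = 0}) ((\<lambda>i. monom 1 i) ` {..<n})"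
proof -
  have "degree p \<le> n" by (rule degree_le) (use assms in auto)
  have "p = (\<Sum>i\<le>n. monom (coeff p i) i)" using poly_as_sum_of_monoms'[OF \<open>degree p \<le> n\<close>] by simp
  also have "\<dots> = (\<Sum>i<n. monom (coeff p i) i)"
    using assms(3)[of n] by (simp add: lessThan_Suc_atMost[symmetric])
  also have "\<dots> = (\<Sum>i<n. [:coeff p i:] * monom 1 i)"
    by (simp add: smult_monom)
  finally have eq: "p = (\<Sum>i<n. [:coeff p i:] * monom 1 i)" .
  have "[:coeff p i:] * monom 1 i + 0 \<in> lin_span (poly_set D \<inter> {p. degree p = 0}) ((\<lambda>i. monom 1 i) ` {..<n})"
    if "i < n" for i
  proof (rule lin_span.step)
    have "coeff p i \<in> D" using assms by (simp add: poly_set_def)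
    then show "[:coeff p i:] \<in> poly_set D \<inter> {p. degree p = 0}"
      using assms(1) by (simp add: const_in_poly_set)
  qed (use that in \<open>auto intro: lin_span.zero\<close>)
  then show ?thesis by (subst eq) (auto intro!: lin_span_sum)
qed

text \<open>\<open>D\<close> and its polynomials live in different types. To regard polynomials of
  bounded degree as a module over \<open>D\<close>, the ring \<open>D\<close> is replaced by its
  copy of constant polynomials.\<close>

lemma noetherian_const_polys:
  assumes "subring_set D" "noetherian_on D D"
  shows "noetherian_on (poly_set D \<inter> {p. degree p = 0}) (poly_set D \<inter> {p. degree p = 0})"
  unfolding noetherian_on_def
proof (intro allI impI)
  fix V assume V: "V \<subseteq> poly_set D \<inter> {p. degree p = 0}"
  have eq: "p = [:coeff p 0:]" if "p \<in> V" for p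
  proof -
    have "degree p = 0" using V that by auto
    then show ?thesis by (auto elim!: degree_eq_zeroE)
  qed
  have "(\<lambda>p. coeff p 0) ` V \<subseteq> D" using V by (auto simp: poly_set_def)
  from noetherian_onE[OF assms(2) this] obtain Y where
    Y: "Y \<subseteq> (\<lambda>p. coeff p 0) ` V" "finite Y" "(\<lambda>p. coeff p 0) ` V \<subseteq> lin_span D Y" .
  obtain X0 where X0: "X0 \<subseteq> V" "finite X0" "Y = (\<lambda>p. coeff p 0) ` X0"
    using Y(1,2) by (meson finite_subset_image)
  have "[:c:] \<in> lin_span (poly_set D \<inter> {p. degree p = 0}) X0" if "c \<in> lin_span D Y" for c
    using that
  proof induction
    case (step d x y)
    from step X0 obtain p where p: "p \<in> X0" "x = coeff p 0" by auto
    have "[:d * x + y:] = [:d:] * p + [:y:]"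
    proof -
      have "p = [:x:]" using eq[of p] p X0 by auto
      then show ?thesis by simp
    qed
    then show ?case using step p assms(1) by (auto intro!: lin_span.step const_in_poly_set simp del: mult_pCons_left)
  qed (auto intro: lin_span.zero)
  then have "V \<subseteq> lin_span (poly_set D \<inter> {p. degree p = 0}) X0" 
  proof (intro subsetI)
    fix p assume H: "\<And>c. c \<in> lin_span D Y \<Longrightarrow> [:c:] \<in> lin_span (poly_set D \<inter> {p. degree p = 0}) X0"
      and p: "p \<in> V"
    show "p \<in> lin_span (poly_set D \<inter> {p. degree p = 0}) X0"
      by (subst eq[OF p], rule H) (use Y(3) p in auto)
  qed
  then show "\<exists>X0\<subseteq>V. finite X0 \<and> V \<subseteq> lin_span (poly_set D \<inter> {p. degree p = 0}) X0"
    using X0 by blast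
qed

lemma subring_const_polys: "subring_set D \<Longrightarrow> subring_set (poly_set D \<inter> {p. degree p = 0})"
  using subring_poly_set[of D]
  by (intro subring_setI) (auto simp: subring_set_one subring_set_uminus subring_set_add subring_set_mult
      elim!: degree_eq_zeroE)

text \<open>The classical argument: \<open>F\<close> realizes generators of the leading coefficients
  and reduces degrees down to \<open>d\<close>; what remains has degree below \<open>d\<close> and
  lies in a finite module over the constants.\<close>

theorem hilbert_basis:
  assumes D: "subring_set D" and N: "noetherian_on D D"
  shows "noetherian_on (poly_set D) (poly_set D)"
  unfolding noetherian_on_def
proof (intro allI impI)
  fix V assume V: "V \<subseteq> poly_set D"
  define I where "I = lin_span (poly_set D) V"
  note P = subring_poly_set[OF D]
  have IP: "I \<subseteq> poly_set D" unfolding I_def using lin_span_self[OF P V] .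
  define L where "L = lead_coeff ` I"
  have "L \<subseteq> D" using IP unfolding L_def poly_set_def by auto
  from noetherian_onE[OF N this] obtain C where C: "C \<subseteq> L" "finite C" "L \<subseteq> lin_span D C" .
  obtain F where F: "F \<subseteq> I" "finite F" "C = lead_coeff ` F"
    using C(1,2) unfolding L_def by (meson finite_subset_image)
  define d where "d = Suc (Max (insert 0 (degree ` F)))"
  have dF: "degree f < d" if "f \<in> F" for f
    unfolding d_def using F(2) that by (simp add: less_Suc_eq_le)
  define K where "K = poly_set D \<inter> {p. degree p = 0}"
  have K: "subring_set K" "noetherian_on K K"
    unfolding K_def using subring_const_polys noetherian_const_polys D N by auto
  define I0 where "I0 = {p \<in> I. \<forall>i\<ge>d. coeff p i = 0}"
  have "I0 \<subseteq> lin_span K ((\<lambda>i. monom 1 i) ` {..<d})"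
    using poly_set_span_low_degree[OF D, of _ d] IP unfolding I0_def K_def by auto
  then have "noetherian_on K I0"
    using noetherian_on_lin_span[OF K, of "(\<lambda>i. monom 1 i) ` {..<d}"] noetherian_on_subset by blast
  then obtain Y where Y: "Y \<subseteq> I0" "finite Y" "I0 \<subseteq> lin_span K Y" by (rule noetherian_onE) auto
  define Z where "Z = F \<union> Y"
  have ZI: "Z \<subseteq> I" using F Y unfolding Z_def I0_def by auto
  have "p \<in> lin_span (poly_set D) Z" if "p \<in> I" for p
    using that
  proof (induction "degree p" arbitrary: p rule: less_induct)
    case less
    show ?case
    proof (cases "\<forall>i\<ge>d. coeff p i = 0")
      case True
      then have "p \<in> lin_span K Y" using Y less unfolding I0_def by auto
      then show ?thesis using lin_span_mono[of K "poly_set D" Y Z] unfolding K_def Z_def by auto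
    next
      case False
      then have deg: "degree p \<ge> d" using le_degree le_trans by blast
      define n where "n = degree p"
      have "lead_coeff p \<in> lin_span D C" using C less unfolding L_def by auto
      \<comment> \<open>The coefficient at the fixed index \<open>n\<close> is tracked, not the
        leading coefficient, because partial sums may cancel at the top.\<close>
      have "\<exists>q\<in>lin_span (poly_set D) F. coeff q n = c \<and> degree q \<le> n"
        if "c \<in> lin_span D C" for c using that
      proof induction
        case zero
        show ?case by (intro bexI[of _ 0]) (auto intro: lin_span.zero)
      next
        case (step a x y)
        then obtain q where q: "q \<in> lin_span (poly_set D) F" "coeff q n = y" "degree q \<le> n" by auto
        obtain f where f: "f \<in> F" "x = lead_coeff f" using step F by auto
        have fd: "degree f \<le> n" using dF[OF f(1)] deg n_def by auto
        let ?m = "monom a (n - degree f)"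
        have "?m * f + q \<in> lin_span (poly_set D) F"
          using step f q D by (intro lin_span.step monom_in_poly_set)
        moreover have "coeff (?m * f) n = a * x"
          using fd by (simp add: coeff_monom_mult f)
        moreover have "degree (?m * f) \<le> n"
          using degree_mult_le[of ?m f] degree_monom_le[of a "n - degree f"] fd by linarith
        ultimately show ?case using q
          by (intro bexI[of _ "?m * f + q"]) (auto intro: degree_add_le)
      qed
      then obtain q where q: "q \<in> lin_span (poly_set D) F" "coeff q n = lead_coeff p" "degree q \<le> n"
        using \<open>lead_coeff p \<in> _\<close> by blast
      have qI: "q \<in> I" using q lin_span_trans[OF P, of F V] F unfolding I_def by auto
      have diffI: "p - q \<in> I" using less qI P unfolding I_def by (auto intro: lin_span_diff)
      have qZ: "q \<in> lin_span (poly_set D) Z" using q lin_span_mono[of _ _ F Z] unfolding Z_def by auto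
      have "degree (p - q) < degree p"
      proof -
        have "coeff (p - q) i = 0" if "i \<ge> n" for i
          using q that n_def by (cases "i = n") (auto simp: coeff_eq_0)
        moreover have "n > 0" using deg n_def d_def by auto
        ultimately have "degree (p - q) < n"
          by (metis coeff_0 degree_0 leading_coeff_0_iff linorder_not_less)
        then show ?thesis using n_def by simp
      qed
      then have "p - q \<in> lin_span (poly_set D) Z" using less diffI by auto
      from lin_span_add[OF this qZ] show ?thesis by simp
    qed
  qed
  then have "V \<subseteq> lin_span (poly_set D) Z"
    unfolding I_def using P by (auto intro: lin_span_base)
  moreover have "finite Z" using F Y unfolding Z_def by auto
  ultimately show "\<exists>X0\<subseteq>V. finite X0 \<and> V \<subseteq> lin_span (poly_set D) X0"
    using lin_span_finite_subset_witness[of Z] ZI lin_span_trans[OF P] unfolding I_def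
    by (meson subset_trans)
qed

section \<open>Integral elements\<close>

definition ring_adjoin :: "'a::comm_ring_1 set \<Rightarrow> 'a set \<Rightarrow> 'a set" where
  "ring_adjoin D V = \<Inter>{E. subring_set E \<and> D \<subseteq> E \<and> V \<subseteq> E}"

lemma subring_ring_adjoin: "subring_set (ring_adjoin D V)"
  unfolding ring_adjoin_def by (auto simp: subring_set_def)

lemma ring_adjoin_base: "D \<subseteq> ring_adjoin D V"
  and ring_adjoin_gen: "V \<subseteq> ring_adjoin D V"
  unfolding ring_adjoin_def by auto

lemma ring_adjoin_least: "subring_set E \<Longrightarrow> D \<subseteq> E \<Longrightarrow> V \<subseteq> E \<Longrightarrow> ring_adjoin D V \<subseteq> E"
  unfolding ring_adjoin_def by auto

lemma ring_adjoin_mono: "D \<subseteq> D' \<Longrightarrow> V \<subseteq> V' \<Longrightarrow> ring_adjoin D V \<subseteq> ring_adjoin D' V'"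
  using ring_adjoin_base[of D' V'] ring_adjoin_gen[of V' D'] by (intro ring_adjoin_least subring_ring_adjoin) auto

lemma ring_adjoin_insert: "ring_adjoin D (insert x V) = ring_adjoin (ring_adjoin D V) {x}"
proof
  show "ring_adjoin D (insert x V) \<subseteq> ring_adjoin (ring_adjoin D V) {x}"
    using ring_adjoin_base[of D V] ring_adjoin_gen[of V D] ring_adjoin_base[of "ring_adjoin D V" "{x}"] ring_adjoin_gen[of "{x}" "ring_adjoin D V"]
    by (intro ring_adjoin_least subring_ring_adjoin) auto
  show "ring_adjoin (ring_adjoin D V) {x} \<subseteq> ring_adjoin D (insert x V)"
    using ring_adjoin_mono[of D D V "insert x V"] ring_adjoin_base[of D "insert x V"] ring_adjoin_gen[of "insert x V" D]
    by (intro ring_adjoin_least subring_ring_adjoin) auto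
qed

lemma ring_adjoin_single:
  assumes "subring_set D"
  shows "ring_adjoin D {x} = (\<lambda>p. poly p x) ` poly_set D"
proof
  note P = subring_poly_set[OF assms]
  have "subring_set ((\<lambda>p. poly p x) ` poly_set D)"
  proof (rule subring_setI)
    show "1 \<in> (\<lambda>p. poly p x) ` poly_set D"
      using P by (intro image_eqI[of _ _ 1]) (auto intro: subring_intros)
  next
    fix y assume "y \<in> (\<lambda>p. poly p x) ` poly_set D"
    then obtain p where "p \<in> poly_set D" "y = poly p x" by auto
    then show "- y \<in> (\<lambda>p. poly p x) ` poly_set D"
      using P by (intro image_eqI[of _ _ "- p"]) (auto intro: subring_set_uminus)
  next
    fix y z assume "y \<in> (\<lambda>p. poly p x) ` poly_set D" "z \<in> (\<lambda>p. poly p x) ` poly_set D"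
    then obtain p q where pq: "p \<in> poly_set D" "y = poly p x" "q \<in> poly_set D" "z = poly q x" by auto
    show "y + z \<in> (\<lambda>p. poly p x) ` poly_set D"
      using P pq by (intro image_eqI[of _ _ "p + q"]) (auto intro: subring_set_add)
    show "y * z \<in> (\<lambda>p. poly p x) ` poly_set D"
      using P pq by (intro image_eqI[of _ _ "p * q"]) (auto intro: subring_set_mult)
  qed
  moreover have "D \<subseteq> (\<lambda>p. poly p x) ` poly_set D"
  proof
    fix c assume "c \<in> D"
    then show "c \<in> (\<lambda>p. poly p x) ` poly_set D"
      using assms by (intro image_eqI[of _ _ "[:c:]"]) (auto intro: const_in_poly_set)
  qed
  moreover have "x \<in> (\<lambda>p. poly p x) ` poly_set D"
    using assms by (intro image_eqI[of _ _ "monom 1 1"]) (auto intro: monom_in_poly_set subring_set_one simp: poly_monom)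
  ultimately show "ring_adjoin D {x} \<subseteq> (\<lambda>p. poly p x) ` poly_set D"
    by (intro ring_adjoin_least) auto
  show "(\<lambda>p. poly p x) ` poly_set D \<subseteq> ring_adjoin D {x}"
    using ring_adjoin_base[of D "{x}"] ring_adjoin_gen[of "{x}" D] poly_set_mono[of D "ring_adjoin D {x}"]
    by (auto intro!: poly_in_subring subring_ring_adjoin)
qed

text \<open>\<open>D[x]\<close> is the image of the polynomial ring under evaluation, so generators
  of the preimage of \<open>V\<close> map to generators of \<open>V\<close>.\<close>

lemma noetherian_ring_adjoin_single:
  assumes "subring_set D" "noetherian_on D D"
  shows "noetherian_on (ring_adjoin D {x}) (ring_adjoin D {x})"
  unfolding noetherian_on_def
proof (intro allI impI)
  fix V assume V: "V \<subseteq> ring_adjoin D {x}"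
  define U where "U = {p \<in> poly_set D. poly p x \<in> V}"
  have "U \<subseteq> poly_set D" unfolding U_def by auto
  from noetherian_onE[OF hilbert_basis[OF assms] this]
  obtain U0 where U0: "U0 \<subseteq> U" "finite U0" "U \<subseteq> lin_span (poly_set D) U0" .
  have "poly p x \<in> lin_span (ring_adjoin D {x}) ((\<lambda>p. poly p x) ` U0)"
    if "p \<in> lin_span (poly_set D) U0" for p
    using that
  proof induction
    case (step c p q)
    then show ?case unfolding poly_add poly_mult
      by (intro lin_span.step) (auto simp: ring_adjoin_single[OF assms(1)])
  qed (auto intro: lin_span.zero)
  then have "V \<subseteq> lin_span (ring_adjoin D {x}) ((\<lambda>p. poly p x) ` U0)"
    using V U0(3) unfolding U_def ring_adjoin_single[OF assms(1)] by blast
  moreover have "(\<lambda>p. poly p x) ` U0 \<subseteq> V" using U0 unfolding U_def by auto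
  ultimately show "\<exists>V0\<subseteq>V. finite V0 \<and> V \<subseteq> lin_span (ring_adjoin D {x}) V0"
    using U0(2) by blast
qed

lemma noetherian_ring_adjoin:
  assumes "finite V" "subring_set D" "noetherian_on D D"
  shows "noetherian_on (ring_adjoin D V) (ring_adjoin D V)"
  using assms(1)
proof induction
  case empty
  have "ring_adjoin D {} = D" using ring_adjoin_base[of D "{}"] ring_adjoin_gen[of "{}" D] ring_adjoin_least[of D D "{}"] assms by auto
  then show ?case using assms by simp
next
  case (insert x V)
  then show ?case using noetherian_ring_adjoin_single[OF subring_ring_adjoin] by (subst (1 2) ring_adjoin_insert) auto
qed

definition integral_over :: "'a::comm_ring_1 set \<Rightarrow> 'a \<Rightarrow> bool" where
  "integral_over D x \<longleftrightarrow> (\<exists>p\<in>poly_set D. lead_coeff p = 1 \<and> poly p x = 0)"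

lemma integral_over_mono: "integral_over D x \<Longrightarrow> D \<subseteq> E \<Longrightarrow> integral_over E x"
  unfolding integral_over_def using poly_set_mono by blast

lemma integral_over_base:
  assumes "subring_set D" "x \<in> D"
  shows "integral_over D x"
  unfolding integral_over_def using assms
  by (intro bexI[of _ "[:-x, 1:]"])
     (auto intro!: pCons_in_poly_set const_in_poly_set subring_intros simp flip: one_pCons simp: subring_poly_set)

lemma lin_span_powers_poly:
  assumes D: "subring_set D" and "y \<in> lin_span D ((\<lambda>i. x ^ i) ` {..<n})"
  shows "\<exists>p\<in>poly_set D. (\<forall>i\<ge>n. coeff p i = 0) \<and> poly p x = y"
  using assms(2)
proof induction
  case zero
  show ?case using D by (intro bexI[of _ 0]) (auto simp: poly_set_def intro: subring_intros)
next
  case (step c z y)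
  then obtain p i where p: "p \<in> poly_set D" "\<forall>i\<ge>n. coeff p i = 0" "poly p x = y"
    and i: "i < n" "z = x ^ i" by auto
  then show ?case using D step(1)
    by (intro bexI[of _ "monom c i + p"])
       (auto simp: poly_monom intro: subring_set_add subring_poly_set monom_in_poly_set)
qed

text \<open>In a Noetherian module the powers of \<open>x\<close> are spanned by finitely many of them; this replaces
  the determinant trick.\<close>

lemma integral_over_if_powers:
  assumes D: "subring_set D" and N: "noetherian_on D M" and M: "\<And>n. x ^ n \<in> M"
  shows "integral_over D x"
proof -
  have "range (\<lambda>n. x ^ n) \<subseteq> M" using M by auto
  from noetherian_onE[OF N this] obtain V where V: "V \<subseteq> range (\<lambda>n. x ^ n)" "finite V"
    "range (\<lambda>n. x ^ n) \<subseteq> lin_span D V" .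
  obtain A where A: "finite A" "V = (\<lambda>n. x ^ n) ` A" using V(1,2) by (meson finite_subset_image)
  define n where "n = Suc (Max (insert 0 A))"
  have "V \<subseteq> (\<lambda>i. x ^ i) ` {..<n}"
    unfolding A(2) n_def using A(1) by (auto simp: less_Suc_eq_le)
  then have "x ^ n \<in> lin_span D ((\<lambda>i. x ^ i) ` {..<n})"
    using V(3) lin_span_mono[of D D V] by blast
  then obtain p where p: "p \<in> poly_set D" "\<forall>i\<ge>n. coeff p i = 0" "poly p x = x ^ n"
    using lin_span_powers_poly[OF D] by blast
  have "coeff (monom 1 n - p) n = 1" "\<And>i. i > n \<Longrightarrow> coeff (monom 1 n - p) i = 0" using p by auto
  then have "degree (monom 1 n - p) = n"
    by (metis antisym degree_le le_degree zero_neq_one)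
  then have "lead_coeff (monom 1 n - p) = 1" using p by auto
  then show ?thesis unfolding integral_over_def using p D
    by (intro bexI[of _ "monom 1 n - p"])
       (auto simp: poly_monom intro: subring_set_diff subring_poly_set monom_in_poly_set subring_set_one)
qed

lemma monic_degree_pos:
  fixes p :: "'a::comm_ring_1 poly"
  assumes "lead_coeff p = 1" "poly p x = 0"
  shows "degree p > 0"
proof (rule ccontr)
  assume "\<not> degree p > 0"
  then have "p = 1" using assms(1) by (metis degree_0_id gr0I one_pCons)
  then show False using assms(2) by simp
qed

lemma ring_adjoin_integral_span:
  assumes D: "subring_set D" and p: "p \<in> poly_set D" "lead_coeff p = 1" "poly p x = 0"
  shows "ring_adjoin D {x} \<subseteq> lin_span D ((\<lambda>i. x ^ i) ` {..<degree p})"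
proof -
  define n where "n = degree p"
  define M where "M = lin_span D ((\<lambda>i. x ^ i) ` {..<n})"
  have base: "x ^ i \<in> M" if "i < n" for i
    unfolding M_def using D that by (intro lin_span_base) auto
  have "n > 0" unfolding n_def using p(2,3) by (rule monic_degree_pos)
  have "poly p x = (\<Sum>i<n. coeff p i * x ^ i) + x ^ n"
    using p(2) unfolding poly_altdef n_def by (simp add: lessThan_Suc_atMost[symmetric])
  then have "x ^ n = - (\<Sum>i<n. coeff p i * x ^ i)" using p(3) by (simp add: eq_neg_iff_add_eq_0 add.commute)
  moreover have "(\<Sum>i<n. coeff p i * x ^ i) \<in> M"
    using p base D unfolding M_def by (intro lin_span_sum lin_span_scale) (auto simp: poly_set_def)
  ultimately have xn: "x ^ n \<in> M" using D unfolding M_def by (simp add: lin_span_uminus)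
  have xM: "x * y \<in> M" if "y \<in> M" for y
    using that unfolding M_def
  proof (induction)
    case (step c z y)
    then obtain i where i: "i < n" "z = x ^ i" by auto
    then have "x ^ Suc i \<in> M" using xn base[of "Suc i"] by (cases "Suc i = n") (auto simp del: power_Suc)
    then have "c * x ^ Suc i + x * y \<in> M" using step D unfolding M_def by (auto intro: lin_span_add lin_span_scale)
    then show ?case using i unfolding M_def by (simp add: algebra_simps)
  qed (simp add: lin_span.zero)
  have "poly q x \<in> M" if "q \<in> poly_set D" for q
    using that
  proof (induction q)
    case (pCons c q)
    have "c \<in> D" "q \<in> poly_set D"
      using pCons.prems by (simp_all add: pCons_in_poly_set_iff)
    then have "c * x ^ 0 \<in> M" "x * poly q x \<in> M"
      using pCons.IH xM lin_span_scale[OF D _ base[OF \<open>n > 0\<close>, unfolded M_def]] unfolding M_def by auto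
    then have "c * x ^ 0 + x * poly q x \<in> M"
      unfolding M_def by (rule lin_span_add)
    then show ?case by simp
  qed (simp add: M_def lin_span.zero)
  then show ?thesis unfolding ring_adjoin_single[OF D] M_def n_def by auto
qed

lemma subring_lin_span_one: "subring_set D \<Longrightarrow> D \<subseteq> lin_span D {1}"
  using lin_span_scale[of D _ 1 "{1}"] lin_span_base[of D 1 "{1}"] by auto

lemma ring_adjoin_integral_finite:
  assumes D: "subring_set D" and "finite V" "\<And>x. x \<in> V \<Longrightarrow> integral_over D x"
  shows "\<exists>G. finite G \<and> ring_adjoin D V \<subseteq> lin_span D G"
  using assms(2,3)
proof (induction V)
  case empty
  have "ring_adjoin D {} \<subseteq> D" using ring_adjoin_least[of D D "{}"] D by auto
  also have "D \<subseteq> lin_span D {1}"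
    by (rule subring_lin_span_one[OF D])
  finally show ?case by blast
next
  case (insert x V)
  then obtain G where G: "finite G" "ring_adjoin D V \<subseteq> lin_span D G" by auto
  have "integral_over (ring_adjoin D V) x"
    using insert.prems integral_over_mono ring_adjoin_base by blast
  then obtain p where "p \<in> poly_set (ring_adjoin D V)" "lead_coeff p = 1" "poly p x = 0"
    unfolding integral_over_def by auto
  from ring_adjoin_integral_span[OF subring_ring_adjoin this]
  have "ring_adjoin D (insert x V) \<subseteq> lin_span (ring_adjoin D V) ((\<lambda>i. x ^ i) ` {..<degree p})"
    by (subst ring_adjoin_insert)
  also have "\<dots> \<subseteq> lin_span D {g * q | g q. g \<in> G \<and> q \<in> (\<lambda>i. x ^ i) ` {..<degree p}}"
    by (rule lin_span_tower[OF D G(2)])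
  finally show ?case using G(1)
    by (intro exI[of _ "{g * q | g q. g \<in> G \<and> q \<in> (\<lambda>i. x ^ i) ` {..<degree p}}"])
       (auto intro!: finite_image_set2)
qed

lemma integral_over_ring_adjoin_finite:
  assumes D: "subring_set D" "noetherian_on D D" and V: "finite V" "\<And>x. x \<in> V \<Longrightarrow> integral_over D x"
    and "z \<in> ring_adjoin D V"
  shows "integral_over D z"
proof -
  obtain G where "finite G" "ring_adjoin D V \<subseteq> lin_span D G"
    using ring_adjoin_integral_finite[OF D(1) V] by auto
  then have "noetherian_on D (ring_adjoin D V)"
    using noetherian_on_lin_span[OF D] noetherian_on_subset by blast
  then show ?thesis
    by (rule integral_over_if_powers[OF D(1)]) (use assms in \<open>auto intro: subring_set_power subring_ring_adjoin\<close>)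
qed

text \<open>Sums and products of integral \<open>x\<close> and \<open>y\<close> lie in
  \<open>D[x, y]\<close>, which is contained in a finite \<open>D\<close>-module, so no equation has
  to be computed.\<close>

lemma subring_integral_closure:
  assumes D: "subring_set D" "noetherian_on D D"
  shows "subring_set {x. integral_over D x}"
proof -
  have closed: "integral_over D z"
    if "integral_over D x" "integral_over D y" "z \<in> ring_adjoin D {x, y}" for x y z
    using integral_over_ring_adjoin_finite[OF D, of "{x, y}" z] that by auto
  have sub: "x \<in> ring_adjoin D {x, y}" "y \<in> ring_adjoin D {x, y}" for x y
    using ring_adjoin_gen[of "{x, y}"] by auto
  note adj = subring_ring_adjoin[of D "{x, y}" for x y]
  show ?thesis
  proof (rule subring_setI; unfold mem_Collect_eq)
    show "integral_over D 1" using D by (intro integral_over_base subring_set_one)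
  next
    fix x assume "integral_over D x"
    then show "integral_over D (- x)" using closed[of x x "- x"] subring_set_uminus[OF adj sub(1)] by blast
  next
    fix x y assume *: "integral_over D x" "integral_over D y"
    show "integral_over D (x + y)" by (rule closed[OF * subring_set_add[OF adj sub]])
    show "integral_over D (x * y)" by (rule closed[OF * subring_set_mult[OF adj sub]])
  qed
qed

lemma integral_over_ring_adjoin:
  assumes D: "subring_set D" "noetherian_on D D" and V: "\<And>x. x \<in> V \<Longrightarrow> integral_over D x"
    and "z \<in> ring_adjoin D V"
  shows "integral_over D z"
  using ring_adjoin_least[OF subring_integral_closure[OF D], of D V] assms integral_over_base by blast

text \<open>Only the coefficients of one equation matter: adjoining them to \<open>D\<close> gives a
  ring inside a finite \<open>D\<close>-module, and adjoining \<open>x\<close> keeps it inside one.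
  So \<open>E\<close> may be any set of integral elements.\<close>

lemma integral_over_trans:
  assumes D: "subring_set D" "noetherian_on D D" and E: "\<And>y. y \<in> E \<Longrightarrow> integral_over D y"
    and x: "integral_over E x"
  shows "integral_over D x"
proof -
  from x obtain p where p: "p \<in> poly_set E" "lead_coeff p = 1" "poly p x = 0"
    unfolding integral_over_def by auto
  define E' where "E' = ring_adjoin D (coeff p ` {..degree p})"
  have "coeff p i \<in> E'" for i
  proof (cases "i \<le> degree p")
    case True
    then show ?thesis unfolding E'_def by (intro subsetD[OF ring_adjoin_gen]) auto
  next
    case False
    then show ?thesis unfolding E'_def by (simp add: coeff_eq_0 subring_set_zero subring_ring_adjoin)
  qed
  then have pE': "p \<in> poly_set E'" by (auto simp: poly_set_def)
  obtain G where G: "finite G" "E' \<subseteq> lin_span D G"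
    using ring_adjoin_integral_finite[OF D(1), of "coeff p ` {..degree p}"] p E
    unfolding E'_def poly_set_def by auto
  have E's: "subring_set E'" unfolding E'_def by (rule subring_ring_adjoin)
  let ?M = "lin_span D {g * q | g q. g \<in> G \<and> q \<in> (\<lambda>i. x ^ i) ` {..<degree p}}"
  have M: "ring_adjoin E' {x} \<subseteq> ?M"
    using ring_adjoin_integral_span[OF E's pE' p(2,3)]
      lin_span_tower[OF D(1) G(2), of "(\<lambda>i. x ^ i) ` {..<degree p}"] by blast
  have "noetherian_on D ?M"
    using G(1) by (intro noetherian_on_lin_span D finite_image_set2) auto
  then have "noetherian_on D (ring_adjoin E' {x})" using M by (rule noetherian_on_subset)
  then show ?thesis
  proof (rule integral_over_if_powers[OF D(1)])
    show "x ^ n \<in> ring_adjoin E' {x}" for n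
      using ring_adjoin_gen[of "{x}" E'] by (auto intro: subring_set_power subring_ring_adjoin)
  qed
qed

lemma integral_over_root:
  assumes D: "subring_set D" "noetherian_on D D" and "n > 0" "integral_over D (x ^ n)"
  shows "integral_over D x"
proof (rule integral_over_trans[OF D])
  let ?E = "ring_adjoin D {x ^ n}"
  show "integral_over D y" if "y \<in> ?E" for y
    using integral_over_ring_adjoin[OF D _ that] assms by auto
  have "degree (monom 1 n - [:x ^ n:]) = n"
    using \<open>n > 0\<close> degree_add_eq_left[of "- [:x ^ n:]" "monom 1 n"] by (simp add: degree_monom_eq del: minus_pCons)
  then have "lead_coeff (monom 1 n - [:x ^ n:]) = 1"
    using \<open>n > 0\<close> by (cases n) auto
  moreover have "monom 1 n - [:x ^ n:] \<in> poly_set ?E"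
    using ring_adjoin_gen[of "{x ^ n}" D]
    by (intro subring_set_diff subring_poly_set monom_in_poly_set const_in_poly_set subring_ring_adjoin
        subring_set_one) auto
  ultimately show "integral_over ?E x"
    unfolding integral_over_def by (intro bexI[of _ "monom 1 n - [:x ^ n:]"]) (auto simp: poly_monom)
qed

section \<open>Fractions and subfields inside a fixed field\<close>

definition fraction_set :: "'a::field set \<Rightarrow> 'a set" where
  "fraction_set D = {a / b | a b. a \<in> D \<and> b \<in> D \<and> b \<noteq> 0}"

lemma fraction_setI: "a \<in> D \<Longrightarrow> b \<in> D \<Longrightarrow> b \<noteq> 0 \<Longrightarrow> a / b \<in> fraction_set D"
  unfolding fraction_set_def by auto

lemma fraction_setE:
  assumes "x \<in> fraction_set D"
  obtains a b where "a \<in> D" "b \<in> D" "b \<noteq> 0" "x = a / b"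
  using assms unfolding fraction_set_def by auto

definition subfield_set :: "'a::field set \<Rightarrow> bool" where
  "subfield_set F \<longleftrightarrow> subring_set F \<and> (\<forall>x\<in>F. inverse x \<in> F)"

lemma subfield_set_divide: "subfield_set F \<Longrightarrow> x \<in> F \<Longrightarrow> y \<in> F \<Longrightarrow> x / y \<in> F"
  by (auto simp: subfield_set_def divide_inverse intro: subring_set_mult)

lemma subfield_subring: "subfield_set F \<Longrightarrow> subring_set F"
  by (simp add: subfield_set_def)

lemma fraction_set_base: "subring_set D \<Longrightarrow> D \<subseteq> fraction_set D"
  using fraction_setI[of _ D 1] by (auto intro: subring_set_one)

lemma subfield_fraction_set:
  assumes D: "subring_set D"
  shows "subfield_set (fraction_set D)"
proof -
  have "subring_set (fraction_set D)"
  proof (rule subring_setI)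
    show "1 \<in> fraction_set D" using fraction_set_base[OF D] D by (auto intro: subring_set_one)
  next
    fix x assume "x \<in> fraction_set D"
    then obtain a b where "a \<in> D" "b \<in> D" "b \<noteq> 0" "x = a / b" by (rule fraction_setE)
    then show "- x \<in> fraction_set D" using fraction_setI[of "- a" D b] D by (auto intro: subring_intros)
  next
    fix x y assume "x \<in> fraction_set D" "y \<in> fraction_set D"
    then obtain a b c d where abcd: "a \<in> D" "b \<in> D" "b \<noteq> 0" "x = a / b"
      "c \<in> D" "d \<in> D" "d \<noteq> 0" "y = c / d" by (metis fraction_setE)
    have "x + y = (a * d + c * b) / (b * d)" "x * y = (a * c) / (b * d)"
      using abcd by (auto simp: field_simps)
    moreover have "(a * d + c * b) / (b * d) \<in> fraction_set D" "(a * c) / (b * d) \<in> fraction_set D"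
      using abcd D by (auto intro!: fraction_setI intro: subring_intros)
    ultimately show "x + y \<in> fraction_set D" "x * y \<in> fraction_set D" by auto
  qed
  moreover have "inverse x \<in> fraction_set D" if "x \<in> fraction_set D" for x
  proof -
    obtain a b where "a \<in> D" "b \<in> D" "b \<noteq> 0" "x = a / b" using \<open>x \<in> _\<close> by (rule fraction_setE)
    then show ?thesis using fraction_setI[of b D a] fraction_set_base[OF D] D
      by (cases "a = 0") (auto intro: subring_intros)
  qed
  ultimately show ?thesis by (auto simp: subfield_set_def)
qed

lemma fraction_set_least: "subfield_set F \<Longrightarrow> D \<subseteq> F \<Longrightarrow> fraction_set D \<subseteq> F"
  unfolding fraction_set_def by (auto intro: subfield_set_divide)

lemma fraction_set_mono: "D \<subseteq> E \<Longrightarrow> fraction_set D \<subseteq> fraction_set E"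
  unfolding fraction_set_def by auto

lemma noetherian_on_subfield:
  assumes "subfield_set F"
  shows "noetherian_on F F"
  unfolding noetherian_on_def
proof (intro allI impI)
  fix V assume V: "V \<subseteq> F"
  show "\<exists>V0\<subseteq>V. finite V0 \<and> V \<subseteq> lin_span F V0"
  proof (cases "V \<subseteq> {0}")
    case True
    then show ?thesis by (intro exI[of _ "{}"]) (auto intro: lin_span.zero)
  next
    case False
    then obtain v where v: "v \<in> V" "v \<noteq> 0" by auto
    have "x \<in> lin_span F {v}" if "x \<in> V" for x
    proof -
      have "x / v \<in> F" using assms V v that by (auto intro: subfield_set_divide)
      then have "(x / v) * v + 0 \<in> lin_span F {v}" by (intro lin_span.intros) auto
      then show ?thesis using v by simp
    qed
    then show ?thesis using v by (intro exI[of _ "{v}"]) auto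
  qed
qed

lemma common_denominator:
  assumes D: "subring_set D" and "finite A" "\<And>i. i \<in> A \<Longrightarrow> f i \<in> fraction_set D"
  shows "\<exists>d\<in>D. d \<noteq> 0 \<and> (\<forall>i\<in>A. d * f i \<in> D)"
  using assms(2,3)
proof (induction A)
  case empty
  then show ?case using D by (auto intro!: bexI[of _ 1] subring_set_one)
next
  case (insert i A)
  then obtain d where d: "d \<in> D" "d \<noteq> 0" "\<forall>i\<in>A. d * f i \<in> D" by auto
  obtain a b where ab: "a \<in> D" "b \<in> D" "b \<noteq> 0" "f i = a / b"
    using insert.prems by (meson fraction_setE insertI1)
  have "(d * b) * f j \<in> D" if "j \<in> insert i A" for j
  proof (cases "j = i")
    case True
    then have "(d * b) * f j = d * a" using ab by simp
    moreover have "d * a \<in> D" using D d ab by (intro subring_set_mult)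
    ultimately show ?thesis by metis
  next
    case False
    then have "b * (d * f j) \<in> D" using that d ab D by (auto intro: subring_intros)
    then show ?thesis by (simp add: ac_simps)
  qed
  then show ?case using D d ab by (intro bexI[of _ "d * b"]) (auto intro: subring_intros)
qed

lemma poly_common_denominator:
  assumes D: "subring_set D" and p: "p \<in> poly_set (fraction_set D)"
  shows "\<exists>d\<in>D. d \<noteq> 0 \<and> smult d p \<in> poly_set D"
proof -
  obtain d where d: "d \<in> D" "d \<noteq> 0" "\<forall>i\<in>{..degree p}. d * coeff p i \<in> D"
    using common_denominator[OF D, of "{..degree p}" "coeff p"] p by (auto simp: poly_set_def)
  have "d * coeff p i \<in> D" for i
    using d D by (cases "i \<le> degree p") (auto simp: coeff_eq_0 subring_set_zero)
  then show ?thesis using d by (auto simp: poly_set_def)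
qed

section \<open>Normal domains and separable extensions\<close>

lemma integral_over_rootI:
  "p \<in> poly_set D \<Longrightarrow> lead_coeff p = 1 \<Longrightarrow> poly p x = 0 \<Longrightarrow> integral_over D x"
  unfolding integral_over_def by blast

lemma subring_set_prod_mset:
  assumes "subring_set D" "\<And>x. x \<in># A \<Longrightarrow> f x \<in> D"
  shows "(\<Prod>x\<in>#A. f x) \<in> D"
  using assms(2) by (induction A) (auto intro: subring_set_one[OF assms(1)] subring_set_mult[OF assms(1)])

text \<open>Division by a monic polynomial divides by no coefficient, so quotient and remainder stay
  over the subring. The alternative \<open>r = 0\<close> is there because the zero polynomial has
  degree 0.\<close>

lemma monic_division:
  fixes f :: "'a::field poly"
  assumes D: "subring_set D" and f: "f \<in> poly_set D" "lead_coeff f = 1" and "p \<in> poly_set D"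
  shows "\<exists>q\<in>poly_set D. \<exists>r\<in>poly_set D. p = f * q + r \<and> (r = 0 \<or> degree r < degree f)"
  using assms(4)
proof (induction "degree p" arbitrary: p rule: less_induct)
  case less
  note P = subring_poly_set[OF D]
  show ?case
  proof (cases "p = 0 \<or> degree p < degree f")
    case True
    then show ?thesis using less P by (intro bexI[of _ 0] bexI[of _ p]) (auto intro: subring_intros)
  next
    case False
    define m where "m = monom (lead_coeff p) (degree p - degree f)"
    have m: "m \<in> poly_set D" unfolding m_def
      using less.prems D by (intro monom_in_poly_set) (auto simp: poly_set_def)
    have p': "p - f * m \<in> poly_set D" using less.prems m f P by (intro subring_intros)
    have "f \<noteq> 0" using f by auto
    have dm: "degree m = degree p - degree f" "m \<noteq> 0" "lead_coeff m = lead_coeff p"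
      unfolding m_def using False by (auto simp: degree_monom_eq)
    have dfm: "degree (f * m) = degree p" using dm \<open>f \<noteq> 0\<close> False by (simp add: degree_mult_eq)
    have lc: "lead_coeff (f * m) = lead_coeff p" using dm f by (simp add: lead_coeff_mult)
    show ?thesis
    proof (cases "p - f * m = 0")
      case True
      then show ?thesis using m P by (intro bexI[of _ m] bexI[of _ 0]) (auto intro: subring_intros)
    next
      case nz: False
      have "degree (p - f * m) < degree p"
      proof -
        have "coeff (p - f * m) (degree p) = 0" using lc dfm by simp
        moreover have "degree (p - f * m) \<le> degree p" using dfm by (metis degree_diff_le order_refl)
        ultimately show ?thesis using nz by (metis leading_coeff_0_iff order_le_less)
      qed
      from less.hyps[OF this p'] obtain q r where
        qr: "q \<in> poly_set D" "r \<in> poly_set D" "p - f * m = f * q + r" "r = 0 \<or> degree r < degree f" by auto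
      have "p = f * (q + m) + r" using qr(3) by (simp add: algebra_simps)
      then show ?thesis using qr m P by (intro bexI[of _ "q + m"] bexI[of _ r]) (auto intro: subring_set_add)
    qed
  qed
qed

text \<open>The cofactor is required to lie over \<open>F\<close> as well; plain divisibility in
  \<open>'a poly\<close> would lose this.\<close>

definition minimal_poly :: "'a::field set \<Rightarrow> 'a \<Rightarrow> 'a poly \<Rightarrow> bool" where
  "minimal_poly F x f \<longleftrightarrow> f \<in> poly_set F \<and> lead_coeff f = 1 \<and> poly f x = 0 \<and>
     (\<forall>p\<in>poly_set F. poly p x = 0 \<longrightarrow> (\<exists>q\<in>poly_set F. p = f * q))"

lemma minimal_poly_exists:
  assumes F: "subfield_set F" and "p \<in> poly_set F" "p \<noteq> 0" "poly p x = 0"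
  shows "\<exists>f. minimal_poly F x f"
proof -
  note Fs = subfield_subring[OF F]
  define Q where "Q q \<longleftrightarrow> q \<in> poly_set F \<and> q \<noteq> 0 \<and> poly q x = 0" for q
  obtain g where g: "Q g" "\<And>q. Q q \<Longrightarrow> degree g \<le> degree q"
    using assms ex_has_least_nat[of Q p degree] unfolding Q_def by blast
  define f where "f = smult (inverse (lead_coeff g)) g"
  have "inverse (lead_coeff g) \<in> F" using g F unfolding Q_def subfield_set_def poly_set_def by auto
  then have f: "f \<in> poly_set F" unfolding f_def using g Fs unfolding Q_def by (auto intro: smult_in_poly_set)
  have lf: "lead_coeff f = 1" "poly f x = 0" "degree f = degree g"
    unfolding f_def using g unfolding Q_def by auto
  have "\<exists>q\<in>poly_set F. p = f * q" if p: "p \<in> poly_set F" "poly p x = 0" for p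
  proof -
    obtain q r where qr: "q \<in> poly_set F" "r \<in> poly_set F" "p = f * q + r" "r = 0 \<or> degree r < degree f"
      using monic_division[OF Fs f lf(1) p(1)] by auto
    then have "poly r x = 0" using p lf by auto
    then have "r = 0" using g(2)[of r] qr(2,4) lf(3) unfolding Q_def by linarith
    then show ?thesis using qr by auto
  qed
  then show ?thesis using f lf unfolding minimal_poly_def by blast
qed

lemma integral_over_subfield_minimal_poly:
  assumes "subfield_set F" "integral_over F x"
  shows "\<exists>f. minimal_poly F x f"
  using assms minimal_poly_exists[OF assms(1)] unfolding integral_over_def by force

lemma minimal_poly_degree:
  assumes "minimal_poly F x f" "p \<in> poly_set F" "poly p x = 0" "p \<noteq> 0"
  shows "degree f \<le> degree p"
  using assms unfolding minimal_poly_def by (metis degree_mult_right_le mult_eq_0_iff)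

lemma minimal_poly_degree_pos:
  assumes "minimal_poly F x f"
  shows "degree f > 0"
  using assms monic_degree_pos unfolding minimal_poly_def by blast

text \<open>Each \<open>z\<close> in \<open>F[x]\<close> is itself integral over \<open>F\<close>.
  Minimality makes the constant term of its minimal polynomial nonzero, and solving for that term
  expresses \<open>inverse z\<close> as a polynomial in \<open>z\<close>.\<close>

lemma subfield_ring_adjoin:
  assumes F: "subfield_set F" and x: "integral_over F x"
  shows "subfield_set (ring_adjoin F {x})"
proof -
  note Fs = subfield_subring[OF F]
  have "inverse z \<in> ring_adjoin F {x}" if z: "z \<in> ring_adjoin F {x}" for z
  proof (cases "z = 0")
    case False
    have "integral_over F z"
      using integral_over_ring_adjoin[OF Fs noetherian_on_subfield[OF F] _ z] x by auto
    then obtain f where f: "minimal_poly F z f" using integral_over_subfield_minimal_poly[OF F] by blast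
    obtain c q where fq: "f = pCons c q" by (metis pCons_cases)
    have c: "c \<in> F" and q: "q \<in> poly_set F"
      using f unfolding fq minimal_poly_def
      by (simp_all add: pCons_in_poly_set_iff)
    have "q \<noteq> 0" using minimal_poly_degree_pos[OF f] fq by auto
    have eq: "c + z * poly q z = 0" using f unfolding fq minimal_poly_def by simp
    have "c \<noteq> 0"
    proof
      assume "c = 0"
      then have "poly q z = 0" using eq False by auto
      from minimal_poly_degree[OF f q this \<open>q \<noteq> 0\<close>] show False using \<open>q \<noteq> 0\<close> fq by simp
    qed
    have "inverse z = - (poly q z / c)" using eq False \<open>c \<noteq> 0\<close>
      by (simp add: field_simps) (metis add.commute add_eq_0_iff)
    also have "\<dots> = - (inverse c * poly q z)" by (simp add: divide_inverse)
    also have "\<dots> \<in> ring_adjoin F {x}"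
    proof -
      have "inverse c \<in> ring_adjoin F {x}" using c F ring_adjoin_base[of F "{x}"] unfolding subfield_set_def by auto
      moreover have "poly q z \<in> ring_adjoin F {x}"
        using q z poly_set_mono[OF ring_adjoin_base[of F "{x}"]] by (intro poly_in_subring subring_ring_adjoin) auto
      ultimately show ?thesis by (intro subring_set_uminus subring_set_mult subring_ring_adjoin)
    qed
    finally show ?thesis .
  qed (simp add: subring_set_zero subring_ring_adjoin)
  then show ?thesis by (simp add: subfield_set_def subring_ring_adjoin)
qed

definition normal_set :: "'a::field set \<Rightarrow> bool" where
  "normal_set D \<longleftrightarrow> (\<forall>x\<in>fraction_set D. integral_over D x \<longrightarrow> x \<in> D)"

lemma monic_roots_integral_imp_coeffs:
  fixes f :: "'a::alg_closed_field poly"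
  assumes C: "subring_set C" and "lead_coeff f = 1" "\<And>r. poly f r = 0 \<Longrightarrow> r \<in> C"
  shows "f \<in> poly_set C"
proof -
  have "f \<noteq> 0" using assms(2) by auto
  then obtain A where A: "f = (\<Prod>x\<in>#A. [:-x, 1:])"
    using alg_closed_imp_factorization[of f] assms(2) by auto
  have "[:-x, 1:] \<in> poly_set C" if "x \<in># A" for x
  proof -
    have "[:-x, 1:] dvd f" unfolding A using that by (simp add: dvd_prod_mset)
    then have "x \<in> C" using assms(3) by (simp add: poly_eq_0_iff_dvd)
    then show ?thesis using C by (intro pCons_in_poly_set const_in_poly_set subring_intros) auto
  qed
  then show ?thesis unfolding A by (intro subring_set_prod_mset subring_poly_set C)
qed

text \<open>The coefficients of a split monic polynomial are polynomial expressions in its roots,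
  hence integral; lying in the fraction field, they are in \<open>D\<close>. This plays the part of
  Gauss's lemma.\<close>

lemma normal_monic_poly:
  fixes f :: "'a::alg_closed_field poly"
  assumes D: "subring_set D" "noetherian_on D D" "normal_set D"
    and f: "f \<in> poly_set (fraction_set D)" "lead_coeff f = 1" "\<And>r. poly f r = 0 \<Longrightarrow> integral_over D r"
  shows "f \<in> poly_set D"
  using monic_roots_integral_imp_coeffs[OF subring_integral_closure[OF D(1,2)] f(2)] f D(3)
  unfolding normal_set_def poly_set_def by auto

lemma degree_sum_less_on:
  assumes "\<And>i. i \<in> A \<Longrightarrow> degree (f i) < n" "0 < n"
  shows "degree (sum f A) < n"
  using assms(1) by (induction A rule: infinite_finite_induct) (auto simp: assms(2) intro: degree_add_less)

lemma diff_dvd_power_diff: "(x - y :: 'a::comm_ring_1) dvd x ^ n - y ^ n"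
  by (simp add: power_diff_sumr2)

text \<open>Clear the denominator of an integral fraction \<open>a / b\<close> at a root of \<open>b\<close>; then, for an
  integral polynomial \<open>h\<close>, use that \<open>X ^ N - h\<close> is a monic factor of a monic polynomial over \<open>D\<close>.\<close>

theorem normal_set_ring_adjoin_transcendental:
  fixes D :: "'a::alg_closed_field set"
  assumes D: "subring_set D" "noetherian_on D D" "normal_set D"
    and y: "\<And>p. p \<in> poly_set D \<Longrightarrow> poly p y = 0 \<Longrightarrow> p = 0"
  shows "normal_set (ring_adjoin D {y})"
  unfolding normal_set_def
proof (intro ballI impI)
  fix x assume xf: "x \<in> fraction_set (ring_adjoin D {y})" and xi: "integral_over (ring_adjoin D {y}) x"
  define F where "F = fraction_set D"
  have F: "subfield_set F" "subring_set F" "D \<subseteq> F"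
    unfolding F_def using subfield_fraction_set fraction_set_base D(1) subfield_subring by auto
  note PF = subring_poly_set[OF F(2)]
  have PDF: "poly_set D \<subseteq> poly_set F" by (rule poly_set_mono[OF F(3)])
  have yF: "p = 0" if p: "p \<in> poly_set F" "poly p y = 0" for p
  proof -
    obtain d where d: "d \<in> D" "d \<noteq> 0" "smult d p \<in> poly_set D"
      using poly_common_denominator[OF D(1), of p] p unfolding F_def by auto
    have "smult d p = 0" using y[OF d(3)] p by simp
    then show ?thesis using d by simp
  qed
  obtain p where p: "p \<in> poly_set (ring_adjoin D {y})" "lead_coeff p = 1" "poly p x = 0"
    using xi unfolding integral_over_def by auto
  define m where "m = degree p"
  have "m > 0" unfolding m_def using p(2,3) by (rule monic_degree_pos)
  have "\<forall>i. \<exists>c\<in>poly_set D. coeff p i = poly c y"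
    using p(1) unfolding ring_adjoin_single[OF D(1)] poly_set_def[of "_ ` _"] by auto
  then obtain c0 where c0: "\<And>i. c0 i \<in> poly_set D" "\<And>i. coeff p i = poly (c0 i) y" by metis
  \<comment> \<open>\<open>c0 m\<close> is only chosen to have the value 1 at \<open>y\<close>; the
    constant 1 makes the top term of the equation a pure power.\<close>
  define c where "c = c0 (m := 1)"
  have c: "\<And>i. c i \<in> poly_set D" "\<And>i. coeff p i = poly (c i) y" "c m = 1"
    using c0 p(2) subring_set_one[OF subring_poly_set[OF D(1)]] unfolding c_def m_def by auto
  have homog: "(\<Sum>i\<le>m. c i * a ^ i * b ^ (m - i)) = 0"
    if ab: "a \<in> poly_set F" "b \<in> poly_set F" "x * poly b y = poly a y" for a b
  proof (rule yF)
    show "(\<Sum>i\<le>m. c i * a ^ i * b ^ (m - i)) \<in> poly_set F"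
      using ab c PDF PF by (intro subring_set_sum subring_set_mult subring_set_power) auto
    have "poly (\<Sum>i\<le>m. c i * a ^ i * b ^ (m - i)) y
        = (\<Sum>i\<le>m. coeff p i * (x * poly b y) ^ i * poly b y ^ (m - i))"
      by (simp add: poly_sum c ab)
    also have "\<dots> = (\<Sum>i\<le>m. coeff p i * x ^ i * poly b y ^ m)"
    proof (rule sum.cong[OF refl])
      fix i assume "i \<in> {..m}"
      then have "poly b y ^ i * poly b y ^ (m - i) = poly b y ^ m" by (simp flip: power_add)
      then show "coeff p i * (x * poly b y) ^ i * poly b y ^ (m - i) = coeff p i * x ^ i * poly b y ^ m"
        by (simp add: power_mult_distrib mult.assoc)
    qed
    also have "\<dots> = poly p x * poly b y ^ m" by (simp add: poly_altdef m_def sum_distrib_right)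
    finally show "poly (\<Sum>i\<le>m. c i * a ^ i * b ^ (m - i)) y = 0" using p by simp
  qed
  \<comment> \<open>Least degree of the denominator replaces reduction to lowest terms.\<close>
  define Q where "Q ab \<longleftrightarrow> fst ab \<in> poly_set F \<and> snd ab \<in> poly_set F \<and> snd ab \<noteq> 0 \<and>
    x * poly (snd ab) y = poly (fst ab) y" for ab
  obtain a0 b0 where ab0: "a0 \<in> poly_set D" "b0 \<in> poly_set D" "poly b0 y \<noteq> 0" "x = poly a0 y / poly b0 y"
    using xf unfolding ring_adjoin_single[OF D(1)] by (auto elim!: fraction_setE)
  then have "Q (a0, b0)" using PDF unfolding Q_def by auto
  then obtain ab where ab: "Q ab" "\<And>ab'. Q ab' \<Longrightarrow> degree (snd ab) \<le> degree (snd ab')"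
    using ex_has_least_nat[of Q "(a0, b0)" "\<lambda>ab. degree (snd ab)"] by blast
  obtain a b where ab_eq: "ab = (a, b)" by (cases ab)
  have a: "a \<in> poly_set F" and b: "b \<in> poly_set F" "b \<noteq> 0" and xab: "x * poly b y = poly a y"
    using ab(1) unfolding Q_def ab_eq by auto
  have "degree b = 0"
  proof (rule ccontr)
    assume "degree b \<noteq> 0"
    \<comment> \<open>At a root of \<open>b\<close> the homogenized equation collapses to
      \<open>a ^ m = 0\<close>, so \<open>a\<close> vanishes there too. The minimal polynomial of
      the root cancels from both, against the minimality of the degree of \<open>b\<close>.\<close>
    then obtain \<beta> where \<beta>: "poly b \<beta> = 0" using alg_closed_imp_poly_has_root by blast
    have "0 = poly (\<Sum>i\<le>m. c i * a ^ i * b ^ (m - i)) \<beta>" using homog[OF a b(1) xab] by simp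
    also have "\<dots> = (\<Sum>i\<le>m. if i = m then poly a \<beta> ^ m else 0)"
      unfolding poly_sum by (intro sum.cong) (auto simp: \<beta> c)
    also have "\<dots> = poly a \<beta> ^ m" by simp
    finally have a\<beta>: "poly a \<beta> = 0" by simp
    obtain f where f: "minimal_poly F \<beta> f" using minimal_poly_exists[OF F(1) b \<beta>] by blast
    obtain a' b' where a'b': "a' \<in> poly_set F" "b' \<in> poly_set F" "a = f * a'" "b = f * b'"
      using f a b \<beta> a\<beta> unfolding minimal_poly_def by metis
    have "f \<noteq> 0" "b' \<noteq> 0" using a'b' b by auto
    then have "poly f y \<noteq> 0" using yF f unfolding minimal_poly_def by blast
    then have "x * poly b' y = poly a' y" using xab unfolding a'b' by simp
    then have "Q (a', b')" using a'b' \<open>b' \<noteq> 0\<close> unfolding Q_def by auto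
    then have "degree b \<le> degree b'" using ab unfolding ab_eq by fastforce
    then show False using minimal_poly_degree_pos[OF f] \<open>f \<noteq> 0\<close> \<open>b' \<noteq> 0\<close>
      unfolding a'b' by (simp add: degree_mult_eq)
  qed
  then obtain e where e: "b = [:e:]" by (rule degree_eq_zeroE)
  have "e \<noteq> 0" "e \<in> F" using b e by (auto simp: poly_set_def dest: spec[of _ 0])
  define h where "h = smult (inverse e) a"
  have h: "h \<in> poly_set F" unfolding h_def using a F \<open>e \<in> F\<close>
    by (intro smult_in_poly_set) (auto simp: subfield_set_def)
  have xh: "x = poly h y" using xab \<open>e \<noteq> 0\<close> unfolding h_def e by (simp add: field_simps)
  have h0: "(\<Sum>i\<le>m. c i * h ^ i) = 0"
    using homog[OF h, of 1] xh PF by (simp add: subring_set_one)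
  \<comment> \<open>\<open>N\<close> exceeds the degree of \<open>h\<close>, so that
    \<open>X ^ N - h\<close> is monic, and the degrees of all \<open>c i\<close>, so that in
    \<open>H\<close> the term with \<open>i = m\<close> dominates and \<open>H\<close> is
    monic.\<close>
  define N where "N = Suc (degree h + (\<Sum>i\<le>m. degree (c i)))"
  have Nc: "degree (c i) < N" if "i \<le> m" for i
    unfolding N_def using member_le_sum[of i "{..m}" "\<lambda>i. degree (c i)"] that by auto
  define H where "H = (\<Sum>i\<le>m. c i * monom 1 N ^ i)"
  have Hm: "H = (\<Sum>i<m. c i * monom 1 N ^ i) + monom 1 (N * m)"
    unfolding H_def by (simp add: lessThan_Suc_atMost[symmetric] c monom_power mult.commute)
  have "degree (\<Sum>i<m. c i * monom 1 N ^ i) < N * m"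
  proof (rule degree_sum_less_on)
    fix i assume "i \<in> {..<m}"
    then have i: "i < m" by simp
    have "degree (c i * monom 1 N ^ i) \<le> degree (c i) + N * i"
      by (rule order_trans[OF degree_mult_le]) (auto simp: monom_power degree_monom_eq mult.commute)
    also have "\<dots> < N + N * i" using Nc i by simp
    also have "\<dots> \<le> N * m" using mult_le_mono2[of "Suc i" m N] i by simp
    finally show "degree (c i * monom 1 N ^ i) < N * m" .
  qed (use \<open>m > 0\<close> N_def in auto)
  then have lH: "lead_coeff H = 1"
    unfolding Hm by (subst lead_coeff_add_le) (auto simp: degree_monom_eq)
  have HD: "H \<in> poly_set D" unfolding H_def
    using c D by (intro subring_set_sum subring_set_mult subring_set_power subring_poly_set
      monom_in_poly_set subring_set_one) auto
  define f where "f = monom 1 N - h"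
  have fH: "f dvd H"
  proof -
    have "H = (\<Sum>i\<le>m. c i * (monom 1 N ^ i - h ^ i))"
      using h0 unfolding H_def by (simp add: right_diff_distrib sum_subtractf)
    also have "f dvd \<dots>"
      unfolding f_def by (intro dvd_sum dvd_mult diff_dvd_power_diff)
    finally show ?thesis .
  qed
  have "degree h < N" unfolding N_def by simp
  then have "lead_coeff (- h + monom 1 N) = 1" by (subst lead_coeff_add_le) (auto simp: degree_monom_eq)
  then have lf: "lead_coeff f = 1" unfolding f_def by simp
  have "f \<in> poly_set D"
  proof (rule normal_monic_poly[OF D _ lf])
    show "f \<in> poly_set (fraction_set D)"
      using h F unfolding f_def F_def[symmetric]
      by (intro subring_set_diff PF monom_in_poly_set subring_set_one)
    fix r assume "poly f r = 0"
    then have "poly H r = 0" using fH by (metis dvdE mult_zero_left poly_mult)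
    then show "integral_over D r" using HD lH by (rule integral_over_rootI[rotated 2])
  qed
  then have "monom 1 N - f \<in> poly_set D"
    using D by (intro subring_set_diff subring_poly_set monom_in_poly_set subring_set_one)
  then have "h \<in> poly_set D" by (simp add: f_def)
  then show "x \<in> ring_adjoin D {y}" unfolding xh ring_adjoin_single[OF D(1)] by auto
qed

text \<open>Asking for some polynomial with \<open>x\<close> as a simple root, not for a property of
  the minimal polynomial, makes the notion visibly stable under enlarging \<open>F\<close> and under
  additive powers. The minimal polynomial divides \<open>g\<close>, so its own derivative cannot
  vanish at \<open>x\<close>.\<close>

definition separable_over :: "'a::field set \<Rightarrow> 'a \<Rightarrow> bool" where
  "separable_over F x \<longleftrightarrow> (\<exists>g\<in>poly_set F. poly g x = 0 \<and> poly (pderiv g) x \<noteq> 0)"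

text \<open>The polynomial \<open>S\<close> is \<open>\<Sum>x\<in>#A. g x * P / (X - x)\<close> for \<open>P = \<Prod>x\<in>#A. (X - x)\<close>.\<close>

lemma pderiv_mult_mod_split:
  fixes g :: "'a::field poly"
  assumes C: "subring_set C" and "\<And>x. x \<in># A \<Longrightarrow> x \<in> C \<and> poly g x \<in> C"
  shows "(\<Prod>x\<in>#A. [:-x, 1:]) \<in> poly_set C \<and> (\<exists>S\<in>poly_set C. (S = 0 \<or> degree S < size A) \<and>
    (\<Prod>x\<in>#A. [:-x, 1:]) dvd pderiv (\<Prod>x\<in>#A. [:-x, 1:]) * g - S)"
  using assms(2)
proof (induction A)
  case empty
  then show ?case using subring_poly_set[OF C] by (auto intro: subring_intros)
next
  case (add x A)
  let ?P = "\<Prod>x\<in>#A. [:-x, 1:]" and ?L = "[:-x, 1:]"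
  from add obtain S where S: "S \<in> poly_set C" "S = 0 \<or> degree S < size A" "?P dvd pderiv ?P * g - S"
    and P: "?P \<in> poly_set C" by auto
  have x: "x \<in> C" "poly g x \<in> C" using add.prems by auto
  have L: "?L \<in> poly_set C" using x C by (intro pCons_in_poly_set const_in_poly_set subring_intros) auto
  define S' where "S' = smult (poly g x) ?P + ?L * S"
  have degP: "degree ?P = size A"
  proof (induction A)
    case (add y A)
    have "(\<Prod>x\<in>#A. [:-x, 1:]) \<noteq> 0" by (auto simp: prod_mset_zero_iff)
    then show ?case using add by (simp add: degree_mult_eq del: mult_pCons_left)
  qed simp
  have dS: "S' = 0 \<or> degree S' < size (add_mset x A)"
  proof -
    have "degree (smult (poly g x) ?P) \<le> size A" using degP by (metis degree_smult_le)
    moreover have "degree (?L * S) \<le> size A"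
    proof (cases "S = 0")
      case False
      then have "degree (?L * S) = Suc (degree S)" by (subst degree_mult_eq) auto
      then show ?thesis using S(2) False by simp
    qed simp
    ultimately have "degree S' \<le> size A" unfolding S'_def by (rule degree_add_le)
    then show ?thesis by simp
  qed
  have "?L dvd g - [:poly g x:]" by (simp add: dvd_iff_poly_eq_0)
  then have "?L * ?P dvd (g - [:poly g x:]) * ?P" by (rule mult_dvd_mono) simp
  moreover have "?L * ?P dvd ?L * (pderiv ?P * g - S)" using S(3) by (rule mult_dvd_mono[OF dvd_refl])
  ultimately have "?L * ?P dvd (g - [:poly g x:]) * ?P + ?L * (pderiv ?P * g - S)" by (rule dvd_add)
  also have "(g - [:poly g x:]) * ?P + ?L * (pderiv ?P * g - S) = pderiv (?L * ?P) * g - S'"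
  proof -
    have "pderiv (?L * ?P) = ?L * pderiv ?P + ?P"
      by (simp only: pderiv_mult) (simp add: pderiv_pCons)
    moreover have "smult (poly g x) ?P = [:poly g x:] * ?P" by simp
    ultimately show ?thesis unfolding S'_def by (simp only: algebra_simps)
  qed
  finally have "?L * ?P dvd pderiv (?L * ?P) * g - S'" .
  moreover have "S' \<in> poly_set C" unfolding S'_def
    using C x P L S by (intro subring_set_add subring_set_mult smult_in_poly_set subring_poly_set)
  moreover have "?L * ?P \<in> poly_set C" using C L P by (intro subring_set_mult subring_poly_set)
  moreover have "(\<Prod>x\<in>#add_mset x A. [:-x, 1:]) = ?L * ?P"
    by (simp only: image_mset_add_mset prod_mset.add_mset)
  ultimately show ?case using dS by metis
qed

text \<open>For the minimal polynomial \<open>f\<close> of \<open>x\<close> and an integral \<open>h = g(x)\<close>, the remainder of \<open>f' g\<close>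
  modulo \<open>f\<close> has coefficients that are both in the fraction field and integral; hence
  \<open>f'(x) h \<in> D[x]\<close>.\<close>

theorem integral_closure_separable_simple:
  fixes D :: "'a::alg_closed_field set"
  assumes D: "subring_set D" "noetherian_on D D" "normal_set D"
    and x: "integral_over D x" "separable_over (fraction_set D) x"
  shows "\<exists>G. finite G \<and> {h \<in> fraction_set (ring_adjoin D {x}). integral_over D h} \<subseteq> lin_span D G"
proof -
  define F where "F = fraction_set D"
  have F: "subfield_set F" "subring_set F" "D \<subseteq> F"
    unfolding F_def using subfield_fraction_set fraction_set_base D(1) subfield_subring by auto
  note PF = subring_poly_set[OF F(2)]
  have xF: "integral_over F x" using x(1) F(3) by (rule integral_over_mono)
  obtain f where f: "minimal_poly F x f" using integral_over_subfield_minimal_poly[OF F(1) xF] by blast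
  then have fF: "f \<in> poly_set F" "lead_coeff f = 1" "poly f x = 0" unfolding minimal_poly_def by auto
  have fd: "f dvd p" if "p \<in> poly_set F" "poly p x = 0" for p
    using f that unfolding minimal_poly_def by (metis dvd_triv_left)
  define \<delta> where "\<delta> = poly (pderiv f) x"
  have "\<delta> \<noteq> 0"
  proof
    assume "\<delta> = 0"
    from x(2) obtain g where g: "g \<in> poly_set F" "poly g x = 0" "poly (pderiv g) x \<noteq> 0"
      unfolding separable_over_def F_def by auto
    obtain w where "g = f * w" using fd g by (metis dvdE)
    then have "poly (pderiv g) x = 0" using fF \<open>\<delta> = 0\<close> by (simp add: pderiv_mult \<delta>_def)
    then show False using g by simp
  qed
  obtain P where P: "P \<in> poly_set D" "lead_coeff P = 1" "poly P x = 0"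
    using x(1) unfolding integral_over_def by auto
  have "f dvd P" using fd P poly_set_mono[OF F(3)] by auto
  then have rootD: "integral_over D r" if "poly f r = 0" for r
    using that P(1,2) by (intro integral_over_rootI[of P]) (auto elim!: dvdE)
  have fD: "f \<in> poly_set D" by (rule normal_monic_poly[OF D fF(1)[unfolded F_def] fF(2) rootD])
  have "f \<noteq> 0" using fF by auto
  then obtain A where A: "size A = degree f" "f = (\<Prod>x\<in>#A. [:-x, 1:])"
    using alg_closed_imp_factorization[of f] fF by auto
  have rootA: "poly f r = 0" if "r \<in># A" for r
  proof -
    have "[:-r, 1:] dvd f" unfolding A(2) using that by (simp add: dvd_prod_mset)
    then show ?thesis by (simp add: poly_eq_0_iff_dvd)
  qed
  define W where "W = (\<lambda>i. x ^ i) ` {..<degree f}"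
  have adj: "ring_adjoin D {x} \<subseteq> lin_span D W"
    unfolding W_def by (rule ring_adjoin_integral_span[OF D(1) fD fF(2,3)])
  have key: "\<delta> * h \<in> lin_span D W" if h: "h \<in> fraction_set (ring_adjoin D {x})" "integral_over D h" for h
  proof -
    have "fraction_set (ring_adjoin D {x}) \<subseteq> ring_adjoin F {x}"
      using subfield_ring_adjoin[OF F(1) xF] ring_adjoin_mono[OF F(3) order_refl] by (rule fraction_set_least)
    then obtain g where g: "g \<in> poly_set F" "h = poly g x"
      using h unfolding ring_adjoin_single[OF F(2)] by auto
    obtain Q where Q: "Q \<in> poly_set D" "lead_coeff Q = 1" "poly Q h = 0"
      using h(2) unfolding integral_over_def by auto
    \<comment> \<open>\<open>Q(g(X))\<close> vanishes at \<open>x\<close>, hence at all conjugates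
      of \<open>x\<close>; so the values of \<open>g\<close> at the roots of \<open>f\<close>, the
      conjugates of \<open>h\<close>, are integral too.\<close>
    have "f dvd pcompose Q g"
      using Q g F poly_set_mono[OF F(3)] by (intro fd pcompose_in_poly_set) (auto simp: poly_pcompose)
    then have gr: "integral_over D (poly g r)" if "r \<in># A" for r
      using Q rootA[OF that] by (intro integral_over_rootI[of Q]) (auto simp flip: poly_pcompose elim!: dvdE)
    obtain S where S: "S \<in> poly_set {z. integral_over D z}" "S = 0 \<or> degree S < degree f"
      "f dvd pderiv f * g - S"
      using pderiv_mult_mod_split[OF subring_integral_closure[OF D(1,2)], of A g] rootA rootD gr
      unfolding A(1) A(2)[symmetric] by blast
    obtain q r where qr: "q \<in> poly_set F" "r \<in> poly_set F" "pderiv f * g = f * q + r" "r = 0 \<or> degree r < degree f"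
      using monic_division[OF F(2) fF(1,2), of "pderiv f * g"] g fF PF
      by (metis F(2) pderiv_in_poly_set subring_set_mult)
    have "f dvd r - S"
    proof -
      have "r - S = (pderiv f * g - S) - f * q" using qr(3) by simp
      then show ?thesis using S(3) by (metis dvd_diff dvd_triv_left)
    qed
    moreover have "r - S = 0 \<or> degree (r - S) < degree f"
      using S(2) qr(4) degree_diff_less[of r "degree f" S] by auto
    ultimately have "r = S" by (metis dvd_imp_degree_le eq_iff_diff_eq_0 linorder_not_less)
    then have "S \<in> poly_set D" using S(1) qr(2) D(3) unfolding F_def normal_set_def poly_set_def by auto
    then have "poly S x \<in> ring_adjoin D {x}" unfolding ring_adjoin_single[OF D(1)] by auto
    moreover have "poly S x = \<delta> * h"
      using arg_cong[OF qr(3), of "\<lambda>p. poly p x"] fF g \<open>r = S\<close> by (simp add: \<delta>_def)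
    ultimately show ?thesis using adj by auto
  qed
  have scale: "z / \<delta> \<in> lin_span D ((\<lambda>w. w / \<delta>) ` W)" if "z \<in> lin_span D W" for z
    using that
  proof induction
    case (step c w z)
    then have "c * (w / \<delta>) + z / \<delta> \<in> lin_span D ((\<lambda>w. w / \<delta>) ` W)" by (intro lin_span.step) auto
    then show ?case by (simp add: add_divide_distrib)
  qed (simp add: lin_span.zero)
  have "h \<in> lin_span D ((\<lambda>w. w / \<delta>) ` W)"
    if "h \<in> fraction_set (ring_adjoin D {x})" "integral_over D h" for h
    using scale[OF key[OF that]] \<open>\<delta> \<noteq> 0\<close> by simp
  moreover have "finite W" unfolding W_def by simp
  ultimately show ?thesis by (intro exI[of _ "(\<lambda>w. w / \<delta>) ` W"]) auto
qed

text \<open>Elements are adjoined one at a time, each ring being replaced by its integral closure in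
  the enlarged fraction field. This keeps every stage normal and inside a finite
  \<open>D\<close>-module, hence Noetherian, as the simple case demands.\<close>

theorem integral_closure_separable:
  fixes D :: "'a::alg_closed_field set"
  assumes D: "subring_set D" "noetherian_on D D" "normal_set D"
    and "finite V" "\<And>x. x \<in> V \<Longrightarrow> integral_over D x" "\<And>x. x \<in> V \<Longrightarrow> separable_over (fraction_set D) x"
  shows "\<exists>E. subring_set E \<and> normal_set E \<and> D \<subseteq> E \<and> V \<subseteq> E \<and> (\<exists>G. finite G \<and> E \<subseteq> lin_span D G)"
  using assms(4-6)
proof (induction V)
  case empty
  have "D \<subseteq> lin_span D {1}" by (rule subring_lin_span_one[OF D(1)])
  then show ?case using D by blast
next
  case (insert x V)
  then obtain E G where E: "subring_set E" "normal_set E" "D \<subseteq> E" "V \<subseteq> E" and G: "finite G" "E \<subseteq> lin_span D G"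
    by auto
  have "noetherian_on D E" using noetherian_on_lin_span[OF D(1,2) G(1)] G(2) by (rule noetherian_on_subset)
  then have NE: "noetherian_on E E" using E(3) by (rule noetherian_on_mono)
  have "poly_set (fraction_set D) \<subseteq> poly_set (fraction_set E)"
    by (intro poly_set_mono fraction_set_mono E(3))
  then have sep: "separable_over (fraction_set E) x"
    using insert.prems(2)[of x] unfolding separable_over_def by blast
  have int: "integral_over E x" using insert.prems(1)[of x] E(3) integral_over_mono by blast
  define K where "K = fraction_set (ring_adjoin E {x})"
  have K: "subfield_set K" "ring_adjoin E {x} \<subseteq> K"
    unfolding K_def using subfield_fraction_set fraction_set_base subring_ring_adjoin by blast+
  define E' where "E' = {h \<in> K. integral_over E h}"
  obtain G' where G': "finite G'" "E' \<subseteq> lin_span E G'"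
    using integral_closure_separable_simple[OF E(1) NE E(2) int sep] unfolding E'_def K_def by auto
  have E's: "subring_set E'"
    using subring_integral_closure[OF E(1) NE] subfield_subring[OF K(1)]
    unfolding E'_def subring_set_def by auto
  have EE': "E \<subseteq> E'" using K ring_adjoin_base[of E "{x}"] integral_over_base[OF E(1)] unfolding E'_def by auto
  have xE': "x \<in> E'" using K ring_adjoin_gen[of "{x}" E] int unfolding E'_def by auto
  have "normal_set E'" unfolding normal_set_def
  proof (intro ballI impI)
    fix z assume z: "z \<in> fraction_set E'" "integral_over E' z"
    have "fraction_set E' \<subseteq> K" by (rule fraction_set_least[OF K(1)]) (auto simp: E'_def)
    moreover have "integral_over E z" by (rule integral_over_trans[OF E(1) NE _ z(2)]) (simp add: E'_def)
    ultimately show "z \<in> E'" using z unfolding E'_def by auto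
  qed
  moreover have "E' \<subseteq> lin_span D {g * p | g p. g \<in> G \<and> p \<in> G'}"
    using G'(2) lin_span_tower[OF D(1) G(2)] by blast
  moreover have "finite {g * p | g p. g \<in> G \<and> p \<in> G'}" using G(1) G'(1) by (intro finite_image_set2) auto
  ultimately show ?case using E's EE' E(3,4) xE' by (intro exI[of _ E']) blast
qed

section \<open>Noether normalization and finiteness of integral closure\<close>

text \<open>Holds for 1 in every characteristic and for the powers of a positive characteristic, so
  characteristic 0 needs no separate argument.\<close>

definition additive_power :: "'a::field itself \<Rightarrow> nat \<Rightarrow> bool" where
  "additive_power T q \<longleftrightarrow> q > 0 \<and> (\<forall>x y::'a. (x + y) ^ q = x ^ q + y ^ q)"

context
  fixes q :: nat
  assumes q: "additive_power TYPE('a::field) q"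
begin

lemma additive_power_pos: "q > 0"
  using q by (simp add: additive_power_def)

lemma additive_power_add: "((x::'a) + y) ^ q = x ^ q + y ^ q"
  using q by (simp add: additive_power_def)

lemma additive_power_uminus: "(- (x::'a)) ^ q = - (x ^ q)"
proof -
  have "x ^ q + (- x) ^ q = 0" using additive_power_add[of x "-x"] additive_power_pos by (simp add: power_0_left)
  then show ?thesis by (simp add: eq_neg_iff_add_eq_0 add.commute)
qed

lemma additive_power_of_nat: "(of_nat n :: 'a) ^ q = of_nat n"
  by (induction n) (use additive_power_pos in \<open>auto simp: additive_power_add\<close>)

lemma additive_power_sum: "(\<Sum>i\<in>A. f i :: 'a) ^ q = (\<Sum>i\<in>A. f i ^ q)"
  by (induction A rule: infinite_finite_induct) (use additive_power_pos in \<open>auto simp: additive_power_add\<close>)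

lemma additive_power_inj: "(x::'a) ^ q = y ^ q \<Longrightarrow> x = y"
  using additive_power_add[of x "-y"] additive_power_uminus[of y] additive_power_pos by auto

lemma subring_power_image:
  fixes D :: "'a set"
  assumes "subring_set D"
  shows "subring_set ((\<lambda>x. x ^ q) ` D)"
  using assms
  by (intro subring_setI)
     (auto simp flip: additive_power_add additive_power_uminus power_mult_distrib
       intro: subring_intros intro!: imageI image_eqI[of 1 _ 1])

lemma subring_power_vimage:
  fixes D :: "'a set"
  assumes "subring_set D"
  shows "subring_set {x. x ^ q \<in> D}"
  using assms
  by (intro subring_setI) (auto simp: additive_power_add additive_power_uminus power_mult_distrib
       intro: subring_intros)

text \<open>Raising the coefficients of \<open>g\<close> to the \<open>q\<close>-th power gives a
  polynomial whose value at \<open>x ^ q\<close> is \<open>g(x) ^ q\<close>. The operation commutes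
  with derivatives because natural numbers are fixed by \<open>q\<close>-th powers.\<close>

lemma separable_over_power:
  fixes F :: "'a set"
  assumes F: "subring_set F" and "separable_over F x"
  shows "separable_over F (x ^ q)"
proof -
  from assms obtain g where g: "g \<in> poly_set F" "poly g x = 0" "poly (pderiv g) x \<noteq> 0"
    unfolding separable_over_def by auto
  have coeff: "coeff (map_poly (\<lambda>c. c ^ q) p) i = coeff p i ^ q" for p :: "'a poly" and i
    using additive_power_pos by (simp add: coeff_map_poly)
  have ev: "poly (map_poly (\<lambda>c. c ^ q) p) (x ^ q) = poly p x ^ q" for p
  proof -
    have deg: "degree (map_poly (\<lambda>c. c ^ q) p) \<le> degree p" by (rule map_poly_degree_leq)
    have "poly (map_poly (\<lambda>c. c ^ q) p) (x ^ q) = (\<Sum>i\<le>degree p. coeff p i ^ q * (x ^ q) ^ i)"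
      unfolding poly_altdef coeff[symmetric] using deg
      by (intro sum.mono_neutral_left) (auto simp: coeff_eq_0)
    also have "\<dots> = poly p x ^ q"
      by (simp add: poly_altdef additive_power_sum power_mult_distrib flip: power_mult)
         (simp add: mult.commute)
    finally show ?thesis .
  qed
  have "pderiv (map_poly (\<lambda>c. c ^ q) g) = map_poly (\<lambda>c. c ^ q) (pderiv g)"
    by (intro poly_eqI) (simp add: coeff coeff_pderiv power_mult_distrib additive_power_of_nat del: of_nat_Suc)
  moreover have "map_poly (\<lambda>c. c ^ q) g \<in> poly_set F"
    using g F by (auto simp: poly_set_def coeff intro: subring_set_power)
  ultimately show ?thesis using g ev[of g] ev[of "pderiv g"] additive_power_pos
    unfolding separable_over_def by (intro bexI[of _ "map_poly (\<lambda>c. c ^ q) g"]) auto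
qed

end

lemma additive_power_1: "additive_power TYPE('a::field) 1"
  by (simp add: additive_power_def)

lemma additive_power_mult:
  assumes "additive_power TYPE('a::field) q" "additive_power TYPE('a) r"
  shows "additive_power TYPE('a) (q * r)"
  using assms unfolding additive_power_def by (simp add: power_mult)

lemma additive_power_prod:
  assumes "\<And>i. i \<in> A \<Longrightarrow> additive_power TYPE('a::field) (f i)"
  shows "additive_power TYPE('a) (prod f A)"
  using assms by (induction A rule: infinite_finite_induct) (auto intro: additive_power_1[simplified] additive_power_mult)

lemma additive_power_CHAR:
  assumes "CHAR('a::field) > 0"
  shows "additive_power TYPE('a) CHAR('a)"
  unfolding additive_power_def using assms prime_CHAR_semidom[OF assms] freshmans_dream by blast

text \<open>If the derivative of the minimal polynomial \<open>g\<close> vanishes at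
  \<open>x\<close>, it is zero, so \<open>g(X) = h(X ^ p)\<close>; then \<open>h\<close> has smaller
  degree and annihilates \<open>x ^ p\<close>.\<close>

lemma separable_over_some_power:
  fixes x :: "'a::field"
  assumes F: "subfield_set F" and "f \<in> poly_set F" "f \<noteq> 0" "poly f x = 0"
  shows "\<exists>q. additive_power TYPE('a) q \<and> separable_over F (x ^ q)"
  using assms(2-)
proof (induction "degree f" arbitrary: f x rule: less_induct)
  case less
  note Fs = subfield_subring[OF F]
  obtain g where g: "minimal_poly F x g" using minimal_poly_exists[OF F less.prems] by blast
  then have gF: "g \<in> poly_set F" "poly g x = 0" "lead_coeff g = 1" "g \<noteq> 0" unfolding minimal_poly_def by auto
  define n where "n = degree g"
  have n: "n > 0" "n \<le> degree f"
    unfolding n_def using minimal_poly_degree_pos[OF g] minimal_poly_degree[OF g less.prems(1,3,2)] by auto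
  show ?case
  proof (cases "poly (pderiv g) x = 0")
    case False
    then have "separable_over F (x ^ 1)" using gF unfolding separable_over_def by auto
    then show ?thesis using additive_power_1 by blast
  next
    case True
    have "pderiv g = 0"
    proof (rule ccontr)
      assume "pderiv g \<noteq> 0"
      from minimal_poly_degree[OF g pderiv_in_poly_set[OF Fs gF(1)] True this]
      have "n \<le> degree (pderiv g)" unfolding n_def .
      moreover have "degree (pderiv g) \<le> n - 1"
        unfolding n_def by (rule degree_le) (auto simp: coeff_pderiv coeff_eq_0)
      ultimately show False using n by simp
    qed
    then have der: "of_nat (Suc i) * coeff g (Suc i) = 0" for i by (metis coeff_0 coeff_pderiv)
    define p where "p = CHAR('a)"
    have pdvd: "p dvd i" if "coeff g i \<noteq> 0" for i
    proof (cases i)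
      case (Suc j)
      then have "of_nat i = (0::'a)" using der[of j] that by auto
      then show ?thesis unfolding p_def by (simp add: of_nat_eq_0_iff_char_dvd)
    qed simp
    have "p dvd n" using pdvd[of n] gF unfolding n_def by simp
    \<comment> \<open>In characteristic 0 divisibility by \<open>p = 0\<close> would force
      \<open>n = 0\<close>, so this case occurs only in positive characteristic.\<close>
    then have p0: "p > 0" using n by (auto intro: gr0I)
    then have "prime p" unfolding p_def by (rule prime_CHAR_semidom)
    then have p2: "p \<ge> 2" by (rule prime_ge_2_nat)
    have add_p: "additive_power TYPE('a) p" using p0 unfolding p_def by (rule additive_power_CHAR)
    define h where "h = (\<Sum>i\<le>n. monom (coeff g (p * i)) i)"
    have hF: "h \<in> poly_set F" unfolding h_def using gF Fs
      by (intro subring_set_sum subring_poly_set monom_in_poly_set) (auto simp: poly_set_def)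
    have big: "coeff g (p * i) = 0" if "i \<ge> n" for i
    proof -
      have "n < p * n" using p2 n by simp
      also have "\<dots> \<le> p * i" using that by simp
      finally show ?thesis unfolding n_def by (rule coeff_eq_0)
    qed
    have hcoeff: "coeff h i = coeff g (p * i)" for i
      unfolding h_def using big[of i] by (auto simp: coeff_sum)
    have "degree h \<le> n - 1" by (rule degree_le) (use big in \<open>auto simp: hcoeff\<close>)
    then have dh: "degree h < degree f" using n by simp
    obtain k where k: "n = p * k" using \<open>p dvd n\<close> by auto
    have "coeff h k = 1" using gF unfolding hcoeff k[symmetric] n_def by simp
    then have "h \<noteq> 0" by auto
    have "poly h (x ^ p) = (\<Sum>i\<le>n. coeff g (p * i) * x ^ (p * i))"
      unfolding h_def by (simp add: poly_sum poly_monom power_mult)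
    also have "\<dots> = (\<Sum>j\<in>(\<lambda>i. p * i) ` {..n}. coeff g j * x ^ j)"
      by (subst sum.reindex) (use p0 in \<open>auto intro: inj_onI\<close>)
    also have "\<dots> = (\<Sum>j\<le>p * n. coeff g j * x ^ j)"
    proof (rule sum.mono_neutral_left)
      show "\<forall>j\<in>{..p * n} - (*) p ` {..n}. coeff g j * x ^ j = 0"
      proof
        fix j assume j: "j \<in> {..p * n} - (*) p ` {..n}"
        have "\<not> p dvd j" using j p0 by (auto elim!: dvdE)
        then show "coeff g j * x ^ j = 0" using pdvd[of j] by auto
      qed
    qed auto
    also have "\<dots> = poly g x"
      unfolding poly_altdef using p0 n
      by (intro sum.mono_neutral_right) (auto simp: n_def coeff_eq_0 intro: order_trans)
    finally have "poly h (x ^ p) = 0" using gF by simp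
    from less.hyps[OF dh hF \<open>h \<noteq> 0\<close> this] obtain q where
      "additive_power TYPE('a) q" "separable_over F ((x ^ p) ^ q)" by auto
    then show ?thesis using additive_power_mult[OF add_p]
      by (intro exI[of _ "p * q"]) (auto simp: power_mult)
  qed
qed

section \<open>Algebraic dependence and Noether normalization\<close>

lemma noetherian_ring_adjoin_subfield:
  "subfield_set K \<Longrightarrow> finite V \<Longrightarrow> noetherian_on (ring_adjoin K V) (ring_adjoin K V)"
  using noetherian_ring_adjoin noetherian_on_subfield subfield_subring by blast

definition monomial_at :: "nat \<Rightarrow> (nat \<Rightarrow> 'a::comm_ring_1) \<Rightarrow> (nat \<Rightarrow> nat) \<Rightarrow> 'a" where
  "monomial_at n x m = (\<Prod>i<n. x i ^ m i)"

definition exponents :: "nat \<Rightarrow> (nat \<Rightarrow> nat) set" where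
  "exponents n = {m. \<forall>i\<ge>n. m i = 0}"

text \<open>A nonzero polynomial is given by its support \<open>M\<close> and its nonzero
  coefficients. Restricting to \<open>exponents n\<close> makes distinct members of \<open>M\<close>
  distinct formal monomials in the first \<open>n\<close> variables.\<close>

definition algebraically_dependent :: "'a::comm_ring_1 set \<Rightarrow> nat \<Rightarrow> (nat \<Rightarrow> 'a) \<Rightarrow> bool" where
  "algebraically_dependent K n x \<longleftrightarrow> (\<exists>M c. finite M \<and> M \<noteq> {} \<and> M \<subseteq> exponents n \<and>
     (\<forall>m\<in>M. c m \<in> K \<and> c m \<noteq> 0) \<and> (\<Sum>m\<in>M. c m * monomial_at n x m) = 0)"

lemma base_digits_unique:
  fixes a b :: "nat \<Rightarrow> nat"
  assumes "\<And>i. i < n \<Longrightarrow> a i < N" "\<And>i. i < n \<Longrightarrow> b i < N"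
    "(\<Sum>i<n. N ^ i * a i) = (\<Sum>i<n. N ^ i * b i)" "i < n"
  shows "a i = b i"
  using assms
proof (induction n arbitrary: a b i)
  case (Suc n)
  have split: "(\<Sum>i<Suc n. N ^ i * e i) = e 0 + N * (\<Sum>i<n. N ^ i * e (Suc i))" for e :: "nat \<Rightarrow> nat"
    by (simp add: sum.lessThan_Suc_shift sum_distrib_left mult.assoc del: sum.lessThan_Suc)
  have eq: "a 0 + N * (\<Sum>i<n. N ^ i * a (Suc i)) = b 0 + N * (\<Sum>i<n. N ^ i * b (Suc i))"
    using Suc.prems(3) unfolding split .
  have lt: "a 0 < N" "b 0 < N" using Suc.prems(1,2)[of 0] by auto
  have "a 0 = (a 0 + N * (\<Sum>i<n. N ^ i * a (Suc i))) mod N" using lt by simp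
  also have "\<dots> = b 0" using lt by (simp add: eq)
  finally have 0: "a 0 = b 0" .
  then have "(\<Sum>i<n. N ^ i * a (Suc i)) = (\<Sum>i<n. N ^ i * b (Suc i))" using eq lt by simp
  then have "a (Suc j) = b (Suc j)" if "j < n" for j
    using Suc.IH[of "\<lambda>i. a (Suc i)" "\<lambda>i. b (Suc i)" j] Suc.prems(1,2) that by auto
  then show ?case using 0 Suc.prems(4) by (cases i) auto
qed simp

text \<open>Nagata's substitution \<open>z i = x i - x 0 ^ N ^ i\<close>: for large \<open>N\<close> the monomials have pairwise
  distinct degrees in \<open>x 0\<close>, so the relation becomes monic in \<open>x 0\<close> up to a constant.\<close>

lemma noether_normalization_step:
  fixes x :: "nat \<Rightarrow> 'a::field"
  assumes K: "subfield_set K" and dep: "algebraically_dependent K (Suc n) x"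
  shows "\<exists>z. (\<forall>i<n. z i \<in> ring_adjoin K (x ` {..<Suc n})) \<and>
    (\<forall>i<Suc n. integral_over (ring_adjoin K (z ` {..<n})) (x i))"
proof -
  note Ks = subfield_subring[OF K]
  obtain M c where M: "finite M" "M \<noteq> {}" "M \<subseteq> exponents (Suc n)"
    and c: "\<And>m. m \<in> M \<Longrightarrow> c m \<in> K \<and> c m \<noteq> 0"
    and rel: "(\<Sum>m\<in>M. c m * monomial_at (Suc n) x m) = 0"
    using dep unfolding algebraically_dependent_def by auto
  define N where "N = Suc (\<Sum>m\<in>M. \<Sum>i<Suc n. m i)"
  have mN: "m i < N" if "m \<in> M" "i < Suc n" for m i
  proof -
    have "m i \<le> (\<Sum>i<Suc n. m i)" using that by (intro member_le_sum) auto
    also have "\<dots> \<le> (\<Sum>m\<in>M. \<Sum>i<Suc n. m i)" using that M by (intro member_le_sum) auto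
    finally show ?thesis unfolding N_def by simp
  qed
  have N1: "N \<ge> 1" unfolding N_def by simp
  \<comment> \<open>With \<zeta> vanishing at 0 and \<open>N ^ 0 = 1\<close>, the polynomials
    \<open>u i\<close> below take the value \<open>x i\<close> at \<open>x 0\<close> for every
    \<open>i\<close>, including 0.\<close>
  define \<zeta> where "\<zeta> i = (if i = 0 then 0 else x i - x 0 ^ (N ^ i))" for i
  define z where "z i = \<zeta> (Suc i)" for i
  define D where "D = ring_adjoin K (z ` {..<n})"
  have Ds: "subring_set D" unfolding D_def by (rule subring_ring_adjoin)
  have ND: "noetherian_on D D"
    unfolding D_def by (intro noetherian_ring_adjoin_subfield K) auto
  have \<zeta>D: "\<zeta> i \<in> D" if "i < Suc n" for i
  proof (cases i)
    case (Suc j)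
    then have "\<zeta> i \<in> z ` {..<n}" using that unfolding z_def by auto
    then show ?thesis unfolding D_def by (rule subsetD[OF ring_adjoin_gen])
  qed (simp add: \<zeta>_def subring_set_zero Ds)
  define u where "u i = monom 1 (N ^ i) + [:\<zeta> i:]" for i
  have u: "degree (u i) = N ^ i" "lead_coeff (u i) = 1" "u i \<noteq> 0" for i
  proof -
    have "N ^ i > 0" using N1 by simp
    then show d: "degree (u i) = N ^ i"
      unfolding u_def by (subst degree_add_eq_left) (auto simp: degree_monom_eq)
    show "lead_coeff (u i) = 1" unfolding d unfolding u_def using \<open>N ^ i > 0\<close> by (cases "N ^ i") auto
    then show "u i \<noteq> 0" by auto
  qed
  define q where "q m = (\<Prod>i<Suc n. u i ^ m i)" for m
  define w where "w m = (\<Sum>i<Suc n. N ^ i * m i)" for m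
  have q: "degree (q m) = w m" "lead_coeff (q m) = 1" for m
  proof -
    show "degree (q m) = w m" unfolding q_def w_def
      by (subst degree_prod_sum_eq) (use u in \<open>auto simp: degree_power_eq mult.commute\<close>)
    show "lead_coeff (q m) = 1" unfolding q_def lead_coeff_prod lead_coeff_power u(2) by simp
  qed
  have qev: "poly (q m) (x 0) = monomial_at (Suc n) x m" for m
    unfolding q_def monomial_at_def poly_prod poly_power u_def
    by (intro prod.cong) (auto simp: poly_monom \<zeta>_def)
  have qD: "q m \<in> poly_set D" for m
    unfolding q_def u_def using \<zeta>D Ds
    by (intro subring_set_prod subring_poly_set subring_set_power subring_set_add monom_in_poly_set
        const_in_poly_set subring_set_one) auto
  have inj: "m = m'" if "m \<in> M" "m' \<in> M" "w m = w m'" for m m'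
  proof
    fix i
    show "m i = m' i"
    proof (cases "i < Suc n")
      case True
      then show ?thesis using base_digits_unique[of "Suc n" m N m' i] mN that unfolding w_def by blast
    next
      case False
      then have "m i = 0" "m' i = 0" using M(3) that(1,2) by (auto simp: exponents_def subset_iff)
      then show ?thesis by simp
    qed
  qed
  \<comment> \<open>The weights \<open>w m\<close> are numbers with base-\<open>N\<close> digits
    \<open>m i\<close>, hence distinct on \<open>M\<close>. So exactly one term reaches the top
    degree, and its coefficient in \<open>K\<close> cannot cancel.\<close>
  obtain m0 where m0: "m0 \<in> M" "\<And>m. m \<in> M \<Longrightarrow> w m \<le> w m0"
  proof -
    have "Max (w ` M) \<in> w ` M" using M by (intro Max_in) auto
    then obtain m0 where "m0 \<in> M" "w m0 = Max (w ` M)" by auto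
    then show ?thesis using that[of m0] M by auto
  qed
  define S where "S = (\<Sum>m\<in>M. smult (c m) (q m))"
  have "degree S \<le> w m0"
    unfolding S_def by (rule degree_sum_le) (use m0 q M in \<open>auto intro: order_trans[OF degree_smult_le]\<close>)
  moreover have cS: "coeff S (w m0) = c m0"
  proof -
    have "coeff S (w m0) = (\<Sum>m\<in>M. c m * coeff (q m) (w m0))" unfolding S_def by (simp add: coeff_sum)
    also have "\<dots> = (\<Sum>m\<in>M. if m = m0 then c m0 else 0)"
    proof (rule sum.cong[OF refl])
      fix m assume m: "m \<in> M"
      show "c m * coeff (q m) (w m0) = (if m = m0 then c m0 else 0)"
      proof (cases "m = m0")
        case True
        then show ?thesis using q[of m] by auto
      next
        case False
        then have "w m < w m0" using inj[OF m m0(1)] m0(2)[OF m] by force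
        then show ?thesis using False q(1)[of m] by (simp add: coeff_eq_0)
      qed
    qed
    also have "\<dots> = c m0" using M m0 by simp
    finally show ?thesis .
  qed
  moreover have c0: "c m0 \<noteq> 0" "c m0 \<in> K" using c m0 by auto
  ultimately have dS: "degree S = w m0" by (metis le_degree order_antisym)
  define S' where "S' = smult (inverse (c m0)) S"
  have "lead_coeff S' = 1" unfolding S'_def using c0 cS dS by auto
  moreover have "S' \<in> poly_set D"
  proof -
    have KD: "K \<subseteq> D" unfolding D_def by (rule ring_adjoin_base)
    have "inverse (c m0) \<in> D" using c0 K KD unfolding subfield_set_def by auto
    then show ?thesis unfolding S'_def S_def using KD qD c Ds
      by (intro smult_in_poly_set subring_set_sum subring_poly_set) auto
  qed
  moreover have "poly S' (x 0) = 0"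
    unfolding S'_def S_def using rel by (simp add: poly_sum qev)
  ultimately have x0: "integral_over D (x 0)" by (intro integral_over_rootI)
  have int: "integral_over D (x i)" if "i < Suc n" for i
  proof (cases "i = 0")
    case False
    have C: "subring_set {y. integral_over D y}" by (rule subring_integral_closure[OF Ds ND])
    have "\<zeta> i + x 0 ^ (N ^ i) \<in> {y. integral_over D y}"
      using \<zeta>D[OF that] x0 integral_over_base[OF Ds] by (intro subring_set_add[OF C] subring_set_power[OF C]) auto
    then show ?thesis using False unfolding \<zeta>_def by simp
  qed (simp add: x0)
  have "z i \<in> ring_adjoin K (x ` {..<Suc n})" if "i < n" for i
  proof -
    have "x (Suc i) \<in> ring_adjoin K (x ` {..<Suc n})" "x 0 \<in> ring_adjoin K (x ` {..<Suc n})"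
      using that by (auto intro!: subsetD[OF ring_adjoin_gen])
    then show ?thesis unfolding z_def \<zeta>_def
      by (auto intro: subring_set_diff subring_set_power subring_ring_adjoin)
  qed
  then show ?thesis using int unfolding D_def by blast
qed

text \<open>Each dependence trades \<open>n + 1\<close> elements for \<open>n\<close> over which the
  old ones are integral, and transitivity carries this through. Keeping the \<open>z i\<close> in
  \<open>K[x]\<close> later gives the inclusion of the normalization in \<open>A\<close>.\<close>

theorem noether_normalization:
  fixes x :: "nat \<Rightarrow> 'a::field"
  assumes K: "subfield_set K"
  shows "\<exists>m z. \<not> algebraically_dependent K m z \<and> (\<forall>i<m. z i \<in> ring_adjoin K (x ` {..<n})) \<and>
    (\<forall>i<n. integral_over (ring_adjoin K (z ` {..<m})) (x i))"
proof (induction n arbitrary: x)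
  case 0
  have "\<not> algebraically_dependent K 0 x"
  proof
    assume "algebraically_dependent K 0 x"
    then obtain M c where M: "finite M" "M \<noteq> {}" "M \<subseteq> exponents 0"
      "\<forall>m\<in>M. c m \<in> K \<and> c m \<noteq> 0" "(\<Sum>m\<in>M. c m * monomial_at 0 x m) = 0"
      unfolding algebraically_dependent_def by auto
    have "exponents 0 = {\<lambda>_. 0}" unfolding exponents_def by auto
    then have "M = {\<lambda>_. 0}" using M by auto
    then show False using M by (simp add: monomial_at_def)
  qed
  then show ?case by (intro exI[of _ 0] exI[of _ x]) auto
next
  case (Suc n)
  show ?case
  proof (cases "algebraically_dependent K (Suc n) x")
    case False
    have "integral_over (ring_adjoin K (x ` {..<Suc n})) (x i)" if "i < Suc n" for i
      using that by (intro integral_over_base subring_ring_adjoin subsetD[OF ring_adjoin_gen]) auto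
    moreover have "x i \<in> ring_adjoin K (x ` {..<Suc n})" if "i < Suc n" for i
      using that by (intro subsetD[OF ring_adjoin_gen]) auto
    ultimately show ?thesis using False by blast
  next
    case True
    obtain z where z: "\<forall>i<n. z i \<in> ring_adjoin K (x ` {..<Suc n})"
      "\<forall>i<Suc n. integral_over (ring_adjoin K (z ` {..<n})) (x i)"
      using noether_normalization_step[OF K True] by blast
    obtain m y where y: "\<not> algebraically_dependent K m y" "\<forall>i<m. y i \<in> ring_adjoin K (z ` {..<n})"
      "\<forall>i<n. integral_over (ring_adjoin K (y ` {..<m})) (z i)"
      using Suc.IH by blast
    define P where "P = ring_adjoin K (y ` {..<m})"
    have P: "subring_set P" "noetherian_on P P" unfolding P_def
      by (intro subring_ring_adjoin noetherian_ring_adjoin_subfield K finite_imageI finite_lessThan)+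
    have zP: "integral_over P v" if "v \<in> ring_adjoin K (z ` {..<n})" for v
    proof (rule integral_over_ring_adjoin[OF P])
      show "v \<in> ring_adjoin P (z ` {..<n})"
        using that ring_adjoin_mono[of K P "z ` {..<n}" "z ` {..<n}"] ring_adjoin_base[of K] unfolding P_def by auto
    qed (use y in \<open>auto simp: P_def\<close>)
    have "integral_over P (x i)" if "i < Suc n" for i
      using integral_over_trans[OF P zP] z(2) that by blast
    moreover have "ring_adjoin K (z ` {..<n}) \<subseteq> ring_adjoin K (x ` {..<Suc n})"
      using z by (intro ring_adjoin_least subring_ring_adjoin ring_adjoin_base) auto
    ultimately show ?thesis using y unfolding P_def by blast
  qed
qed

text \<open>A span may use one generator several times; collecting coefficients per index gives a
  sum over distinct indices, as algebraic dependence requires.\<close>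

lemma lin_span_image_sum:
  assumes D: "subring_set D" and "y \<in> lin_span D (f ` A)"
  shows "\<exists>B c. finite B \<and> B \<subseteq> A \<and> (\<forall>b\<in>B. c b \<in> D) \<and> y = (\<Sum>b\<in>B. c b * f b)"
  using assms(2)
proof induction
  case zero
  show ?case by (intro exI[of _ "{}"]) auto
next
  case (step d z y)
  then obtain B c a where B: "finite B" "B \<subseteq> A" "\<forall>b\<in>B. c b \<in> D" "y = (\<Sum>b\<in>B. c b * f b)"
    and a: "a \<in> A" "z = f a" by auto
  define c' where "c' b = (if b \<in> B then c b else 0) + (if b = a then d else 0)" for b
  have "(\<Sum>b\<in>insert a B. c' b * f b) = (\<Sum>b\<in>insert a B. (if b \<in> B then c b else 0) * f b)
      + (\<Sum>b\<in>insert a B. (if b = a then d else 0) * f b)"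
    by (simp add: c'_def distrib_right sum.distrib)
  also have "(\<Sum>b\<in>insert a B. (if b = a then d else 0) * f b) = d * f a"
  proof -
    have "(\<Sum>b\<in>insert a B. (if b = a then d else 0) * f b) = (\<Sum>b\<in>insert a B. if b = a then d * f a else 0)"
      by (intro sum.cong) auto
    then show ?thesis using B(1) by simp
  qed
  also have "(\<Sum>b\<in>insert a B. (if b \<in> B then c b else 0) * f b) = (\<Sum>b\<in>B. (if b \<in> B then c b else 0) * f b)"
    using B(1) by (intro sum.mono_neutral_right) auto
  also have "\<dots> = y" unfolding B(4) by (intro sum.cong) auto
  finally have "d * z + y = (\<Sum>b\<in>insert a B. c' b * f b)" using a by simp
  moreover have "\<forall>b\<in>insert a B. c' b \<in> D"
    using B step(1) D unfolding c'_def by (auto intro: subring_intros)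
  ultimately show ?case using B a by (intro exI[of _ "insert a B"] exI[of _ c']) auto
qed

lemma ring_adjoin_monomials:
  assumes K: "subring_set K"
  shows "ring_adjoin K (x ` {..<n}) \<subseteq> lin_span K (monomial_at n x ` exponents n)"
proof -
  let ?M = "lin_span K (monomial_at n x ` exponents n)"
  have one: "monomial_at n x (\<lambda>_. 0) = 1" by (simp add: monomial_at_def)
  have base: "monomial_at n x m \<in> ?M" if "m \<in> exponents n" for m
    using that K by (auto intro: lin_span_base)
  have e0: "(\<lambda>_. 0) \<in> exponents n" by (simp add: exponents_def)
  have mult_mon: "monomial_at n x m * y \<in> ?M" if "m \<in> exponents n" "y \<in> ?M" for m y
    using that(2)
  proof induction
    case (step c v y)
    then obtain m' where m': "m' \<in> exponents n" "v = monomial_at n x m'" by auto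
    have "monomial_at n x m * v = monomial_at n x (\<lambda>i. m i + m' i)"
      unfolding m' by (simp add: monomial_at_def power_add prod.distrib)
    moreover have "(\<lambda>i. m i + m' i) \<in> exponents n" using that(1) m'(1) by (simp add: exponents_def)
    ultimately have "c * (monomial_at n x m * v) + monomial_at n x m * y \<in> ?M"
      using step by (intro lin_span.step) auto
    then show ?case by (simp add: algebra_simps)
  qed (simp add: lin_span.zero)
  have mult: "v * y \<in> ?M" if "v \<in> ?M" "y \<in> ?M" for v y
    using that(1)
  proof induction
    case (step c m w)
    then have "m * y \<in> ?M" "w * y \<in> ?M" using mult_mon that(2) by auto
    then have "c * (m * y) + w * y \<in> ?M"
      using lin_span_scale[OF K step(1)] by (intro lin_span_add)
    then show ?case by (simp add: algebra_simps)
  qed (simp add: lin_span.zero)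
  have "subring_set ?M"
    using base[OF e0] K mult by (intro subring_setI) (auto simp: one intro: lin_span_uminus lin_span_add)
  moreover have "K \<subseteq> ?M"
  proof
    fix c assume "c \<in> K"
    from lin_span_scale[OF K this base[OF e0]] show "c \<in> ?M" by (simp add: one)
  qed
  moreover have "x ` {..<n} \<subseteq> ?M"
  proof
    fix y assume "y \<in> x ` {..<n}"
    then obtain i where i: "i < n" "y = x i" by auto
    let ?e = "\<lambda>j. if j = i then 1 else 0 :: nat"
    have "?e \<in> exponents n" using i by (simp add: exponents_def)
    moreover have "monomial_at n x ?e = (\<Prod>j<n. if j = i then x i else 1)"
      unfolding monomial_at_def by (intro prod.cong) auto
    then have "monomial_at n x ?e = y" using i by simp
    ultimately show "y \<in> ?M" using base by metis
  qed
  ultimately show ?thesis by (rule ring_adjoin_least)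
qed

lemma algebraically_dependent_Suc:
  assumes "algebraically_dependent K n x"
  shows "algebraically_dependent K (Suc n) x"
proof -
  obtain M c where M: "finite M" "M \<noteq> {}" "M \<subseteq> exponents n" "\<forall>m\<in>M. c m \<in> K \<and> c m \<noteq> 0"
    "(\<Sum>m\<in>M. c m * monomial_at n x m) = 0"
    using assms unfolding algebraically_dependent_def by auto
  have "(\<Sum>m\<in>M. c m * monomial_at (Suc n) x m) = (\<Sum>m\<in>M. c m * monomial_at n x m)"
    using M(3) by (intro sum.cong) (auto simp: monomial_at_def exponents_def)
  moreover have "exponents n \<subseteq> exponents (Suc n)" by (auto simp: exponents_def)
  ultimately show ?thesis unfolding algebraically_dependent_def using M
    by (intro exI[of _ M] exI[of _ c]) auto
qed

text \<open>Expanding the coefficients of \<open>p\<close> into monomials and storing the power of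
  \<open>z n\<close> in position \<open>n\<close> of the exponent turns \<open>p\<close> into a
  relation among \<open>n + 1\<close> elements. \<open>T\<close> drops the zero terms; independence
  forces it to be empty, hence \<open>p = 0\<close>.\<close>

lemma algebraically_independent_transcendental:
  fixes z :: "nat \<Rightarrow> 'a::comm_ring_1"
  assumes K: "subring_set K" and ind: "\<not> algebraically_dependent K (Suc n) z"
    and p: "p \<in> poly_set (ring_adjoin K (z ` {..<n}))" "poly p (z n) = 0"
  shows "p = 0"
proof -
  have "\<forall>j. \<exists>B c. finite B \<and> B \<subseteq> exponents n \<and> (\<forall>b\<in>B. c b \<in> K) \<and>
      coeff p j = (\<Sum>b\<in>B. c b * monomial_at n z b)"
  proof
    fix j
    have "coeff p j \<in> lin_span K (monomial_at n z ` exponents n)"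
      using p(1) ring_adjoin_monomials[OF K, of z n] unfolding poly_set_def by auto
    from lin_span_image_sum[OF K this]
    show "\<exists>B c. finite B \<and> B \<subseteq> exponents n \<and> (\<forall>b\<in>B. c b \<in> K) \<and>
      coeff p j = (\<Sum>b\<in>B. c b * monomial_at n z b)" .
  qed
  then obtain B c where B: "\<And>j. finite (B j)" "\<And>j. B j \<subseteq> exponents n"
      "\<And>j b. b \<in> B j \<Longrightarrow> c j b \<in> K" "\<And>j. coeff p j = (\<Sum>b\<in>B j. c j b * monomial_at n z b)"
    by metis
  define T where "T = (SIGMA j:{..degree p}. {b \<in> B j. c j b \<noteq> 0})"
  have finT: "finite T" unfolding T_def using B(1) by auto
  define h where "h = (\<lambda>(j, b :: nat \<Rightarrow> nat). b(n := j))"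
  define g where "g m = (m n, m(n := 0))" for m :: "nat \<Rightarrow> nat"
  have gh: "g (h t) = t" if "t \<in> T" for t
  proof -
    obtain j b where t: "t = (j, b)" "b \<in> B j" using \<open>t \<in> T\<close> unfolding T_def by auto
    have "b n = 0" using B(2)[of j] t by (auto simp: exponents_def)
    then show ?thesis by (simp add: t g_def h_def fun_upd_idem)
  qed
  define c' where "c' m = case_prod c (g m)" for m
  have inj: "inj_on h T" by (metis gh inj_onI)
  have mon: "monomial_at (Suc n) z (h (j, b)) = monomial_at n z b * z n ^ j" for j b
    by (auto simp: monomial_at_def h_def intro!: prod.cong)
  have "(\<Sum>m\<in>h ` T. c' m * monomial_at (Suc n) z m) = (\<Sum>t\<in>T. c' (h t) * monomial_at (Suc n) z (h t))"
    using inj by (simp add: sum.reindex)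
  also have "\<dots> = (\<Sum>(j, b)\<in>T. c j b * monomial_at n z b * z n ^ j)"
    by (intro sum.cong refl) (auto simp: c'_def gh mon mult.assoc)
  also have "\<dots> = (\<Sum>j\<le>degree p. \<Sum>b | b \<in> B j \<and> c j b \<noteq> 0. c j b * monomial_at n z b * z n ^ j)"
    unfolding T_def using B(1) by (subst sum.Sigma) auto
  also have "\<dots> = (\<Sum>j\<le>degree p. coeff p j * z n ^ j)"
  proof (rule sum.cong[OF refl])
    fix j
    have "(\<Sum>b | b \<in> B j \<and> c j b \<noteq> 0. c j b * monomial_at n z b * z n ^ j)
        = (\<Sum>b\<in>B j. c j b * monomial_at n z b * z n ^ j)"
      using B(1) by (intro sum.mono_neutral_left) auto
    then show "(\<Sum>b | b \<in> B j \<and> c j b \<noteq> 0. c j b * monomial_at n z b * z n ^ j) = coeff p j * z n ^ j"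
      by (simp add: B(4) sum_distrib_right)
  qed
  also have "\<dots> = 0" using p(2) by (simp add: poly_altdef)
  finally have sum0: "(\<Sum>m\<in>h ` T. c' m * monomial_at (Suc n) z m) = 0" .
  have "h ` T \<subseteq> exponents (Suc n)"
    using B(2) unfolding T_def h_def by (fastforce simp: exponents_def)
  moreover have "\<forall>m\<in>h ` T. c' m \<in> K \<and> c' m \<noteq> 0"
    using B(3) by (auto simp: c'_def gh) (auto simp: T_def)
  ultimately have "T = {}"
  proof (rule_tac ccontr)
    assume *: "h ` T \<subseteq> exponents (Suc n)" "\<forall>m\<in>h ` T. c' m \<in> K \<and> c' m \<noteq> 0" "T \<noteq> {}"
    have "algebraically_dependent K (Suc n) z"
      unfolding algebraically_dependent_def
      by (rule exI[of _ "h ` T"], rule exI[of _ c'], intro conjI * sum0 finite_imageI finT)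
         (use *(3) in simp)
    then show False using ind by simp
  qed
  then have c0: "c j b = 0" if "j \<le> degree p" "b \<in> B j" for j b using that unfolding T_def by blast
  have "coeff p (degree p) = 0" unfolding B(4)[of "degree p"] using c0 by (intro sum.neutral) auto
  then show ?thesis by simp
qed

text \<open>The \<open>z i\<close> are adjoined one at a time, each transcendental over the ring
  generated by the previous ones; a field is trivially normal.\<close>

lemma normal_set_algebraically_independent:
  fixes z :: "nat \<Rightarrow> 'a::alg_closed_field"
  assumes K: "subfield_set K" and "\<not> algebraically_dependent K n z"
  shows "normal_set (ring_adjoin K (z ` {..<n}))"
  using assms(2)
proof (induction n)
  case 0
  have "fraction_set (ring_adjoin K {}) \<subseteq> K"
    using K subfield_subring by (intro fraction_set_least ring_adjoin_least) auto
  then show ?case using ring_adjoin_base[of K "{}"] unfolding normal_set_def by auto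
next
  case (Suc n)
  note Ks = subfield_subring[OF K]
  have "normal_set (ring_adjoin (ring_adjoin K (z ` {..<n})) {z n})"
  proof (rule normal_set_ring_adjoin_transcendental)
    show "noetherian_on (ring_adjoin K (z ` {..<n})) (ring_adjoin K (z ` {..<n}))"
      by (intro noetherian_ring_adjoin_subfield K) auto
    show "normal_set (ring_adjoin K (z ` {..<n}))" using Suc algebraically_dependent_Suc by blast
  qed (use algebraically_independent_transcendental[OF Ks Suc.prems] subring_ring_adjoin in auto)
  then show ?case by (simp only: lessThan_Suc image_insert ring_adjoin_insert[of K "z n" "z ` {..<n}"])
qed

text \<open>Some power \<open>q\<close> of the characteristic makes all generators separable over a Noether
  normalization \<open>P = K[z]\<close>, so \<open>q\<close>-th powers of integral elements lie in a finite module over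
  \<open>P\<close>, hence over \<open>K[z ^ q]\<close>; one then extracts \<open>q\<close>-th roots of all coefficients.\<close>

theorem finiteness_of_integral_closure:
  fixes V :: "'a::alg_closed_field set"
  assumes K: "subfield_set K" and perfect: "\<And>c q. c \<in> K \<Longrightarrow> q > 0 \<Longrightarrow> \<exists>d\<in>K. d ^ q = c"
    and "finite V"
  shows "noetherian_on (ring_adjoin K V) {h \<in> fraction_set (ring_adjoin K V). integral_over (ring_adjoin K V) h}"
proof -
  note Ks = subfield_subring[OF K]
  define A where "A = ring_adjoin K V"
  define H where "H = {h \<in> fraction_set A. integral_over A h}"
  obtain n and x :: "nat \<Rightarrow> 'a" where Vx: "V = x ` {..<n}"
    using \<open>finite V\<close> by (metis finite_imp_nat_seg_image_inj_on lessThan_def)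
  obtain m z where ind: "\<not> algebraically_dependent K m z" and zA: "\<forall>i<m. z i \<in> A"
    and xint: "\<forall>i<n. integral_over (ring_adjoin K (z ` {..<m})) (x i)"
    using noether_normalization[OF K, of x n] unfolding A_def Vx by blast
  define P where "P = ring_adjoin K (z ` {..<m})"
  have P: "subring_set P" "noetherian_on P P" "normal_set P" "K \<subseteq> P" unfolding P_def
    using normal_set_algebraically_independent[OF K ind]
    by (auto intro!: subring_ring_adjoin noetherian_ring_adjoin_subfield K subsetD[OF ring_adjoin_base])
  have PA: "P \<subseteq> A" unfolding P_def A_def using zA
    by (intro ring_adjoin_least subring_ring_adjoin ring_adjoin_base) (auto simp: A_def)
  have Vint: "integral_over P v" if "v \<in> V" for v using xint that unfolding Vx P_def by auto
  define F where "F = fraction_set P"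
  have F: "subfield_set F" "P \<subseteq> F" unfolding F_def using subfield_fraction_set fraction_set_base P(1) by auto
  have "\<exists>q. additive_power TYPE('a) q \<and> separable_over F (v ^ q)" if v: "v \<in> V" for v
  proof -
    obtain f where "f \<in> poly_set P" "lead_coeff f = 1" "poly f v = 0"
      using Vint[OF v] unfolding integral_over_def by auto
    moreover from this have "f \<noteq> 0" by auto
    ultimately show ?thesis using separable_over_some_power[OF F(1), of f v] poly_set_mono[OF F(2)] by auto
  qed
  then obtain e where e: "\<And>v. v \<in> V \<Longrightarrow> additive_power TYPE('a) (e v)" "\<And>v. v \<in> V \<Longrightarrow> separable_over F (v ^ e v)"
    by metis
  \<comment> \<open>One exponent for all generators: a further additive power preserves
    separability.\<close>
  define q where "q = prod e V"
  have q: "additive_power TYPE('a) q" unfolding q_def using e(1) by (rule additive_power_prod)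
  note q0 = additive_power_pos[OF q]
  have Vsep: "separable_over F (v ^ q)" if v: "v \<in> V" for v
  proof -
    have "q = e v * prod e (V - {v})" unfolding q_def using \<open>finite V\<close> v by (simp add: prod.remove)
    moreover have "additive_power TYPE('a) (prod e (V - {v}))" using e(1) by (intro additive_power_prod) auto
    ultimately show ?thesis
      using separable_over_power[of "prod e (V - {v})" F "v ^ e v"] e(2)[OF v] subfield_subring[OF F(1)]
      by (simp add: power_mult)
  qed
  define Vq where "Vq = (\<lambda>v. v ^ q) ` V"
  have C: "subring_set {y. integral_over P y}" using subring_integral_closure[OF P(1,2)] .
  have "integral_over P v" if "v \<in> Vq" for v
    using that Vint subring_set_power[OF C] unfolding Vq_def by auto
  then obtain E G where E: "subring_set E" "normal_set E" "P \<subseteq> E" "Vq \<subseteq> E" and G: "finite G" "E \<subseteq> lin_span P G"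
  proof -
    assume *: "\<And>E G. subring_set E \<Longrightarrow> normal_set E \<Longrightarrow> P \<subseteq> E \<Longrightarrow> Vq \<subseteq> E \<Longrightarrow> finite G \<Longrightarrow>
      E \<subseteq> lin_span P G \<Longrightarrow> thesis" and int: "\<And>v. v \<in> Vq \<Longrightarrow> integral_over P v"
    have "finite Vq" using \<open>finite V\<close> unfolding Vq_def by simp
    moreover have "separable_over (fraction_set P) v" if "v \<in> Vq" for v
      using that Vsep unfolding Vq_def F_def by auto
    ultimately show thesis using integral_closure_separable[OF P(1-3) _ int] * by metis
  qed
  \<comment> \<open>\<open>K\<close> being perfect, each element of \<open>P'\<close> is the
    \<open>q\<close>-th power of an element of \<open>P\<close>; and \<open>P\<close> lies in a
    finite \<open>P'\<close>-module, since the \<open>z i\<close> are integral over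
    \<open>P'\<close>.\<close>
  define P' where "P' = ring_adjoin K ((\<lambda>y. y ^ q) ` z ` {..<m})"
  have P': "subring_set P'" "noetherian_on P' P'" "K \<subseteq> P'" unfolding P'_def
    by (auto intro!: subring_ring_adjoin noetherian_ring_adjoin_subfield K subsetD[OF ring_adjoin_base])
  have zP: "z ` {..<m} \<subseteq> P" unfolding P_def by (rule ring_adjoin_gen)
  have P'root: "P' \<subseteq> (\<lambda>d. d ^ q) ` P"
    unfolding P'_def
  proof (rule ring_adjoin_least[OF subring_power_image[OF q P(1)]])
    show "K \<subseteq> (\<lambda>d. d ^ q) ` P"
    proof
      fix c assume "c \<in> K"
      then obtain d where "d \<in> K" "d ^ q = c" using perfect q0 by blast
      then show "c \<in> (\<lambda>d. d ^ q) ` P" using P(4) by auto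
    qed
  qed (use zP in auto)
  have "integral_over P' (z i)" if "i < m" for i
  proof (rule integral_over_root[OF P'(1,2) q0])
    show "integral_over P' (z i ^ q)"
      using that by (intro integral_over_base P') (auto simp: P'_def intro!: subsetD[OF ring_adjoin_gen])
  qed
  then obtain G2 where G2: "finite G2" "ring_adjoin P' (z ` {..<m}) \<subseteq> lin_span P' G2"
    using ring_adjoin_integral_finite[OF P'(1), of "z ` {..<m}"] by auto
  have "P \<subseteq> ring_adjoin P' (z ` {..<m})" unfolding P_def using P'(3) by (intro ring_adjoin_mono) auto
  then have "lin_span P G \<subseteq> lin_span P' {g * p | g p. g \<in> G2 \<and> p \<in> G}"
    using G2 by (intro lin_span_tower[OF P'(1)]) auto
  moreover have "finite {g * p | g p. g \<in> G2 \<and> p \<in> G}" using G(1) G2(1) by (intro finite_image_set2) auto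
  ultimately have NE: "noetherian_on P' E"
    using noetherian_on_lin_span[OF P'(1,2)] noetherian_on_subset G(2) by (meson subset_trans)
  have Aint: "integral_over P y" if "y \<in> A" for y
  proof (rule integral_over_ring_adjoin[OF P(1,2) Vint])
    show "y \<in> ring_adjoin P V" using that ring_adjoin_mono[OF P(4), of V V] unfolding A_def by auto
  qed
  have Aq: "A \<subseteq> {y. y ^ q \<in> E}"
    unfolding A_def
  proof (rule ring_adjoin_least[OF subring_power_vimage[OF q E(1)]])
    show "K \<subseteq> {y. y ^ q \<in> E}" using subring_set_power[OF Ks] P(4) E(3) by blast
    show "V \<subseteq> {y. y ^ q \<in> E}" using E(4) unfolding Vq_def by auto
  qed
  \<comment> \<open>\<open>q\<close>-th powers of \<open>A\<close> lie in \<open>E\<close>, so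
    \<open>h ^ q\<close> is a fraction over \<open>E\<close>; it is integral, and \<open>E\<close>
    is normal.\<close>
  have HE: "h ^ q \<in> E" if h: "h \<in> H" for h
  proof -
    obtain a b where ab: "a \<in> A" "b \<in> A" "b \<noteq> 0" "h = a / b" using h unfolding H_def by (auto elim: fraction_setE)
    have "h ^ q \<in> fraction_set E"
      unfolding ab(4) power_divide using Aq ab q0 by (intro fraction_setI) auto
    moreover have "integral_over P h" using integral_over_trans[OF P(1,2) Aint] h unfolding H_def by blast
    then have "integral_over P (h ^ q)" using subring_set_power[OF C] by auto
    then have "integral_over E (h ^ q)" using E(3) by (rule integral_over_mono)
    ultimately show ?thesis using E(2) unfolding normal_set_def by blast
  qed
  have "noetherian_on A H"
    unfolding noetherian_on_def
  proof (intro allI impI)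
    fix U assume U: "U \<subseteq> H"
    then have "(\<lambda>h. h ^ q) ` U \<subseteq> E" using HE by auto
    from noetherian_onE[OF NE this] obtain W where W: "W \<subseteq> (\<lambda>h. h ^ q) ` U" "finite W"
      "(\<lambda>h. h ^ q) ` U \<subseteq> lin_span P' W" .
    obtain U0 where U0: "U0 \<subseteq> U" "finite U0" "W = (\<lambda>h. h ^ q) ` U0"
      using W(1,2) by (meson finite_subset_image)
    \<comment> \<open>A \<open>P'\<close>-combination of elements \<open>u ^ q\<close> is the
      \<open>q\<close>-th power of the \<open>A\<close>-combination with the rooted coefficients.
      Injectivity of the \<open>q\<close>-th power then returns from \<open>h ^ q\<close> to
      \<open>h\<close>.\<close>
    have root: "\<exists>y\<in>lin_span A U0. w = y ^ q" if "w \<in> lin_span P' W" for w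
      using that
    proof induction
      case zero
      show ?case using q0 by (intro bexI[of _ 0]) (auto intro: lin_span.zero)
    next
      case (step c v w)
      then obtain y where y: "y \<in> lin_span A U0" "w = y ^ q" by auto
      obtain d where d: "d \<in> P" "c = d ^ q" using step P'root by auto
      obtain u where u: "u \<in> U0" "v = u ^ q" using step U0 by auto
      have "d * u + y \<in> lin_span A U0" using d u y PA by (intro lin_span.step) auto
      moreover have "c * v + w = (d * u + y) ^ q"
        using d u y by (simp add: additive_power_add[OF q] power_mult_distrib)
      ultimately show ?case by blast
    qed
    have "U \<subseteq> lin_span A U0"
    proof
      fix h assume "h \<in> U"
      then obtain y where "y \<in> lin_span A U0" "h ^ q = y ^ q" using root W(3) by blast
      then show "h \<in> lin_span A U0" using additive_power_inj[OF q] by blast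
    qed
    then show "\<exists>U0\<subseteq>U. finite U0 \<and> U \<subseteq> lin_span A U0" using U0 by blast
  qed
  then show ?thesis unfolding A_def H_def .
qed

section \<open>Orders along a principal divisor\<close>

lemma noetherian_on_chain:
  assumes N: "noetherian_on C C" and I: "\<And>n::nat. I n \<subseteq> C" "\<And>n. lin_span C (I n) \<subseteq> I n" "\<And>n. I n \<subseteq> I (Suc n)"
  shows "\<exists>n. I (Suc n) \<subseteq> I n"
proof -
  have "(\<Union>n. I n) \<subseteq> C" using I by auto
  from noetherian_onE[OF N this] obtain U where U: "U \<subseteq> (\<Union>n. I n)" "finite U" "(\<Union>n. I n) \<subseteq> lin_span C U" .
  have mono: "i \<le> j \<Longrightarrow> I i \<subseteq> I j" for i j by (rule lift_Suc_mono_le[of I]) (rule I(3))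
  have "\<exists>n. U \<subseteq> I n" using U(2,1)
  proof (induction U)
    case (insert a U)
    then obtain m n where "a \<in> I m" "U \<subseteq> I n" by auto
    then show ?case using mono[of m "max m n"] mono[of n "max m n"] by (intro exI[of _ "max m n"]) auto
  qed auto
  then obtain n where "U \<subseteq> I n" ..
  then have "lin_span C U \<subseteq> I n" using lin_span_mono[of C C U "I n"] I(2)[of n] by blast
  then show ?thesis using U(3) by blast
qed

lemma noetherian_on_maximal:
  assumes N: "noetherian_on C C" and "I0 \<in> \<S>"
    and S: "\<And>I. I \<in> \<S> \<Longrightarrow> I \<subseteq> C" "\<And>I. I \<in> \<S> \<Longrightarrow> lin_span C I \<subseteq> I"
  shows "\<exists>I\<in>\<S>. \<forall>J\<in>\<S>. I \<subseteq> J \<longrightarrow> J = I"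
proof (rule ccontr)
  assume no_max: "\<not> (\<exists>I\<in>\<S>. \<forall>J\<in>\<S>. I \<subseteq> J \<longrightarrow> J = I)"
  have "\<exists>F. \<forall>n::nat. F n \<in> \<S> \<and> F n \<subset> F (Suc n)"
  proof (rule dependent_nat_choice)
    show "\<exists>I. I \<in> \<S>" using assms(2) by blast
    show "\<exists>J. J \<in> \<S> \<and> I \<subset> J" if "I \<in> \<S>" for I and n :: nat
      using no_max that by (metis psubsetI)
  qed
  then obtain F where F: "\<And>n::nat. F n \<in> \<S>" "\<And>n. F n \<subset> F (Suc n)" by blast
  have "\<exists>n. F (Suc n) \<subseteq> F n"
    by (rule noetherian_on_chain[OF N]) (use S F in blast)+
  then show False using F(2) by blast
qed

section \<open>Discrete valuations at prime conductors\<close>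

definition conductor :: "'a::comm_ring_1 set \<Rightarrow> 'a \<Rightarrow> 'a set" where
  "conductor C y = {z \<in> C. z * y \<in> C}"

lemma conductor_lin_span:
  assumes "subring_set C"
  shows "lin_span C (conductor C y) \<subseteq> conductor C y"
  using assms by (intro lin_span_least) (auto simp: conductor_def distrib_right mult.assoc intro: subring_intros)

lemma conductor_mult:
  assumes "subring_set C" "a \<in> C" "z \<in> conductor C y"
  shows "a * z \<in> conductor C y"
  using assms by (auto simp: conductor_def mult.assoc intro: subring_set_mult)

text \<open>The conductor \<open>Q\<close> of \<open>y\<close> is a prime such that \<open>\<pi>\<close> generates the maximal ideal of the
  localization at \<open>Q\<close>: for \<open>z \<in> Q\<close> we have \<open>(\<pi> y) z = (z y) \<pi>\<close>, and \<open>\<pi> y\<close> becomes a unit.\<close>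

definition prime_conductor :: "'a::comm_ring_1 set \<Rightarrow> 'a \<Rightarrow> 'a \<Rightarrow> bool" where
  "prime_conductor C y \<pi> \<longleftrightarrow> y \<notin> C \<and>
     (\<forall>a\<in>C. \<forall>b\<in>C. a * b \<in> conductor C y \<longrightarrow> a \<in> conductor C y \<or> b \<in> conductor C y) \<and>
     \<pi> \<in> conductor C y \<and> \<pi> * y \<notin> conductor C y"

text \<open>A conductor maximal among those of the multiples \<open>c * x\<close> outside
  \<open>C\<close> is prime. If \<open>y\<close> mapped it into itself, \<open>y\<close> would be
  integral and so lie in \<open>C\<close>; hence some \<pi> in it has \<open>\<pi> * y\<close>
  outside it.\<close>

lemma prime_conductor_exists:
  fixes C :: "'a::field set"
  assumes C: "subring_set C" "noetherian_on C C" "normal_set C"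
    and x: "x \<in> fraction_set C" "x \<notin> C"
  shows "\<exists>c\<in>C. \<exists>\<pi>. prime_conductor C (c * x) \<pi>"
proof -
  define \<S> where "\<S> = {conductor C (c * x) | c. c \<in> C \<and> c * x \<notin> C}"
  have "conductor C (1 * x) \<in> \<S>" unfolding \<S>_def using x subring_set_one[OF C(1)] by force
  from noetherian_on_maximal[OF C(2) this] obtain I where I: "I \<in> \<S>" "\<And>J. J \<in> \<S> \<Longrightarrow> I \<subseteq> J \<Longrightarrow> J = I"
    using conductor_lin_span[OF C(1)] unfolding \<S>_def by (auto simp: conductor_def)
  obtain c where c: "c \<in> C" "c * x \<notin> C" "I = conductor C (c * x)" using I(1) unfolding \<S>_def by auto
  define y where "y = c * x"
  define Q where "Q = conductor C y"
  have prime: "a \<in> Q \<or> b \<in> Q" if ab: "a \<in> C" "b \<in> C" "a * b \<in> Q" for a b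
  proof (rule disjCI)
    assume "b \<notin> Q"
    then have "b * y \<notin> C" using ab unfolding Q_def conductor_def by auto
    then have nb: "(b * c) * x \<notin> C" unfolding y_def by (simp add: mult.assoc)
    have "conductor C ((b * c) * x) \<in> \<S>" unfolding \<S>_def using nb ab c C by (blast intro: subring_set_mult)
    moreover have "I \<subseteq> conductor C ((b * c) * x)"
    proof
      fix z assume "z \<in> I"
      then have z: "z \<in> C" "z * (c * x) \<in> C" unfolding c(3) conductor_def by auto
      have "z * ((b * c) * x) = b * (z * (c * x))" by (simp add: ac_simps)
      also have "\<dots> \<in> C" using C(1) ab(2) z(2) by (rule subring_set_mult)
      finally show "z \<in> conductor C ((b * c) * x)" using z unfolding conductor_def by simp
    qed
    ultimately have eq: "conductor C ((b * c) * x) = I" by (rule I(2))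
    have "a * ((b * c) * x) = a * b * y" unfolding y_def by (simp add: ac_simps)
    also have "\<dots> \<in> C" using ab unfolding Q_def conductor_def by simp
    finally have "a \<in> conductor C ((b * c) * x)" using ab unfolding conductor_def by simp
    then show "a \<in> Q" unfolding eq c(3) Q_def y_def .
  qed
  have "subfield_set (fraction_set C)" by (rule subfield_fraction_set[OF C(1)])
  then have yf: "y \<in> fraction_set C" unfolding y_def
    using x c fraction_set_base[OF C(1)] by (intro subring_set_mult subfield_subring) auto
  have "\<exists>\<pi>\<in>Q. \<pi> * y \<notin> Q"
  proof (rule ccontr)
    assume "\<not> (\<exists>\<pi>\<in>Q. \<pi> * y \<notin> Q)"
    then have step: "\<pi> * y \<in> Q" if "\<pi> \<in> Q" for \<pi> using that by blast
    \<comment> \<open>The denominator \<open>b\<close> lies in \<open>Q\<close>, so all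
      \<open>b * y ^ n\<close> do; thus every power of \<open>y\<close> lies in the module generated
      by \<open>1 / b\<close>.\<close>
    obtain a b where ab: "a \<in> C" "b \<in> C" "b \<noteq> 0" "y = a / b" using yf by (rule fraction_setE)
    have "b \<in> Q" unfolding Q_def conductor_def using ab by simp
    have pow: "b * y ^ n \<in> Q" for n
    proof (induction n)
      case (Suc n)
      then show ?case using step[OF Suc] by (simp add: ac_simps)
    qed (simp add: \<open>b \<in> Q\<close>)
    have "y ^ n \<in> lin_span C {1 / b}" for n
    proof -
      have "b * y ^ n \<in> C" using pow[of n] unfolding Q_def conductor_def by simp
      then have "(b * y ^ n) * (1 / b) + 0 \<in> lin_span C {1 / b}" by (intro lin_span.intros) auto
      then show ?thesis using ab by simp
    qed
    then have "integral_over C y"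
      using noetherian_on_lin_span[OF C(1,2), of "{1 / b}"] by (intro integral_over_if_powers[OF C(1)]) auto
    then have "y \<in> C" using yf C(3) unfolding normal_set_def by auto
    then show False using c unfolding y_def by simp
  qed
  then show ?thesis using prime c unfolding prime_conductor_def Q_def y_def by blast
qed

context
  fixes C :: "'a::field set" and y \<pi> :: 'a
  assumes C: "subring_set C" "noetherian_on C C" and pc: "prime_conductor C y \<pi>"
begin

lemma prime_conductor_not_zero: "\<pi> \<noteq> 0"
  using pc C by (auto simp: prime_conductor_def conductor_def intro: subring_set_zero)

lemma prime_conductor_one: "1 \<in> C - conductor C y"
  using pc C by (auto simp: prime_conductor_def conductor_def intro: subring_set_one)

lemma prime_conductor_mult: "a \<in> C - conductor C y \<Longrightarrow> b \<in> C - conductor C y \<Longrightarrow> a * b \<in> C - conductor C y"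
  using pc C by (auto simp: prime_conductor_def intro: subring_set_mult)

lemma prime_conductor_power: "a \<in> C - conductor C y \<Longrightarrow> a ^ n \<in> C - conductor C y"
  by (induction n) (use prime_conductor_one prime_conductor_mult in auto)

lemma prime_conductor_pi: "\<pi> \<in> C" "\<pi> \<in> conductor C y"
  using pc by (auto simp: prime_conductor_def conductor_def)

lemma pi_power_mult_in_conductor:
  assumes "n > 0" "a \<in> C"
  shows "\<pi> ^ n * a \<in> conductor C y"
proof -
  obtain m where m: "n = Suc m" using assms by (cases n) auto
  have "(a * \<pi> ^ m) * \<pi> \<in> conductor C y"
    using assms C prime_conductor_pi by (intro conductor_mult subring_set_mult subring_set_power) auto
  then show ?thesis unfolding m by (simp add: ac_simps)
qed

text \<open>\<open>n\<close> is the value of \<open>f\<close> in the localization at the prime: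
  \<open>s\<close> and \<open>c\<close> are units there. The content is that \<pi> cannot divide
  \<open>f\<close> infinitely often.\<close>

lemma prime_conductor_decomposition:
  assumes f: "f \<in> C" "f \<noteq> 0"
  shows "\<exists>n. \<exists>s\<in>C - conductor C y. \<exists>c\<in>C - conductor C y. s * f = \<pi> ^ n * c"
proof -
  define Q where "Q = conductor C y"
  define v where "v n \<longleftrightarrow> (\<exists>s\<in>C - Q. \<exists>c\<in>C. s * f = \<pi> ^ n * c)" for n
  note [simp] = prime_conductor_not_zero
  have v0: "v 0" unfolding v_def Q_def using prime_conductor_one f by (intro bexI[of _ 1] bexI[of _ f]) auto
  have "\<exists>n. \<not> v n"
  proof (rule ccontr)
    assume "\<nexists>n. \<not> v n"
    then have v: "v n" for n by blast
    \<comment> \<open>The elements of \<open>C\<close> that \<open>\<pi> ^ n\<close> carries into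
      the ideal generated by \<open>f\<close> in the localization. Once this ascending chain stops,
      divisibility of \<open>f\<close> by \<open>\<pi> ^ Suc n\<close> puts a product of elements
      outside \<open>Q\<close> into \<open>Q\<close>.\<close>
    define I where "I n = {c \<in> C. \<exists>s\<in>C - Q. \<exists>d\<in>C. s * c * \<pi> ^ n = f * d}" for n
    have "\<exists>n. I (Suc n) \<subseteq> I n"
    proof (rule noetherian_on_chain[OF C(2)])
      fix n
      show "I n \<subseteq> C" unfolding I_def by auto
      show "I n \<subseteq> I (Suc n)"
      proof
        fix c assume "c \<in> I n"
        then obtain s d where "c \<in> C" "s \<in> C - Q" "d \<in> C" "s * c * \<pi> ^ n = f * d" unfolding I_def by auto
        moreover from this have "s * c * \<pi> ^ Suc n = f * (d * \<pi>)" by (simp add: ac_simps)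
        moreover have "d * \<pi> \<in> C" using \<open>d \<in> C\<close> prime_conductor_pi C by (auto intro: subring_set_mult)
        ultimately show "c \<in> I (Suc n)" unfolding I_def by blast
      qed
      show "lin_span C (I n) \<subseteq> I n"
      proof (rule lin_span_least)
        show "0 \<in> I n" unfolding I_def Q_def using prime_conductor_one C
          by (auto intro!: bexI[of _ 1] bexI[of _ 0] subring_set_zero)
      next
        fix a b assume "a \<in> I n" "b \<in> I n"
        then obtain s d s' d' where *: "a \<in> C" "s \<in> C - Q" "d \<in> C" "s * a * \<pi> ^ n = f * d"
          "b \<in> C" "s' \<in> C - Q" "d' \<in> C" "s' * b * \<pi> ^ n = f * d'" unfolding I_def by auto
        have "(s * s') * (a + b) * \<pi> ^ n = s' * (s * a * \<pi> ^ n) + s * (s' * b * \<pi> ^ n)"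
          by (simp add: algebra_simps)
        also have "\<dots> = f * (s' * d + s * d')" using * by (simp add: algebra_simps)
        finally have "(s * s') * (a + b) * \<pi> ^ n = f * (s' * d + s * d')" .
        moreover have "s * s' \<in> C - Q" using * prime_conductor_mult unfolding Q_def by auto
        moreover have "s' * d + s * d' \<in> C" "a + b \<in> C" using * C by (auto intro: subring_intros)
        ultimately show "a + b \<in> I n" unfolding I_def by blast
      next
        fix c a assume "c \<in> C" "a \<in> I n"
        then obtain s d where *: "a \<in> C" "s \<in> C - Q" "d \<in> C" "s * a * \<pi> ^ n = f * d" unfolding I_def by auto
        have "s * (c * a) * \<pi> ^ n = f * (c * d)" using *(4) by (simp add: ac_simps)
        moreover have "c * a \<in> C" "c * d \<in> C" using * \<open>c \<in> C\<close> C by (auto intro: subring_set_mult)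
        ultimately show "c * a \<in> I n" using *(2) unfolding I_def by blast
      qed (rule subset_refl)
    qed
    then obtain n where n: "I (Suc n) \<subseteq> I n" ..
    obtain s c where sc: "s \<in> C - Q" "c \<in> C" "s * f = \<pi> ^ Suc n * c" using v[of "Suc n"] unfolding v_def by auto
    have "1 * c * \<pi> ^ Suc n = f * s" using sc by (simp add: ac_simps)
    then have "c \<in> I (Suc n)" unfolding I_def Q_def using sc prime_conductor_one by blast
    then have "c \<in> I n" using n by blast
    then obtain s' d where s': "s' \<in> C - Q" "d \<in> C" "s' * c * \<pi> ^ n = f * d" unfolding I_def by blast
    have "f * (s' * s) = s' * (\<pi> ^ Suc n * c)" using sc(3) by (simp add: ac_simps)
    also have "\<dots> = \<pi> * (s' * c * \<pi> ^ n)" by (simp add: ac_simps)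
    also have "\<dots> = f * (\<pi> ^ 1 * d)" unfolding s'(3) by (simp add: ac_simps)
    finally have "s' * s = \<pi> ^ 1 * d" using f by simp
    then have "s' * s \<in> Q" using pi_power_mult_in_conductor[of 1 d] s'(2) unfolding Q_def by simp
    moreover have "s' * s \<in> C - Q" using s' sc prime_conductor_mult unfolding Q_def by auto
    ultimately show False by simp
  qed
  then obtain n where n: "v n" "\<not> v (Suc n)" using v0 by (metis nat_induct)
  then obtain s c where sc: "s \<in> C - Q" "c \<in> C" "s * f = \<pi> ^ n * c" unfolding v_def by auto
  \<comment> \<open>Otherwise \<open>c * y\<close> is in \<open>C\<close>, and
    \<open>(\<pi> * y) * c = \<pi> * (c * y)\<close> with \<open>\<pi> * y\<close> outside
    \<open>Q\<close> extracts one more factor \<pi>.\<close>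
  have "c \<notin> Q"
  proof
    assume "c \<in> Q"
    then have "c * y \<in> C" unfolding Q_def conductor_def by auto
    have \<sigma>: "\<pi> * y \<in> C - Q" using pc unfolding prime_conductor_def Q_def conductor_def by auto
    have "(\<pi> * y * s) * f = \<pi> * y * (\<pi> ^ n * c)" using sc(3) by (simp add: ac_simps)
    also have "\<dots> = \<pi> ^ Suc n * (c * y)" by (simp add: ac_simps)
    finally have "(\<pi> * y * s) * f = \<pi> ^ Suc n * (c * y)" .
    moreover have "\<pi> * y * s \<in> C - Q" using prime_conductor_mult[of "\<pi> * y" s] \<sigma> sc unfolding Q_def by auto
    ultimately show False using n(2) \<open>c * y \<in> C\<close> unfolding v_def by blast
  qed
  then show ?thesis using sc unfolding Q_def by blast
qed

end

lemma power_add_in_ideal: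
  fixes a b :: "'a::comm_ring_1"
  assumes C: "subring_set C" and ab: "a \<in> C" "b \<in> C"
    and "w \<in> C" "a ^ k = u * w" "w' \<in> C" "b ^ n = u * w'"
  shows "\<exists>w\<in>C. (a + b) ^ (k + n) = u * w"
proof -
  have "\<exists>w\<in>C. of_nat (k + n choose i) * a ^ i * b ^ (k + n - i) = u * w" if "i \<le> k + n" for i
  proof (cases "k \<le> i")
    case True
    then have "a ^ i = a ^ k * a ^ (i - k)" by (simp flip: power_add)
    then have "of_nat (k + n choose i) * a ^ i * b ^ (k + n - i)
        = u * (w * (of_nat (k + n choose i) * a ^ (i - k) * b ^ (k + n - i)))"
      using assms by (simp add: ac_simps)
    then show ?thesis by (rule bexI) (intro subring_intros C assms)
  next
    case False
    then have "k + n - i = n + (k - i)" by simp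
    then have "b ^ (k + n - i) = b ^ n * b ^ (k - i)" by (simp only: power_add)
    then have "of_nat (k + n choose i) * a ^ i * b ^ (k + n - i)
        = u * (w' * (of_nat (k + n choose i) * a ^ i * b ^ (k - i)))"
      using assms by (simp add: ac_simps)
    then show ?thesis by (rule bexI) (intro subring_intros C assms)
  qed
  then obtain g where g: "\<And>i. i \<le> k + n \<Longrightarrow> g i \<in> C"
    "\<And>i. i \<le> k + n \<Longrightarrow> of_nat (k + n choose i) * a ^ i * b ^ (k + n - i) = u * g i" by metis
  have "(a + b) ^ (k + n) = u * (\<Sum>i\<le>k + n. g i)"
    unfolding binomial_ring sum_distrib_left using g by (intro sum.cong) auto
  then show ?thesis using g C by (intro bexI) (auto intro: subring_set_sum)
qed

text \<open>The radical of the principal ideal is finitely generated; by the binomial formula the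
  exponents of its generators add up to one that works for all its elements.\<close>

lemma radical_exponent_bounded:
  fixes C :: "'a::comm_ring_1 set"
  assumes C: "subring_set C" "noetherian_on C C"
  shows "\<exists>n. \<forall>z\<in>C. (\<exists>k. \<exists>w\<in>C. z ^ k = u * w) \<longrightarrow> (\<exists>w\<in>C. z ^ n = u * w)"
proof -
  define N where "N = {z \<in> C. \<exists>k. \<exists>w\<in>C. z ^ k = u * w}"
  have "N \<subseteq> C" unfolding N_def by auto
  from noetherian_onE[OF C(2) this] obtain G where G: "G \<subseteq> N" "finite G" "N \<subseteq> lin_span C G" .
  from G(2,1) have "\<exists>n. \<forall>z\<in>lin_span C G. \<exists>w\<in>C. z ^ n = u * w"
  proof (induction G)
    case empty
    have "lin_span C {} \<subseteq> {0}" by (rule lin_span_least) auto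
    then show ?case using subring_set_zero[OF C(1)] by (intro exI[of _ 1]) (auto intro!: bexI[of _ 0])
  next
    case (insert g G)
    then obtain n where n: "\<And>z. z \<in> lin_span C G \<Longrightarrow> \<exists>w\<in>C. z ^ n = u * w" by auto
    obtain k w where k: "g \<in> C" "w \<in> C" "g ^ k = u * w" using insert.prems unfolding N_def by auto
    have GC: "lin_span C G \<subseteq> C" using insert.prems by (intro lin_span_self C) (auto simp: N_def)
    have "\<exists>w\<in>C. z ^ (k + n) = u * w" if z: "z \<in> lin_span C (insert g G)" for z
    proof -
      obtain c where c: "c \<in> C" "z - c * g \<in> lin_span C G" using lin_span_insert[OF C(1) z] by blast
      obtain w' where w': "w' \<in> C" "(z - c * g) ^ n = u * w'" using n c by blast
      have "(c * g) ^ k = u * (c ^ k * w)" using k by (simp add: power_mult_distrib ac_simps)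
      moreover have "c ^ k * w \<in> C" "c * g \<in> C" "z - c * g \<in> C" using C c k GC by (auto intro: subring_intros)
      ultimately have "\<exists>w\<in>C. (c * g + (z - c * g)) ^ (k + n) = u * w"
        using power_add_in_ideal[OF C(1)] w' by blast
      then show ?thesis by simp
    qed
    then show ?case by blast
  qed
  then show ?thesis using G(3) unfolding N_def by blast
qed

text \<open>The order of \<open>f\<close> along \<open>u\<close> is the minimum of \<open>v f / v u\<close> over the discrete valuations \<open>v\<close>
  at prime conductors containing \<open>u\<close>. Since \<open>\<pi>\<close> times a unit lies in the radical of \<open>u\<close>, the
  values \<open>v u\<close> are bounded, so all orders have the common denominator \<open>fact n\<close>.\<close>

theorem bounded_order_denominators:
  fixes C :: "'a::field set"
  assumes C: "subring_set C" "noetherian_on C C" "normal_set C" and u: "u \<in> C" "u \<noteq> 0"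
  shows "\<exists>e>0. \<forall>f\<in>C. \<forall>q>0. \<forall>p. f ^ q / u ^ p \<in> C \<longrightarrow> (\<exists>p'. p * e \<le> p' * q \<and> f ^ e / u ^ p' \<in> C)"
proof -
  obtain n where n: "\<And>z k w. z \<in> C \<Longrightarrow> w \<in> C \<Longrightarrow> z ^ k = u * w \<Longrightarrow> \<exists>w\<in>C. z ^ n = u * w"
    using radical_exponent_bounded[OF C(1,2), of u] by blast
  \<comment> \<open>The value \<open>k\<close> of \<open>u\<close> at each valuation used below
    satisfies \<open>0 < k \<le> n\<close>, hence divides \<open>fact n\<close>.\<close>
  define e :: nat where "e = fact n"
  have e0: "e > 0" unfolding e_def by simp
  have "\<exists>p'. p * e \<le> p' * q \<and> f ^ e / u ^ p' \<in> C" if f: "f \<in> C" and q: "q > 0" and fq: "f ^ q / u ^ p \<in> C"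
    for f q p
  proof (cases "f = 0")
    case True
    then show ?thesis using q e0 subring_set_zero[OF C(1)] by (intro exI[of _ "p * e"]) (auto simp: power_0_left)
  next
    case f0: False
    \<comment> \<open>The ceiling of \<open>p * e / q\<close>, the least exponent that satisfies the
      inequality.\<close>
    define p' where "p' = (p * e + q - 1) div q"
    have p': "p * e \<le> p' * q" "p' * q < p * e + q"
    proof -
      define r where "r = (p * e + q - 1) mod q"
      have "r < q" unfolding r_def using q by simp
      moreover have "p' * q + r = p * e + q - 1" unfolding p'_def r_def by simp
      ultimately show "p * e \<le> p' * q" "p' * q < p * e + q" using q by linarith+
    qed
    define x where "x = f ^ e / u ^ p'"
    have "x \<in> C"
    proof (rule ccontr)
      assume xC: "x \<notin> C"
      have "x \<in> fraction_set C" unfolding x_def using u f C by (intro fraction_setI) (auto intro: subring_set_power)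
      then obtain c \<pi> where c: "c \<in> C" and pc: "prime_conductor C (c * x) \<pi>"
        using prime_conductor_exists[OF C] xC by blast
      define Q where "Q = conductor C (c * x)"
      note mult = prime_conductor_mult[OF C(1,2) pc, folded Q_def]
      note pow = prime_conductor_power[OF C(1,2) pc, folded Q_def]
      note dec = prime_conductor_decomposition[OF C(1,2) pc, folded Q_def]
      note pi = prime_conductor_pi[OF C(1,2) pc, folded Q_def]
      note pi0 = prime_conductor_not_zero[OF C(1,2) pc]
      note piQ = pi_power_mult_in_conductor[OF C(1,2) pc, folded Q_def]
      \<comment> \<open>\<open>u ^ p'\<close> clears the denominator of \<open>x\<close> and so lies
        in the prime \<open>Q\<close>; if \<open>u\<close> were outside, so would be this
        power.\<close>
      have "u \<in> Q"
      proof (rule ccontr)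
        assume "u \<notin> Q"
        have "u ^ p' * (c * x) = c * f ^ e" using u by (simp add: x_def)
        also have "\<dots> \<in> C" using f c C(1) by (intro subring_intros)
        finally have "u ^ p' \<in> Q" unfolding Q_def conductor_def
          using u subring_set_power[OF C(1)] by auto
        moreover have "u ^ p' \<in> C - Q" using u \<open>u \<notin> Q\<close> pow by auto
        ultimately show False by simp
      qed
      obtain k s d where sd: "s \<in> C - Q" "d \<in> C - Q" "s * u = \<pi> ^ k * d" using dec[OF u] by blast
      have sdC: "s \<in> C" "d \<in> C" using sd by auto
      have k0: "k > 0"
      proof (rule ccontr)
        assume "\<not> k > 0"
        then have "s * u = d" using sd by simp
        moreover have "s * u \<in> Q" unfolding Q_def
          by (rule conductor_mult[OF C(1)]) (use sdC \<open>u \<in> Q\<close> Q_def in auto)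
        ultimately have "d \<in> Q" by metis
        then show False using sd by simp
      qed
      \<comment> \<open>\<open>\<pi> * d\<close> has value 1 and a power divisible by
        \<open>u\<close>. By the choice of \<open>n\<close> already its \<open>n\<close>-th power is
        divisible by \<open>u\<close>, which bounds the value \<open>k\<close> of \<open>u\<close>
        by \<open>n\<close>.\<close>
      have "(\<pi> * d) ^ k = \<pi> ^ k * d * d ^ (k - 1)"
        using k0 by (cases k) (auto simp: power_mult_distrib ac_simps)
      also have "\<dots> = u * (s * d ^ (k - 1))" unfolding sd(3)[symmetric] by (simp add: ac_simps)
      finally have pidk: "(\<pi> * d) ^ k = u * (s * d ^ (k - 1))" .
      obtain w where w: "w \<in> C" "(\<pi> * d) ^ n = u * w"
        using n[OF _ _ pidk] sdC pi C(1) by (auto intro: subring_intros)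
      have "k \<le> n"
      proof (rule ccontr)
        assume "\<not> k \<le> n"
        then have kn: "\<pi> ^ k = \<pi> ^ n * \<pi> ^ (k - n)" by (simp flip: power_add)
        have "\<pi> ^ n * (s * d ^ n) = s * (\<pi> * d) ^ n" by (simp add: power_mult_distrib ac_simps)
        also have "\<dots> = (s * u) * w" unfolding w(2) by (simp add: ac_simps)
        also have "\<dots> = \<pi> ^ n * (\<pi> ^ (k - n) * (d * w))" unfolding sd(3) kn by (simp add: ac_simps)
        finally have "s * d ^ n = \<pi> ^ (k - n) * (d * w)" using pi0 by simp
        then have "s * d ^ n \<in> Q" using piQ[of "k - n" "d * w"] \<open>\<not> k \<le> n\<close> sdC w C(1)
          by (auto intro: subring_set_mult)
        moreover have "s * d ^ n \<in> C - Q" using sd by (intro mult pow)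
        ultimately show False by simp
      qed
      then have "k dvd e" unfolding e_def using k0 by (intro dvd_fact) auto
      then obtain e' where e': "e = k * e'" by auto
      obtain m s' d' where sd': "s' \<in> C - Q" "d' \<in> C - Q" "s' * f = \<pi> ^ m * d'" using dec[OF f f0] by blast
      have sdC': "s' \<in> C" "d' \<in> C" using sd' by auto
      define g where "g = f ^ q / u ^ p"
      have g: "g \<in> C" "f ^ q = u ^ p * g" using fq u unfolding g_def by auto
      \<comment> \<open>With \<open>k\<close> and \<open>m\<close> the values of \<open>u\<close>
        and \<open>f\<close>, this compares values in \<open>f ^ q = u ^ p * g\<close>. In the
        contrary case a product of elements outside \<open>Q\<close> would be a multiple of
        \<pi>.\<close>
      have "p * k \<le> q * m"
      proof (rule ccontr)
        assume lt: "\<not> p * k \<le> q * m"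
        then have pk: "\<pi> ^ (k * p) = \<pi> ^ (m * q) * \<pi> ^ (k * p - m * q)" by (simp add: mult.commute flip: power_add)
        have "\<pi> ^ (m * q) * (s ^ p * d' ^ q) = s ^ p * (s' * f) ^ q"
          unfolding sd'(3) by (simp add: power_mult_distrib ac_simps flip: power_mult)
        also have "\<dots> = s' ^ q * (s * u) ^ p * g" unfolding power_mult_distrib g(2) by (simp add: ac_simps)
        also have "\<dots> = \<pi> ^ (m * q) * (\<pi> ^ (k * p - m * q) * (s' ^ q * d ^ p * g))"
          unfolding sd(3) power_mult_distrib by (simp add: pk ac_simps flip: power_mult)
        finally have "s ^ p * d' ^ q = \<pi> ^ (k * p - m * q) * (s' ^ q * d ^ p * g)" using pi0 by simp
        moreover have "s' ^ q * d ^ p * g \<in> C" using sdC' sdC g C(1) by (auto intro: subring_intros)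
        ultimately have "s ^ p * d' ^ q \<in> Q" using piQ[of "k * p - m * q"] lt by (auto simp: mult.commute)
        moreover have "s ^ p * d' ^ q \<in> C - Q" using sd sd' by (intro mult pow)
        ultimately show False by simp
      qed
      then have "p * k * e' \<le> q * m * e'" by simp
      \<comment> \<open>\<open>m * e'\<close> is the value of \<open>f ^ e\<close> divided by that
        of \<open>u\<close>. It is an integer since \<open>k\<close> divides \<open>e\<close>, so
        rounding \<open>p * e / q\<close> up to \<open>p'\<close> does not pass it.\<close>
      then have "p * e \<le> m * e' * q" unfolding e' by (simp add: ac_simps)
      then have "p' * q < (m * e' + 1) * q" using p'(2) by (simp add: algebra_simps)
      then have "p' < m * e' + 1" by (simp only: mult_less_cancel2)
      then have "p' \<le> m * e'" by simp
      then have "k * p' \<le> k * (m * e')" by simp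
      then have le: "k * p' \<le> m * e" unfolding e' by (simp add: ac_simps)
      \<comment> \<open>Outside \<open>Q\<close>, yet it multiplies \<open>x\<close> into
        \<open>C\<close> and thus lies in the conductor \<open>Q\<close> of
        \<open>c * x\<close>.\<close>
      define \<sigma> where "\<sigma> = d ^ p' * s' ^ e"
      have \<sigma>: "\<sigma> \<in> C - Q" unfolding \<sigma>_def using sd sd' by (intro mult pow)
      have "\<sigma> * f ^ e = d ^ p' * (s' * f) ^ e" unfolding \<sigma>_def by (simp add: power_mult_distrib ac_simps)
      also have "\<dots> = \<pi> ^ (m * e) * (d' ^ e * d ^ p')"
        unfolding sd'(3) by (simp add: power_mult_distrib ac_simps flip: power_mult)
      also have "\<pi> ^ (m * e) = \<pi> ^ (m * e - k * p') * \<pi> ^ (k * p')" using le by (simp flip: power_add)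
      also have "\<pi> ^ (m * e - k * p') * \<pi> ^ (k * p') * (d' ^ e * d ^ p')
          = \<pi> ^ (m * e - k * p') * d' ^ e * (\<pi> ^ k * d) ^ p'"
        by (simp add: power_mult_distrib ac_simps flip: power_mult)
      also have "\<dots> = (\<pi> ^ (m * e - k * p') * d' ^ e * s ^ p') * u ^ p'"
        unfolding sd(3)[symmetric] by (simp add: power_mult_distrib ac_simps)
      finally have "\<sigma> * x = \<pi> ^ (m * e - k * p') * d' ^ e * s ^ p'" using u by (simp add: x_def)
      also have "\<dots> \<in> C" using pi sdC sdC' C(1) by (auto intro: subring_intros)
      finally have "c * (\<sigma> * x) \<in> C" using c C(1) by (auto intro: subring_set_mult)
      then have "\<sigma> * (c * x) \<in> C" by (simp add: ac_simps)
      then have "\<sigma> \<in> Q" using \<sigma> unfolding Q_def conductor_def by simp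
      then show False using \<sigma> by simp
    qed
    then show ?thesis using p'(1) unfolding x_def by blast
  qed
  then show ?thesis using e0 by blast
qed

section \<open>Idealistic filtrations and graded subrings\<close>

lemma ideal_ring_of_type_algebra_iff:
  fixes M :: "'r::comm_ring_1 set"
  shows "ideal M (ring_of_type_algebra :: 'r ring) \<longleftrightarrow>
    0 \<in> M \<and> (\<forall>x\<in>M. \<forall>y\<in>M. x + y \<in> M) \<and> (\<forall>a. \<forall>x\<in>M. a * x \<in> M)"
proof
  assume "ideal M (ring_of_type_algebra :: 'r ring)"
  then interpret ideal M "ring_of_type_algebra :: 'r ring" .
  show "0 \<in> M \<and> (\<forall>x\<in>M. \<forall>y\<in>M. x + y \<in> M) \<and> (\<forall>a. \<forall>x\<in>M. a * x \<in> M)"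
    using additive_subgroup.zero_closed[OF is_additive_subgroup]
      additive_subgroup.a_closed[OF is_additive_subgroup] I_l_closed by (auto simp: ring_of_type_algebra_def)
next
  assume M: "0 \<in> M \<and> (\<forall>x\<in>M. \<forall>y\<in>M. x + y \<in> M) \<and> (\<forall>a. \<forall>x\<in>M. a * x \<in> M)"
  interpret R: ring "ring_of_type_algebra :: 'r ring" by rule
  have neg: "a_inv (ring_of_type_algebra :: 'r ring) x = - x" for x
    by (rule R.minus_equality) (auto simp: ring_of_type_algebra_def)
  have "- x \<in> M" if "x \<in> M" for x
    using M that by (metis mult_minus1)
  moreover have mult_right: "x * a \<in> M" if "x \<in> M" for a x
    using M that by (simp add: mult.commute)
  ultimately show "ideal M (ring_of_type_algebra :: 'r ring)"
    using M mult_right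
    by (intro idealI R.ring_axioms subgroup.intro)
       (auto simp: ring_of_type_algebra_def neg[unfolded a_inv_def ring_of_type_algebra_def, simplified])
qed

lemma idealistic_filtration_iff:
  "idealistic_filtration I \<longleftrightarrow>
    (\<forall>f. (f, 0) \<in> I) \<and> (\<forall>a. (0, a) \<in> I) \<and>
    (\<forall>f g a. (f, a) \<in> I \<longrightarrow> (g, a) \<in> I \<longrightarrow> (f + g, a) \<in> I) \<and>
    (\<forall>f g a b. (f, a) \<in> I \<longrightarrow> (g, b) \<in> I \<longrightarrow> (f * g, a + b) \<in> I) \<and>
    (\<forall>f a b. (f, a) \<in> I \<longrightarrow> b \<le> a \<longrightarrow> (f, b) \<in> I)" (is "_ \<longleftrightarrow> ?R")
proof
  assume "idealistic_filtration I"
  then show ?R unfolding idealistic_filtration_def ideal_ring_of_type_algebra_iff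
    by (simp add: level_def subset_iff set_eq_iff)
next
  assume R: ?R
  then have "(c * f, a) \<in> I" if "(f, a) \<in> I" for c f a
    using that by (metis add_0)
  then show "idealistic_filtration I"
    using R unfolding idealistic_filtration_def ideal_ring_of_type_algebra_iff
    by (auto simp: level_def)
qed

context
  fixes I :: "('r::comm_ring_1 \<times> real) set"
  assumes I: "idealistic_filtration I"
begin

lemmas filtration_rules = I[unfolded idealistic_filtration_iff]

lemma filtration_zero: "(0, a) \<in> I"
  using filtration_rules by simp

lemma filtration_add: "(f, a) \<in> I \<Longrightarrow> (g, a) \<in> I \<Longrightarrow> (f + g, a) \<in> I"
  using filtration_rules by simp

lemma filtration_mult: "(f, a) \<in> I \<Longrightarrow> (g, b) \<in> I \<Longrightarrow> (f * g, a + b) \<in> I"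
  using filtration_rules by simp

lemma filtration_antimono: "(f, a) \<in> I \<Longrightarrow> b \<le> a \<Longrightarrow> (f, b) \<in> I"
  using filtration_rules by metis

lemma filtration_nonpos: "a \<le> 0 \<Longrightarrow> (f, a) \<in> I"
  using filtration_rules by metis

lemma filtration_scale: "(f, a) \<in> I \<Longrightarrow> (c * f, a) \<in> I"
  using filtration_mult[of c 0 f a] filtration_nonpos by simp

lemma filtration_uminus: "(f, a) \<in> I \<Longrightarrow> (- f, a) \<in> I"
  using filtration_scale[of f a "-1"] by simp

lemma filtration_sum: "(\<And>i. i \<in> A \<Longrightarrow> (g i, a) \<in> I) \<Longrightarrow> (sum g A, a) \<in> I"
  by (induction A rule: infinite_finite_induct) (auto intro: filtration_zero filtration_add)

lemma filtration_power: "(f, a) \<in> I \<Longrightarrow> (f ^ n, real n * a) \<in> I"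
proof (induction n)
  case (Suc n)
  then have "(f * f ^ n, a + real n * a) \<in> I" by (intro filtration_mult)
  then show ?case by (simp add: algebra_simps)
qed (simp add: filtration_nonpos)

lemma filtration_unit:
  assumes "(c * f, a) \<in> I" "c dvd 1"
  shows "(f, a) \<in> I"
proof -
  obtain d where "1 = c * d" using assms(2) by auto
  then have "d * (c * f) = f" by (metis mult.assoc mult.commute mult_1)
  then show ?thesis using filtration_scale[OF assms(1), of d] by simp
qed

end

lemma generated_filtration_base: "T \<subseteq> generated_filtration T"
  and generated_filtration_least: "idealistic_filtration J \<Longrightarrow> T \<subseteq> J \<Longrightarrow> generated_filtration T \<subseteq> J"
  unfolding generated_filtration_def by auto

lemma R_saturation_base: "I \<subseteq> R_saturation I"
  and R_saturation_least:
    "idealistic_filtration J \<Longrightarrow> R_saturated J \<Longrightarrow> I \<subseteq> J \<Longrightarrow> R_saturation I \<subseteq> J"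
  unfolding R_saturation_def by auto

text \<open>If \<open>f\<close> has level \<open>b < a\<close>, the equation gives \<open>f ^ m\<close> the level \<open>a + (m - 1) * b\<close>, so by
  radicality the distance of the level of \<open>f\<close> to \<open>a\<close> shrinks by the factor \<open>1 - 1 / m\<close>.\<close>

lemma R_saturated_integral_equation:
  fixes J :: "('r::comm_ring_1 \<times> real) set"
  assumes J: "idealistic_filtration J" "R_saturated J" and a: "a > 0"
    and eq: "f ^ m = (\<Sum>i<m. c i * f ^ i)" and c: "\<And>i. i < m \<Longrightarrow> (c i, real (m - i) * a) \<in> J"
  shows "(f, a) \<in> J"
proof -
  have m: "m > 0" using eq by (cases m) auto
  define r where "r = 1 - 1 / real m"
  have r: "0 \<le> r" "r < 1" using m unfolding r_def by auto
  define s where "s l = a * (1 - r ^ l)" for l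
  have "(f, s l) \<in> J" for l
  proof (induction l)
    case 0
    show ?case using J by (simp add: s_def filtration_nonpos)
  next
    case (Suc l)
    have "real m * r = real m - 1" using m unfolding r_def by (simp add: field_simps)
    moreover have "real m * s (Suc l) = real m * a - (real m * r) * (a * r ^ l)"
      unfolding s_def by (simp add: algebra_simps)
    ultimately have lev: "real m * s (Suc l) = real m * a - (real m - 1) * (a * r ^ l)" by simp
    have "(c i * f ^ i, real m * s (Suc l)) \<in> J" if i: "i < m" for i
    proof -
      have "(c i * f ^ i, real (m - i) * a + real i * s l) \<in> J"
        using c[OF i] Suc J(1) by (intro filtration_mult filtration_power) auto
      moreover have "real m * s (Suc l) \<le> real (m - i) * a + real i * s l"
      proof -
        have "real i * (a * r ^ l) \<le> (real m - 1) * (a * r ^ l)"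
          using i a r by (intro mult_right_mono mult_nonneg_nonneg) auto
        then show ?thesis unfolding lev using i by (simp add: s_def of_nat_diff algebra_simps)
      qed
      ultimately show ?thesis by (rule filtration_antimono[OF J(1)])
    qed
    then have "(f ^ m, real m * s (Suc l)) \<in> J" unfolding eq by (intro filtration_sum[OF J(1)]) auto
    then show ?case using J(2) m unfolding R_saturated_def by blast
  qed
  moreover have "s \<longlonglongrightarrow> a * (1 - 0)"
    unfolding s_def using r by (intro tendsto_intros LIMSEQ_power_zero) auto
  then have "s \<longlonglongrightarrow> a" by simp
  ultimately show ?thesis using J(2) unfolding R_saturated_def by blast
qed

text \<open>The subring \<open>\<Sum>\<^sub>i I\<^bsub>i\<mu>\<^esub> s\<^sup>i\<close> (with \<open>i\<close> ranging over the integers) of a ring containing \<open>j(R)\<close>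
  and \<open>s\<close>; denominators are powers of \<open>s\<close>.\<close>

definition laurent :: "('r \<Rightarrow> 'w::field) \<Rightarrow> 'w \<Rightarrow> real \<Rightarrow> ('r::comm_ring_1 \<times> real) set \<Rightarrow> 'w set" where
  "laurent j s \<mu> I = {b. \<exists>N q. b * s ^ N = poly q s \<and>
     (\<forall>i. \<exists>c. coeff q i = j c \<and> (c, \<mu> * (real i - real N)) \<in> I)}"

text \<open>Interpreted for \<open>t\<close> and again for its root \<open>s\<close>; both live in
  the same algebraically closed target.\<close>

locale transcendental_embedding = j: comm_ring_hom j
  for j :: "'r::idom \<Rightarrow> 'w::alg_closed_field" +
  fixes s :: 'w
  assumes inj_j: "inj j"
    and transcendental: "\<And>q. q \<in> poly_set (range j) \<Longrightarrow> poly q s = 0 \<Longrightarrow> q = 0"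
begin

lemma subring_range: "subring_set (range j)"
  by (rule subring_setI) (auto simp flip: j.hom_one j.hom_uminus j.hom_add j.hom_mult)

lemma s_nonzero: "s \<noteq> 0"
proof
  assume "s = 0"
  then have "poly (monom 1 1) s = 0" by (simp add: poly_monom)
  then have "monom (1::'w) 1 = 0"
    by (intro transcendental monom_in_poly_set subring_range subring_set_one)
  then show False by simp
qed

lemma j_eq_iff: "j x = j y \<longleftrightarrow> x = y"
  using inj_j by (auto dest: injD)

lemma laurent_monom:
  assumes "idealistic_filtration I" "(c, \<mu> * real k) \<in> I"
  shows "j c * s ^ k \<in> laurent j s \<mu> I"
proof -
  have "\<exists>d. coeff (monom (j c) k) i = j d \<and> (d, \<mu> * (real i - real 0)) \<in> I" for i
    using assms filtration_zero[OF assms(1)] j.hom_zero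
    by (cases "i = k") (auto intro: exI[of _ c] exI[of _ 0])
  then show ?thesis unfolding laurent_def
    by (intro CollectI exI[of _ 0] exI[of _ "monom (j c) k"]) (simp add: poly_monom)
qed

lemma laurent_j: "idealistic_filtration I \<Longrightarrow> j c \<in> laurent j s \<mu> I"
  using laurent_monom[of I c \<mu> 0] by (simp add: filtration_nonpos)

lemma laurent_inverse:
  assumes "idealistic_filtration I" "\<mu> > 0"
  shows "inverse s \<in> laurent j s \<mu> I"
proof -
  have "\<exists>d. coeff 1 i = j d \<and> (d, \<mu> * (real i - real 1)) \<in> I" for i
    using assms filtration_zero[OF assms(1)] filtration_nonpos[OF assms(1)] j.hom_zero j.hom_one
    by (cases "i = 0") (auto intro: exI[of _ 1] exI[of _ 0])
  then show ?thesis unfolding laurent_def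
    using s_nonzero by (intro CollectI exI[of _ 1] exI[of _ "1 :: 'w poly"]) simp
qed

lemma coeff_shift:
  assumes I: "idealistic_filtration I"
    and q: "\<And>i. \<exists>c. coeff q i = j c \<and> (c, \<mu> * (real i - real N)) \<in> I"
  shows "\<exists>c. coeff (monom 1 M * q) i = j c \<and> (c, \<mu> * (real i - real (N + M))) \<in> I"
proof (cases "i < M")
  case True
  then show ?thesis using filtration_zero[OF I] j.hom_zero by (auto simp: coeff_monom_mult intro: exI[of _ 0])
next
  case False
  obtain c where c: "coeff q (i - M) = j c" "(c, \<mu> * (real (i - M) - real N)) \<in> I" using q by blast
  have "real (i - M) - real N = real i - real (N + M)" using False by (simp add: of_nat_diff)
  with c(2) have "(c, \<mu> * (real i - real (N + M))) \<in> I" by (simp only:)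
  then show ?thesis using False c(1) by (intro exI[of _ c]) (simp add: coeff_monom_mult)
qed

lemma subring_laurent:
  assumes I: "idealistic_filtration I"
  shows "subring_set (laurent j s \<mu> I)"
proof (rule subring_setI)
  show "1 \<in> laurent j s \<mu> I" using laurent_j[OF I, of 1] by (simp add: j.hom_one)
next
  fix x assume "x \<in> laurent j s \<mu> I"
  then obtain N q where q: "x * s ^ N = poly q s"
    "\<And>i. \<exists>c. coeff q i = j c \<and> (c, \<mu> * (real i - real N)) \<in> I" unfolding laurent_def by auto
  have "\<exists>c. coeff (- q) i = j c \<and> (c, \<mu> * (real i - real N)) \<in> I" for i
    using q(2)[of i] filtration_uminus[OF I] by (metis coeff_minus j.hom_uminus)
  then show "- x \<in> laurent j s \<mu> I" unfolding laurent_def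
    using q(1) by (intro CollectI exI[of _ N] exI[of _ "- q"]) simp
next
  fix x y assume "x \<in> laurent j s \<mu> I" "y \<in> laurent j s \<mu> I"
  then obtain N q M p where q: "x * s ^ N = poly q s"
    "\<And>i. \<exists>c. coeff q i = j c \<and> (c, \<mu> * (real i - real N)) \<in> I"
    and p: "y * s ^ M = poly p s"
    "\<And>i. \<exists>c. coeff p i = j c \<and> (c, \<mu> * (real i - real M)) \<in> I" unfolding laurent_def by auto
  have "\<exists>c. coeff (monom 1 M * q + monom 1 N * p) i = j c \<and> (c, \<mu> * (real i - real (N + M))) \<in> I" for i
  proof -
    obtain c d where "coeff (monom 1 M * q) i = j c" "(c, \<mu> * (real i - real (N + M))) \<in> I"
      "coeff (monom 1 N * p) i = j d" "(d, \<mu> * (real i - real (N + M))) \<in> I"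
      using coeff_shift[OF I q(2), of M i] coeff_shift[OF I p(2), of N i] by (auto simp: add.commute)
    then show ?thesis using filtration_add[OF I] by (intro exI[of _ "c + d"]) (simp add: j.hom_add)
  qed
  moreover have "(x + y) * s ^ (N + M) = poly (monom 1 M * q + monom 1 N * p) s"
    unfolding poly_add poly_mult poly_monom q(1)[symmetric] p(1)[symmetric]
    by (simp add: power_add algebra_simps)
  ultimately show "x + y \<in> laurent j s \<mu> I" unfolding laurent_def by blast
  have "\<exists>c. coeff (q * p) i = j c \<and> (c, \<mu> * (real i - real (N + M))) \<in> I" for i
  proof -
    have "\<exists>c. coeff q k * coeff p (i - k) = j c \<and> (c, \<mu> * (real i - real (N + M))) \<in> I" if "k \<le> i" for k
    proof -
      obtain c d where cd: "coeff q k = j c" "(c, \<mu> * (real k - real N)) \<in> I"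
        "coeff p (i - k) = j d" "(d, \<mu> * (real (i - k) - real M)) \<in> I" using q(2) p(2) by blast
      have "(c * d, \<mu> * (real k - real N) + \<mu> * (real (i - k) - real M)) \<in> I"
        by (rule filtration_mult[OF I cd(2) cd(4)])
      then show ?thesis using that cd by (intro exI[of _ "c * d"]) (auto simp: j.hom_mult of_nat_diff algebra_simps)
    qed
    then obtain c where c: "\<And>k. k \<le> i \<Longrightarrow> coeff q k * coeff p (i - k) = j (c k)"
      "\<And>k. k \<le> i \<Longrightarrow> (c k, \<mu> * (real i - real (N + M))) \<in> I" by metis
    have "coeff (q * p) i = j (\<Sum>k\<le>i. c k)" unfolding coeff_mult j.hom_sum using c(1) by (intro sum.cong) auto
    then show ?thesis using filtration_sum[OF I, of "{..i}" c] c(2) by auto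
  qed
  moreover have "(x * y) * s ^ (N + M) = poly (q * p) s"
    unfolding poly_mult q(1)[symmetric] p(1)[symmetric] by (simp add: power_add algebra_simps)
  ultimately show "x * y \<in> laurent j s \<mu> I" unfolding laurent_def by blast
qed

text \<open>Transcendence permits comparing coefficients, so membership of a homogeneous element in
  the graded ring turns back into membership in the filtration.\<close>

lemma laurent_homogeneous:
  assumes "j f * s ^ k \<in> laurent j s \<mu> I"
  shows "(f, \<mu> * real k) \<in> I"
proof -
  obtain N q where q: "j f * s ^ k * s ^ N = poly q s"
    "\<And>i. \<exists>c. coeff q i = j c \<and> (c, \<mu> * (real i - real N)) \<in> I" using assms unfolding laurent_def by auto
  have "q - monom (j f) (k + N) = 0"
  proof (rule transcendental)
    have "q \<in> poly_set (range j)" using q(2) unfolding poly_set_def by fast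
    then show "q - monom (j f) (k + N) \<in> poly_set (range j)"
      by (intro subring_set_diff subring_poly_set monom_in_poly_set subring_range) auto
    show "poly (q - monom (j f) (k + N)) s = 0"
      using q(1) by (simp add: poly_monom power_add mult.assoc)
  qed
  then have "coeff q (k + N) = j f" by simp
  then show ?thesis using q(2)[of "k + N"] by (auto simp: j_eq_iff)
qed

text \<open>Take the coefficient of \<open>s ^ (k * m)\<close> in an integral equation of degree \<open>m\<close>.\<close>

lemma integral_over_laurent_imp_saturated:
  assumes J: "idealistic_filtration J" "R_saturated J"
    and B: "B \<subseteq> laurent j s \<mu> J" and k: "\<mu> > 0" "k > 0" and int: "integral_over B (j f * s ^ k)"
  shows "(f, \<mu> * real k) \<in> J"
proof -
  obtain p where p: "p \<in> poly_set B" "lead_coeff p = 1" "poly p (j f * s ^ k) = 0"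
    using int unfolding integral_over_def by auto
  define m where "m = degree p"
  have "\<forall>i. \<exists>N q. coeff p i * s ^ N = poly q s \<and>
      (\<forall>l. \<exists>c. coeff q l = j c \<and> (c, \<mu> * (real l - real N)) \<in> J)"
    using p(1) B unfolding poly_set_def laurent_def by blast
  then obtain N q where q: "\<And>i. coeff p i * s ^ N i = poly (q i) s"
    "\<And>i l. \<exists>c. coeff (q i) l = j c \<and> (c, \<mu> * (real l - real (N i))) \<in> J"
    by metis
  \<comment> \<open>A common exponent for the denominators \<open>s ^ N i\<close>. The integral
    equation times \<open>s ^ M\<close> becomes \<open>P(s) = 0\<close>, transcendence gives
    \<open>P = 0\<close>, and the coefficient at \<open>k * m + M\<close> is an equation for
    \<open>f\<close> over \<open>R\<close>.\<close>
  define M where "M = (\<Sum>i<m. N i)"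
  have NM: "N i \<le> M" if "i < m" for i unfolding M_def using that by (intro member_le_sum) auto
  define P where "P = monom (j (f ^ m)) (k * m + M) + (\<Sum>i<m. monom (j (f ^ i)) (M - N i + k * i) * q i)"
  have "poly P s = 0"
  proof -
    have "poly (monom (j (f ^ i)) (M - N i + k * i) * q i) s = s ^ M * (coeff p i * (j f * s ^ k) ^ i)"
      if "i < m" for i
    proof -
      have "s ^ M = s ^ N i * s ^ (M - N i)" using NM[OF that] by (simp flip: power_add)
      then show ?thesis
        by (simp add: poly_monom q(1)[symmetric] power_add power_mult_distrib j.hom_power ac_simps flip: power_mult)
    qed
    then have "(\<Sum>i<m. poly (monom (j (f ^ i)) (M - N i + k * i) * q i) s)
        = (\<Sum>i<m. s ^ M * (coeff p i * (j f * s ^ k) ^ i))" by (intro sum.cong) auto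
    moreover have "poly (monom (j (f ^ m)) (k * m + M)) s = s ^ M * (j f * s ^ k) ^ m"
      by (simp add: poly_monom power_add power_mult power_mult_distrib j.hom_power ac_simps)
    ultimately have "poly P s = s ^ M * (j f * s ^ k) ^ m + (\<Sum>i<m. s ^ M * (coeff p i * (j f * s ^ k) ^ i))"
      unfolding P_def poly_add poly_sum by simp
    also have "\<dots> = s ^ M * poly p (j f * s ^ k)"
      using p(2) unfolding poly_altdef m_def
      by (simp add: lessThan_Suc_atMost[symmetric] sum_distrib_left distrib_left)
    finally show ?thesis using p(3) by simp
  qed
  moreover have "P \<in> poly_set (range j)"
  proof -
    have "q i \<in> poly_set (range j)" for i using q(2)[of i] unfolding poly_set_def by fast
    then show ?thesis unfolding P_def
      by (intro subring_set_add subring_set_sum subring_set_mult subring_poly_set monom_in_poly_set subring_range) auto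
  qed
  ultimately have P0: "P = 0" by (intro transcendental)
  have "\<forall>i. \<exists>c. coeff (q i) (k * (m - i) + N i) = j c \<and> (c, \<mu> * (real (k * (m - i) + N i) - real (N i))) \<in> J"
    using q(2) by blast
  then obtain c where c: "\<And>i. coeff (q i) (k * (m - i) + N i) = j (c i)"
    "\<And>i. (c i, \<mu> * (real (k * (m - i) + N i) - real (N i))) \<in> J" by metis
  have "coeff (monom (j (f ^ i)) (M - N i + k * i) * q i) (k * m + M) = j (c i * f ^ i)" if i: "i < m" for i
  proof -
    have km: "k * m = k * (m - i) + k * i" using i by (simp flip: distrib_left)
    have "k * m + M - (M - N i + k * i) = k * (m - i) + N i" "\<not> k * m + M < M - N i + k * i"
      unfolding km using NM[OF i] by auto
    then have "coeff (monom (j (f ^ i)) (M - N i + k * i) * q i) (k * m + M) = j (f ^ i) * j (c i)"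
      by (simp only: coeff_monom_mult if_False c(1))
    then show ?thesis by (simp only: j.hom_mult mult.commute)
  qed
  then have "coeff P (k * m + M) = j (f ^ m + (\<Sum>i<m. c i * f ^ i))"
    unfolding P_def by (simp add: coeff_sum j.hom_add j.hom_sum)
  then have "j (f ^ m + (\<Sum>i<m. c i * f ^ i)) = j 0" unfolding P0 by (simp add: j.hom_zero)
  then have "f ^ m + (\<Sum>i<m. c i * f ^ i) = 0" unfolding j_eq_iff .
  then have eq: "f ^ m = (\<Sum>i<m. (- c i) * f ^ i)" by (simp add: sum_negf eq_neg_iff_add_eq_0)
  show ?thesis
  proof (rule R_saturated_integral_equation[OF J _ eq])
    show "\<mu> * real k > 0" using k by simp
    fix i assume "i < m"
    have "(- c i, \<mu> * (real (k * (m - i) + N i) - real (N i))) \<in> J"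
      using c(2) by (rule filtration_uminus[OF J(1)])
    then show "(- c i, real (m - i) * (\<mu> * real k)) \<in> J" by (simp add: ac_simps)
  qed
qed

lemma transcendental_root:
  assumes "w ^ e = s" "e > 0"
  shows "transcendental_embedding j w"
proof
  show "inj j" by (rule inj_j)
  fix q assume q: "q \<in> poly_set (range j)" "poly q w = 0"
  define F where "F = fraction_set (range j)"
  have F: "subfield_set F" "range j \<subseteq> F"
    unfolding F_def using subfield_fraction_set fraction_set_base subring_range by auto
  note Fs = subfield_subring[OF F(1)]
  show "q = 0"
  proof (rule ccontr)
    assume "q \<noteq> 0"
    then obtain f where "minimal_poly F w f"
      using minimal_poly_exists[OF F(1), of q w] q poly_set_mono[OF F(2)] by auto
    then have "integral_over F w" unfolding minimal_poly_def integral_over_def by auto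
    then have "integral_over F s"
      using subring_set_power[OF subring_integral_closure[OF Fs noetherian_on_subfield[OF F(1)]], of w e]
      unfolding assms(1) by simp
    then obtain p where p: "p \<in> poly_set F" "lead_coeff p = 1" "poly p s = 0" unfolding integral_over_def by auto
    obtain d where d: "d \<noteq> 0" "smult d p \<in> poly_set (range j)"
      using poly_common_denominator[OF subring_range] p(1) unfolding F_def by blast
    have "smult d p = 0" using p(3) by (intro transcendental d) simp
    then show False using d p(2) by simp
  qed
qed

end

section \<open>R-saturation over a localized affine domain\<close>

lemma common_multiple_of_positive_rats:
  assumes "finite A" "\<And>a. a \<in> A \<Longrightarrow> a \<in> \<rat> \<and> a > (0::real)"
  shows "\<exists>\<nu>>0. \<nu> \<in> \<rat> \<and> (\<forall>a\<in>A. \<exists>n>0. real n * a = \<nu>)"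
  using assms
proof (induction A)
  case empty
  show ?case by (intro exI[of _ 1]) auto
next
  case (insert a A)
  then obtain \<nu> where \<nu>: "\<nu> > 0" "\<nu> \<in> \<rat>" "\<forall>a\<in>A. \<exists>n>0. real n * a = \<nu>" by auto
  obtain u v :: nat where uv: "v \<noteq> 0" "\<nu> = real u / real v"
    using Rats_abs_nat_div_natE[OF \<nu>(2)] \<nu>(1) by (metis abs_of_pos)
  obtain p q :: nat where pq: "q \<noteq> 0" "a = real p / real q"
    using Rats_abs_nat_div_natE[of a] insert.prems[of a] by (metis abs_of_pos insertI1)
  have u0: "u > 0" using \<nu>(1) uv by (intro gr0I) auto
  have p0: "p > 0" using insert.prems[of a] pq by (intro gr0I) auto
  have eqs: "real (v * p) * \<nu> = real (u * p)" "real (u * q) * a = real (u * p)"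
    using uv pq by (auto simp: field_simps)
  have "\<exists>n>0. real n * b = real (u * p)" if "b \<in> insert a A" for b
  proof (cases "b = a")
    case True
    then show ?thesis using eqs(2) u0 pq by (intro exI[of _ "u * q"]) simp
  next
    case False
    then have "b \<in> A" using that by simp
    then obtain n where n: "n > 0" "real n * b = \<nu>" using \<nu>(3) by blast
    have "real (v * p * n) * b = real (u * p)" unfolding eqs(1)[symmetric] n(2)[symmetric] by simp
    then show ?thesis using n uv p0 by (intro exI[of _ "v * p * n"]) auto
  qed
  then show ?case using u0 p0 by (intro exI[of _ "real (u * p)"]) auto
qed

text \<open>\<open>R0\<close> and \<open>U\<close> are the images of the affine algebra and of the
  multiplicative set in the localization. Only \<open>R0\<close> is finitely generated over
  \<open>K\<close>; the elements of \<open>U\<close> move arbitrary \<open>f\<close> into it and are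
  units of the whole ring.\<close>

locale localized_affine_domain = transcendental_embedding j t
  for j :: "'r::idom \<Rightarrow> 'w::alg_closed_field" and t +
  fixes K V :: "'w set" and R0 U :: "'r set"
  assumes subfield_K: "subfield_set K"
    and perfect_K: "\<And>c q. c \<in> K \<Longrightarrow> q > 0 \<Longrightarrow> \<exists>d\<in>K. d ^ q = c"
    and finite_V: "finite V" and ring_adjoin_K_V: "ring_adjoin K V = j ` R0"
    and units_subset: "U \<subseteq> R0" and units_one: "1 \<in> U"
    and units_mult: "\<And>u v. u \<in> U \<Longrightarrow> v \<in> U \<Longrightarrow> u * v \<in> U"
    and units_dvd: "\<And>u. u \<in> U \<Longrightarrow> u dvd 1"
    and units_clear: "\<And>f. \<exists>u\<in>U. u * f \<in> R0"
begin

lemma units_power: "u \<in> U \<Longrightarrow> u ^ n \<in> U"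
  by (induction n) (auto intro: units_one units_mult)

lemma subring_R0: "subring_set R0"
proof -
  have sub: "subring_set (j ` R0)" using subring_ring_adjoin[of K V] unfolding ring_adjoin_K_V .
  have mem: "x \<in> R0" if "j x \<in> j ` R0" for x using that j_eq_iff by auto
  show ?thesis
  proof (rule subring_setI)
    show "1 \<in> R0" using subring_set_one[OF sub] by (intro mem) (simp add: j.hom_one)
    show "- x \<in> R0" if "x \<in> R0" for x
      using that by (intro mem) (auto simp: j.hom_uminus intro: subring_set_uminus[OF sub])
    show "x + y \<in> R0" "x * y \<in> R0" if "x \<in> R0" "y \<in> R0" for x y
      using that
      by (intro mem; auto simp: j.hom_add j.hom_mult intro: subring_set_add[OF sub] subring_set_mult[OF sub])+
  qed
qed

theorem rfg_type_R_saturation: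
  fixes I :: "('r \<times> real) set"
  assumes "rfg_type I"
  shows "rfg_type (R_saturation I)"
proof -
  obtain T where T: "finite T" "T \<subseteq> UNIV \<times> \<rat>" "I = generated_filtration T"
    using assms unfolding rfg_type_def by blast
  have I: "idealistic_filtration I" unfolding T(3) by (rule idealistic_filtration_generated)
  have TI: "T \<subseteq> I" unfolding T(3) by (rule generated_filtration_base)
  \<comment> \<open>Generators of nonpositive level lie in every filtration and contribute nothing
    to \<open>B\<close>.\<close>
  define T1 where "T1 = {\<tau> \<in> T. snd \<tau> > 0}"
  have T1: "finite T1" "T1 \<subseteq> T" using T(1) unfolding T1_def by auto
  have "\<exists>\<nu>>0. \<nu> \<in> \<rat> \<and> (\<forall>a\<in>snd ` T1. \<exists>n>0. real n * a = \<nu>)"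
    using T T1 by (intro common_multiple_of_positive_rats) (auto simp: T1_def)
  then obtain \<nu> where \<nu>: "\<nu> > 0" "\<nu> \<in> \<rat>" "\<forall>a\<in>snd ` T1. \<exists>n>0. real n * a = \<nu>" by auto
  then have "\<forall>\<tau>\<in>T1. \<exists>n>0. real n * snd \<tau> = \<nu>" by auto
  then obtain n where n: "\<And>\<tau>. \<tau> \<in> T1 \<Longrightarrow> n \<tau> > 0" "\<And>\<tau>. \<tau> \<in> T1 \<Longrightarrow> real (n \<tau>) * snd \<tau> = \<nu>" by metis
  have "\<forall>\<tau>\<in>T1. \<exists>u\<in>U. u * fst \<tau> \<in> R0" using units_clear by blast
  then obtain \<sigma> where \<sigma>: "\<And>\<tau>. \<tau> \<in> T1 \<Longrightarrow> \<sigma> \<tau> \<in> U" "\<And>\<tau>. \<tau> \<in> T1 \<Longrightarrow> \<sigma> \<tau> * fst \<tau> \<in> R0" by metis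
  define g where "g \<tau> = (\<sigma> \<tau> * fst \<tau>) ^ n \<tau>" for \<tau>
  have gR0: "g \<tau> \<in> R0" if "\<tau> \<in> T1" for \<tau>
    unfolding g_def using \<sigma>(2)[OF that] by (intro subring_set_power subring_R0)
  have gI: "(g \<tau>, \<nu>) \<in> I" if "\<tau> \<in> T1" for \<tau>
  proof -
    have "(\<sigma> \<tau> * fst \<tau>, snd \<tau>) \<in> I" using TI T1 that by (intro filtration_scale[OF I]) auto
    then show ?thesis using filtration_power[OF I] n(2)[OF that] unfolding g_def by metis
  qed
  define W where "W = V \<union> (\<lambda>\<tau>. j (g \<tau>) * t) ` T1 \<union> {inverse t}"
  define B where "B = ring_adjoin K W"
  have finW: "finite W" unfolding W_def using finite_V T1 by simp
  have B: "subring_set B" "noetherian_on B B"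
    unfolding B_def by (intro subring_ring_adjoin noetherian_ring_adjoin_subfield subfield_K finW)+
  have R0B: "j f \<in> B" if "f \<in> R0" for f
  proof -
    have "j f \<in> ring_adjoin K V" unfolding ring_adjoin_K_V using that by blast
    moreover have "ring_adjoin K V \<subseteq> B" unfolding B_def W_def by (intro ring_adjoin_mono) auto
    ultimately show ?thesis by blast
  qed
  have UB: "j u \<in> B" if "u \<in> U" for u using that R0B units_subset by auto
  have gB: "j (g \<tau>) * t \<in> B" if "\<tau> \<in> T1" for \<tau>
    using that unfolding B_def by (intro subsetD[OF ring_adjoin_gen]) (auto simp: W_def)
  have tB: "inverse t \<in> B" unfolding B_def by (intro subsetD[OF ring_adjoin_gen]) (simp add: W_def)
  have t0: "t \<noteq> 0" by (rule s_nonzero)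
  \<comment> \<open>Integral elements of the whole field, because \<open>s\<close> may lie outside
    the fraction field \<open>L\<close> of \<open>B\<close>. The finiteness and valuation arguments
    use the part \<open>C\<close> inside \<open>L\<close>.\<close>
  define Ic where "Ic = {w. integral_over B w}"
  have Ic: "subring_set Ic" unfolding Ic_def by (rule subring_integral_closure[OF B])
  have BIc: "B \<subseteq> Ic" unfolding Ic_def using integral_over_base[OF B(1)] by auto
  have rootIc: "w \<in> Ic" if "w ^ m \<in> Ic" "m > 0" for w m
    using that integral_over_root[OF B] unfolding Ic_def by auto
  define L where "L = fraction_set B"
  have L: "subfield_set L" "B \<subseteq> L" unfolding L_def using subfield_fraction_set fraction_set_base B(1) by auto
  note Ls = subfield_subring[OF L(1)]
  have tL: "t \<in> L" using L tB unfolding subfield_set_def by (metis inverse_inverse_eq subsetD)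
  define C where "C = {h \<in> L. integral_over B h}"
  have NC: "noetherian_on B C" unfolding C_def L_def B_def
    by (rule finiteness_of_integral_closure[OF subfield_K perfect_K finW])
  have C: "subring_set C" "B \<subseteq> C" "C \<subseteq> Ic" "C \<subseteq> L"
    using Ic Ls BIc L(2) unfolding C_def Ic_def subring_set_def by auto
  have "normal_set C" unfolding normal_set_def
  proof (intro ballI impI)
    fix z assume z: "z \<in> fraction_set C" "integral_over C z"
    have "fraction_set C \<subseteq> L" using fraction_set_least[OF L(1) C(4)] .
    moreover have "integral_over B z" by (rule integral_over_trans[OF B _ z(2)]) (simp add: C_def)
    ultimately show "z \<in> C" using z unfolding C_def by auto
  qed
  moreover have "inverse t \<in> C" "inverse t \<noteq> 0" using tB C(2) t0 by auto
  ultimately have "\<exists>e>0. \<forall>f\<in>C. \<forall>q>0. \<forall>p. f ^ q / inverse t ^ p \<in> C \<longrightarrow>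
      (\<exists>p'. p * e \<le> p' * q \<and> f ^ e / inverse t ^ p' \<in> C)"
    by (rule bounded_order_denominators[OF C(1) noetherian_on_mono[OF NC C(2)]])
  then obtain e where e: "e > 0" and ord: "\<forall>f\<in>C. \<forall>q>0. \<forall>p. f ^ q / inverse t ^ p \<in> C \<longrightarrow>
      (\<exists>p'. p * e \<le> p' * q \<and> f ^ e / inverse t ^ p' \<in> C)" by blast
  obtain s where s: "s ^ e = t" using nth_root_exists[OF e] by blast
  interpret S: transcendental_embedding j s by (rule transcendental_root[OF s e])
  have s0: "s \<noteq> 0" by (rule S.s_nonzero)
  have sIc: "inverse s \<in> Ic"
  proof (rule rootIc[OF _ e])
    have "inverse s ^ e = inverse t" unfolding power_inverse s ..
    then show "inverse s ^ e \<in> Ic" using tB BIc by auto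
  qed
  \<comment> \<open>\<mu> is the level carried by one factor \<open>s\<close>, as \<nu> is for
    \<open>t\<close>. In \<open>k\<close> below, \<open>nat\<close> sends nonpositive levels to
    exponent 0.\<close>
  define \<mu> where "\<mu> = \<nu> / real e"
  have \<mu>: "\<mu> > 0" "\<mu> \<in> \<rat>" "\<mu> * real e = \<nu>" using \<nu> e unfolding \<mu>_def by auto
  define k where "k a = nat \<lceil>a / \<mu>\<rceil>" for a
  have k_ge: "a \<le> \<mu> * real (k a)" for a
  proof -
    have "a / \<mu> \<le> real (k a)" unfolding k_def by linarith
    then show ?thesis using \<mu>(1) by (simp add: field_simps)
  qed
  have k_le: "k a \<le> m" if "a \<le> \<mu> * real m" for a m
  proof -
    have "a / \<mu> \<le> real m" using that \<mu>(1) by (simp add: field_simps)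
    then show ?thesis unfolding k_def by linarith
  qed
  have down: "h * s ^ m' \<in> Ic" if h: "h * s ^ m \<in> Ic" and "m' \<le> m" for h m m'
  proof -
    have "s ^ m = s ^ m' * s ^ (m - m')" using that by (simp flip: power_add)
    then have "h * s ^ m' = (h * s ^ m) * inverse s ^ (m - m')" using s0 by (simp add: power_inverse)
    also have "\<dots> \<in> Ic" by (rule subring_set_mult[OF Ic h subring_set_power[OF Ic sIc]])
    finally show ?thesis .
  qed
  have div_t: "y / inverse t ^ m = y * t ^ m" for y m
    by (metis divide_inverse inverse_inverse_eq power_inverse)
  \<comment> \<open>An element of \<open>U\<close> need not be invertible in \<open>B\<close>, so
    integrality is asked only after multiplication by some member of \<open>U\<close>.\<close>
  define J where "J = {(f, a). \<exists>u\<in>U. u * f \<in> R0 \<and> j (u * f) * s ^ k a \<in> Ic}"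
  have JI: "(f, a) \<in> J \<longleftrightarrow> (\<exists>u\<in>U. u * f \<in> R0 \<and> j (u * f) * s ^ k a \<in> Ic)" for f a
    unfolding J_def by simp
  have J_nonpos: "(f, a) \<in> J" if "a \<le> 0" for f a
  proof -
    obtain u where u: "u \<in> U" "u * f \<in> R0" using units_clear by blast
    have "k a = 0" using k_le[of a 0] that by simp
    then show ?thesis unfolding JI using u R0B BIc by (intro bexI[of _ u]) auto
  qed
  have J: "idealistic_filtration J"
    unfolding idealistic_filtration_iff
  proof (intro conjI allI impI)
    show "(f, 0) \<in> J" for f by (rule J_nonpos) simp
    show "(0, a) \<in> J" for a
      unfolding JI using units_one subring_set_zero[OF subring_R0] subring_set_zero[OF Ic]
      by (intro bexI[of _ 1]) (auto simp: j.hom_zero)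
    show "(f, b) \<in> J" if "(f, a) \<in> J" "b \<le> a" for f a b
    proof -
      have "k b \<le> k a" using that(2) k_ge[of a] by (intro k_le) auto
      then show ?thesis using that(1) down unfolding JI by blast
    qed
    show "(f + g, a) \<in> J" if fg: "(f, a) \<in> J" "(g, a) \<in> J" for f g a
    proof -
      obtain u v where u: "u \<in> U" "u * f \<in> R0" "j (u * f) * s ^ k a \<in> Ic"
        and v: "v \<in> U" "v * g \<in> R0" "j (v * g) * s ^ k a \<in> Ic" using fg unfolding JI by blast
      have eq: "u * v * (f + g) = v * (u * f) + u * (v * g)" by (simp add: algebra_simps)
      have "u * v * (f + g) \<in> R0" unfolding eq using u v units_subset subring_R0
        by (auto intro!: subring_set_add subring_set_mult)
      moreover have "j (u * v * (f + g)) * s ^ k a = j v * (j (u * f) * s ^ k a) + j u * (j (v * g) * s ^ k a)"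
        unfolding eq by (simp add: j.hom_add j.hom_mult algebra_simps)
      moreover have "j v * (j (u * f) * s ^ k a) + j u * (j (v * g) * s ^ k a) \<in> Ic"
        using subsetD[OF BIc UB[OF u(1)]] subsetD[OF BIc UB[OF v(1)]]
        by (intro subring_set_add[OF Ic] subring_set_mult[OF Ic _ u(3)] subring_set_mult[OF Ic _ v(3)])
      ultimately show ?thesis unfolding JI using units_mult[OF u(1) v(1)] by (intro bexI[of _ "u * v"]) auto
    qed
    show "(f * g, a + b) \<in> J" if fg: "(f, a) \<in> J" "(g, b) \<in> J" for f g a b
    proof -
      obtain u v where u: "u \<in> U" "u * f \<in> R0" "j (u * f) * s ^ k a \<in> Ic"
        and v: "v \<in> U" "v * g \<in> R0" "j (v * g) * s ^ k b \<in> Ic" using fg unfolding JI by blast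
      have eq: "u * v * (f * g) = (u * f) * (v * g)" by (simp add: algebra_simps)
      have "u * v * (f * g) \<in> R0" unfolding eq by (rule subring_set_mult[OF subring_R0 u(2) v(2)])
      moreover have eq': "j (u * v * (f * g)) * s ^ (k a + k b) = (j (u * f) * s ^ k a) * (j (v * g) * s ^ k b)"
        unfolding eq by (simp add: j.hom_mult power_add algebra_simps)
      have "j (u * v * (f * g)) * s ^ (k a + k b) \<in> Ic"
        unfolding eq' by (rule subring_set_mult[OF Ic u(3) v(3)])
      moreover have "k (a + b) \<le> k a + k b"
        using k_ge[of a] k_ge[of b] by (intro k_le) (simp add: algebra_simps)
      ultimately show ?thesis unfolding JI using units_mult[OF u(1) v(1)] down by (intro bexI[of _ "u * v"]) auto
    qed
  qed
  have sat: "R_saturated J"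
    unfolding R_saturated_def
  proof (intro conjI allI impI)
    fix f :: 'r and m :: nat and a
    assume m: "m > 0" and "(f ^ m, real m * a) \<in> J"
    then obtain u where u: "u \<in> U" "u * f ^ m \<in> R0" "j (u * f ^ m) * s ^ k (real m * a) \<in> Ic"
      unfolding JI by blast
    obtain v where v: "v \<in> U" "v * f \<in> R0" using units_clear by blast
    \<comment> \<open>\<open>u\<close> clears \<open>f ^ m\<close> but perhaps not \<open>f\<close>;
      the factor \<open>v\<close> does that. Since \<open>m > 0\<close>, \<open>h ^ m\<close> is
      still a multiple of \<open>u * f ^ m\<close>.\<close>
    define h where "h = u * v * f"
    define l where "l = k (real m * a)"
    have hR0: "h \<in> R0" unfolding h_def mult.assoc
      by (rule subring_set_mult[OF subring_R0 subsetD[OF units_subset u(1)] v(2)])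
    have "u ^ m = u ^ (m - 1) * u" using m by (cases m) auto
    then have "h ^ m = (u ^ (m - 1) * v ^ m) * (u * f ^ m)"
      unfolding h_def by (simp add: power_mult_distrib ac_simps)
    then have "j h ^ m * s ^ l = j (u ^ (m - 1) * v ^ m) * (j (u * f ^ m) * s ^ l)"
      by (simp add: j.hom_mult mult.assoc flip: j.hom_power)
    also have "\<dots> \<in> Ic" unfolding l_def
      by (intro subring_set_mult[OF Ic _ u(3)] subsetD[OF BIc] UB units_mult units_power u(1) v(1))
    \<comment> \<open>The \<open>e\<close>-th power trades \<open>s\<close> for \<open>t\<close> and
      lands in \<open>L\<close>, where the denominator bound applies; an \<open>e\<close>-th root
      then returns to \<open>s\<close>.\<close>
    finally have "(j h ^ m * s ^ l) ^ e \<in> Ic" by (rule subring_set_power[OF Ic])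
    moreover have "(j h ^ m * s ^ l) ^ e = j h ^ (m * e) / inverse t ^ l"
      unfolding div_t power_mult_distrib unfolding s[symmetric] by (simp add: mult.commute flip: power_mult)
    moreover have "j h ^ (m * e) / inverse t ^ l \<in> L"
      using R0B[OF hR0] L tB Ls by (intro subfield_set_divide subring_set_power) auto
    ultimately have "j h ^ (m * e) / inverse t ^ l \<in> C" unfolding C_def Ic_def by auto
    then obtain p' where p': "l * e \<le> p' * (m * e)" "j h ^ e / inverse t ^ p' \<in> C"
      using ord[rule_format, of "j h" "m * e" l] R0B[OF hR0] C(2) m e by auto
    have "j h ^ e / inverse t ^ p' = (j h * s ^ p') ^ e"
      unfolding div_t power_mult_distrib unfolding s[symmetric] by (simp add: mult.commute flip: power_mult)
    then have "(j h * s ^ p') ^ e \<in> Ic" using p'(2) C(3) by (metis subsetD)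
    then have hp: "j h * s ^ p' \<in> Ic" using e by (rule rootIc)
    have "l \<le> p' * m" using p'(1) e by (simp add: mult.assoc[symmetric])
    then have "real l \<le> real p' * real m" by (simp flip: of_nat_mult)
    then have "\<mu> * real l \<le> \<mu> * (real p' * real m)" using \<mu>(1) by (intro mult_left_mono) auto
    then have "real m * a \<le> real m * (\<mu> * real p')" using k_ge[of "real m * a"] unfolding l_def by (simp add: ac_simps)
    then have "k a \<le> p'" using m by (intro k_le) simp
    then have "j (u * v * f) * s ^ k a \<in> Ic" using down[OF hp] unfolding h_def by blast
    then show "(f, a) \<in> J" unfolding JI using hR0 units_mult[OF u(1) v(1)] unfolding h_def by blast
  next
    fix f :: 'r and r :: "nat \<Rightarrow> real" and a
    assume r: "\<forall>l. (f, r l) \<in> J" "r \<longlonglongrightarrow> a"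
    show "(f, a) \<in> J"
    proof (cases "a \<le> 0")
      case False
      \<comment> \<open>\<open>k\<close> is constant from just above this bound up to
        \<open>\<mu> * k a\<close>, so a term of the sequence close enough to \<open>a\<close>
        already demands an exponent at least \<open>k a\<close>.\<close>
      have "\<mu> * (real (k a) - 1) < a"
      proof (rule ccontr)
        assume *: "\<not> \<mu> * (real (k a) - 1) < a"
        have "k a > 0" using k_ge[of a] False by (intro gr0I) auto
        then have "a \<le> \<mu> * real (k a - 1)" using * by (simp add: of_nat_diff)
        then show False using k_le[of a "k a - 1"] \<open>k a > 0\<close> by simp
      qed
      then have "eventually (\<lambda>l. \<mu> * (real (k a) - 1) < r l) sequentially"
        using r(2) by (rule order_tendstoD(1)[rotated])
      then obtain l where "\<mu> * (real (k a) - 1) < r l" by (auto simp: eventually_sequentially)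
      then have "\<mu> * (real (k a) - 1) < \<mu> * real (k (r l))" using k_ge[of "r l"] by simp
      then have "k a \<le> k (r l)" using \<mu>(1) by simp
      then show ?thesis using r(1) down unfolding JI by blast
    qed (rule J_nonpos)
  qed
  have "T \<subseteq> J"
  proof
    fix \<tau> assume \<tau>: "\<tau> \<in> T"
    show "\<tau> \<in> J"
    proof (cases "snd \<tau> > 0")
      case True
      then have \<tau>1: "\<tau> \<in> T1" using \<tau> unfolding T1_def by simp
      have "k \<nu> \<le> e" using \<mu>(3) by (intro k_le) simp
      moreover have "j (g \<tau>) * s ^ e \<in> Ic" using gB[OF \<tau>1] BIc s by auto
      ultimately have "(g \<tau>, \<nu>) \<in> J" unfolding JI using units_one gR0[OF \<tau>1] down by (intro bexI[of _ 1]) auto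
      \<comment> \<open>Radicality of \<open>J\<close> undoes the power \<open>n \<tau>\<close>; the
        unit \<open>\<sigma> \<tau>\<close> is cancelled next.\<close>
      then have "((\<sigma> \<tau> * fst \<tau>) ^ n \<tau>, real (n \<tau>) * snd \<tau>) \<in> J" using n(2)[OF \<tau>1] unfolding g_def by simp
      then have "(\<sigma> \<tau> * fst \<tau>, snd \<tau>) \<in> J" using sat n(1)[OF \<tau>1] unfolding R_saturated_def by blast
      then have "(fst \<tau>, snd \<tau>) \<in> J" using units_dvd[OF \<sigma>(1)[OF \<tau>1]] by (rule filtration_unit[OF J])
      then show ?thesis by simp
    next
      case False
      then show ?thesis using J_nonpos[of "snd \<tau>" "fst \<tau>"] by simp
    qed
  qed
  then have "I \<subseteq> J" unfolding T(3) by (rule generated_filtration_least[OF J])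
  then have RJ: "R_saturation I \<subseteq> J" by (rule R_saturation_least[OF J sat])
  \<comment> \<open>Adjoining \<open>1 / s\<close> puts \<open>s\<close> into the fraction field, so
    that the homogeneous elements \<open>f s ^ m\<close> fall under the finiteness theorem.\<close>
  define B' where "B' = ring_adjoin K (insert (inverse s) W)"
  have B': "subring_set B'" unfolding B'_def by (rule subring_ring_adjoin)
  have BB': "B \<subseteq> B'" unfolding B_def B'_def by (intro ring_adjoin_mono) auto
  \<comment> \<open>Stated for every filtration containing \<open>I\<close>, since it serves both
    the saturation and the filtration generated by \<open>T'\<close>.\<close>
  have B'laurent: "B' \<subseteq> laurent j s \<mu> F" if F: "idealistic_filtration F" "I \<subseteq> F" for F
  proof -
    note F_ring = S.subring_laurent[OF F(1), of \<mu>]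
    have R0F: "ring_adjoin K V \<subseteq> laurent j s \<mu> F"
      unfolding ring_adjoin_K_V using S.laurent_j[OF F(1)] by auto
    have "K \<subseteq> laurent j s \<mu> F" "V \<subseteq> laurent j s \<mu> F"
      using R0F ring_adjoin_base[of K V] ring_adjoin_gen[of V K] by auto
    moreover have "j (g \<tau>) * t \<in> laurent j s \<mu> F" if "\<tau> \<in> T1" for \<tau>
      unfolding s[symmetric] using gI[OF that] F(2) by (intro S.laurent_monom F) (auto simp: \<mu>(3))
    moreover have "inverse s \<in> laurent j s \<mu> F" by (rule S.laurent_inverse[OF F(1) \<mu>(1)])
    moreover from this have "inverse t \<in> laurent j s \<mu> F"
      unfolding s[symmetric] power_inverse[symmetric] by (rule subring_set_power[OF F_ring])
    ultimately show ?thesis unfolding B'_def W_def by (intro ring_adjoin_least F_ring) auto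
  qed
  note RS = idealistic_filtration_R_saturation[of I] R_saturated_R_saturation[of I]
  have JR: "J \<subseteq> R_saturation I"
  proof (rule subrelI)
    fix f a assume "(f, a) \<in> J"
    then obtain u where u: "u \<in> U" "j (u * f) * s ^ k a \<in> Ic" unfolding JI by blast
    show "(f, a) \<in> R_saturation I"
    proof (cases "a \<le> 0")
      case True
      then show ?thesis by (rule filtration_nonpos[OF RS(1)])
    next
      case False
      then have "k a > 0" using k_ge[of a] by (intro gr0I) auto
      have "B \<subseteq> laurent j s \<mu> (R_saturation I)" using BB' B'laurent[OF RS(1) R_saturation_base] by blast
      then have "(u * f, \<mu> * real (k a)) \<in> R_saturation I"
        using u(2) unfolding Ic_def
        by (intro S.integral_over_laurent_imp_saturated[OF RS _ \<mu>(1) \<open>k a > 0\<close>]) auto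
      then have "(u * f, a) \<in> R_saturation I" using k_ge by (rule filtration_antimono[OF RS(1)])
      then show ?thesis using units_dvd[OF u(1)] by (rule filtration_unit[OF RS(1)])
    qed
  qed
  define H where "H = {h \<in> fraction_set B'. integral_over B' h}"
  have NH: "noetherian_on B' H" unfolding H_def B'_def
    using finW by (intro finiteness_of_integral_closure[OF subfield_K perfect_K]) auto
  define Y where "Y = (\<lambda>(f, m). j f * s ^ m) ` {(f, m). f \<in> R0 \<and> j f * s ^ m \<in> Ic}"
  have "Y \<subseteq> H"
  proof
    fix y assume "y \<in> Y"
    then obtain f m where y: "f \<in> R0" "j f * s ^ m \<in> Ic" "y = j f * s ^ m" unfolding Y_def by auto
    have "inverse s \<in> B'" unfolding B'_def by (intro subsetD[OF ring_adjoin_gen]) simp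
    then have "j f / inverse s ^ m \<in> fraction_set B'"
      using R0B[OF y(1)] BB' B' s0 by (intro fraction_setI subring_set_power) auto
    then have "y \<in> fraction_set B'" unfolding y by (simp add: divide_inverse power_inverse)
    moreover have "integral_over B' y" using y BB' integral_over_mono unfolding Ic_def by auto
    ultimately show "y \<in> H" unfolding H_def by simp
  qed
  \<comment> \<open>The generators come from \<open>Y\<close> itself and are therefore homogeneous;
    no decomposition into graded pieces is involved.\<close>
  from noetherian_onE[OF NH this] obtain Y0 where Y0: "Y0 \<subseteq> Y" "finite Y0" "Y \<subseteq> lin_span B' Y0" .
  obtain P where P: "P \<subseteq> {(f, m). f \<in> R0 \<and> j f * s ^ m \<in> Ic}" "finite P" "Y0 = (\<lambda>(f, m). j f * s ^ m) ` P"
    using Y0(1,2) unfolding Y_def by (meson finite_subset_image)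
  define T' where "T' = T \<union> (\<lambda>(f, m). (f, \<mu> * real m)) ` P"
  define F where "F = generated_filtration T'"
  have F: "idealistic_filtration F" "T' \<subseteq> F"
    unfolding F_def using idealistic_filtration_generated generated_filtration_base by auto
  have IF: "I \<subseteq> F" unfolding T(3) using F by (intro generated_filtration_least) (auto simp: T'_def)
  have YF: "Y \<subseteq> laurent j s \<mu> F"
  proof -
    have "Y0 \<subseteq> laurent j s \<mu> F"
    proof
      fix y assume "y \<in> Y0"
      then obtain f m where fm: "(f, m) \<in> P" "y = j f * s ^ m" unfolding P(3) by auto
      have "(f, \<mu> * real m) \<in> F" using fm(1) F(2) unfolding T'_def by force
      then show "y \<in> laurent j s \<mu> F" unfolding fm(2) by (rule S.laurent_monom[OF F(1)])
    qed
    then have "lin_span (laurent j s \<mu> F) Y0 \<subseteq> laurent j s \<mu> F"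
      by (rule lin_span_self[OF S.subring_laurent[OF F(1)]])
    moreover have "lin_span B' Y0 \<subseteq> lin_span (laurent j s \<mu> F) Y0"
      by (rule lin_span_mono[OF B'laurent[OF F(1) IF] subset_refl])
    ultimately show ?thesis using Y0(3) by blast
  qed
  have "J \<subseteq> F"
  proof (rule subrelI)
    fix f a assume "(f, a) \<in> J"
    then obtain u where u: "u \<in> U" "u * f \<in> R0" "j (u * f) * s ^ k a \<in> Ic"
      unfolding JI by blast
    then have "j (u * f) * s ^ k a \<in> Y" unfolding Y_def by auto
    then have "(u * f, \<mu> * real (k a)) \<in> F" using YF by (intro S.laurent_homogeneous) auto
    then have "(u * f, a) \<in> F" using k_ge by (rule filtration_antimono[OF F(1)])
    then show "(f, a) \<in> F" using units_dvd[OF u(1)] by (rule filtration_unit[OF F(1)])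
  qed
  moreover have "F \<subseteq> R_saturation I"
  proof -
    have "(f, \<mu> * real m) \<in> J" if "(f, m) \<in> P" for f m
    proof -
      have fm: "f \<in> R0" "j f * s ^ m \<in> Ic" using that P(1) by auto
      have "k (\<mu> * real m) \<le> m" by (rule k_le) simp
      then show ?thesis unfolding JI using fm units_one down by (intro bexI[of _ 1]) auto
    qed
    then have "T' \<subseteq> R_saturation I" unfolding T'_def using TI R_saturation_base[of I] JR by auto
    then show ?thesis unfolding F_def by (rule generated_filtration_least[OF RS(1)])
  qed
  ultimately have "R_saturation I = generated_filtration T'" using RJ unfolding F_def by blast
  moreover have "finite T'" unfolding T'_def using T(1) P(2) by simp
  moreover have "T' \<subseteq> UNIV \<times> \<rat>" unfolding T'_def using T(2) \<mu>(2) by auto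
  ultimately show ?thesis unfolding rfg_type_def by blast
qed

end

section \<open>Embedding the given ring into an algebraically closed field\<close>

lemma mpoly_eval_in_ring_adjoin:
  assumes h: "comm_ring_hom h" and p: "p \<in> mpoly_ring n"
  shows "h (mpoly_eval \<phi> x p) \<in> ring_adjoin (range (\<lambda>c. h (\<phi> c))) ((\<lambda>i. h (x i)) ` {..<n})"
proof -
  interpret h: comm_ring_hom h by (rule h)
  let ?E = "ring_adjoin (range (\<lambda>c. h (\<phi> c))) ((\<lambda>i. h (x i)) ` {..<n})"
  have E: "subring_set ?E" by (rule subring_ring_adjoin)
  have c: "h (\<phi> c) \<in> ?E" for c by (intro subsetD[OF ring_adjoin_base]) auto
  have x: "h (x i) \<in> ?E" if "i < n" for i using that by (intro subsetD[OF ring_adjoin_gen]) auto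
  show ?thesis unfolding mpoly_eval_def h.hom_sum h.hom_mult h.hom_prod h.hom_power
    using p by (intro subring_set_sum[OF E] subring_set_mult[OF E] subring_set_prod[OF E]
        subring_set_power[OF E] c x) (auto simp: mpoly_ring_def)
qed

text \<open>Constants embed the ring, and the polynomial variable supplies the transcendental
  \<open>t\<close>; the algebraic closure provides all roots of \<open>t\<close>.\<close>

definition poly_fract_embedding :: "'r::idom poly \<Rightarrow> 'r poly fract alg_closure" where
  "poly_fract_embedding p = to_ac (to_fract p)"

lemma transcendental_embedding_poly_fract:
  "transcendental_embedding (\<lambda>c::'r::idom. poly_fract_embedding [:c:]) (poly_fract_embedding [:0, 1:])"
proof -
  let ?j = "\<lambda>c::'r. poly_fract_embedding [:c:]" and ?t = "poly_fract_embedding [:0, 1::'r:]"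
  have add: "poly_fract_embedding (p + q) = poly_fract_embedding p + poly_fract_embedding q"
    and mult: "poly_fract_embedding (p * q) = poly_fract_embedding p * poly_fract_embedding q" for p q :: "'r poly"
    by (simp_all add: poly_fract_embedding_def)
  have hom: "comm_ring_hom ?j"
  proof
    show "?j 0 = 0" "?j 1 = 1" by (simp_all add: poly_fract_embedding_def flip: one_pCons)
    show "?j (x + y) = ?j x + ?j y" "?j (x * y) = ?j x * ?j y" for x y
      using add[of "[:x:]" "[:y:]"] mult[of "[:x:]" "[:y:]"] by (simp_all add: ac_simps)
  qed
  have inj: "inj ?j" by (rule injI) (simp add: poly_fract_embedding_def)
  have ev: "\<exists>p. poly q ?t = poly_fract_embedding p \<and> (p = 0 \<longrightarrow> q = 0)" if "q \<in> poly_set (range ?j)" for q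
    using that
  proof (induction q)
    case 0
    show ?case by (intro exI[of _ 0]) (simp add: poly_fract_embedding_def)
  next
    case (pCons a q)
    have "a \<in> range ?j" "q \<in> poly_set (range ?j)"
      using pCons.prems by (simp_all add: pCons_in_poly_set_iff)
    then obtain c p where c: "a = ?j c" and p: "poly q ?t = poly_fract_embedding p" "p = 0 \<longrightarrow> q = 0"
      using pCons.IH by auto
    have "poly (pCons a q) ?t = ?j c + ?t * poly_fract_embedding p" by (simp add: c p(1))
    also have "\<dots> = poly_fract_embedding (pCons c p)" by (simp flip: add mult)
    finally show ?case using p(2) c
      by (intro exI[of _ "pCons c p"]) (auto simp: poly_fract_embedding_def)
  qed
  have "q = 0" if q: "q \<in> poly_set (range ?j)" "poly q ?t = 0" for q
    using ev[OF q(1)] q(2) by (auto simp: poly_fract_embedding_def)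
  then show ?thesis using hom inj
    by (auto simp: transcendental_embedding_def transcendental_embedding_axioms_def)
qed

theorem proposition2p3p2p3:
  fixes \<phi> :: "'k::alg_closed_field \<Rightarrow> 'a::idom"
    and S :: "'a set"
    and \<iota> :: "'a \<Rightarrow> 'r::idom"
    and I :: "('r \<times> real) set"
  assumes "smooth_affine_coordinate_ring \<phi>"
    and "multiplicative_set S"
    and "is_localization S \<iota>"
    and "idealistic_filtration I"
    and "rfg_type I"
  shows "rfg_type (R_saturation I)"
proof -
  obtain n x fs where pres: "affine_presentation \<phi> n x fs"
    using assms(1) unfolding smooth_affine_coordinate_ring_def by blast
  interpret \<phi>: comm_ring_hom \<phi> using pres by (simp add: affine_presentation_def)
  interpret \<iota>: comm_ring_hom \<iota> using assms(3) by (simp add: is_localization_def)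
  let ?j = "\<lambda>c::'r. poly_fract_embedding [:c:]"
  interpret E: transcendental_embedding ?j "poly_fract_embedding [:0, 1::'r:]"
    by (rule transcendental_embedding_poly_fract)
  define h where "h a = ?j (\<iota> a)" for a
  have h: "comm_ring_hom h"
    unfolding h_def by standard
      (simp_all add: \<iota>.hom_zero \<iota>.hom_one \<iota>.hom_add \<iota>.hom_mult E.j.hom_zero E.j.hom_one E.j.hom_add E.j.hom_mult
        del: pCons_0_0)
  interpret h: comm_ring_hom h by (rule h)
  define K where "K = range (\<lambda>c. h (\<phi> c))"
  define V where "V = (\<lambda>i. h (x i)) ` {..<n}"
  have K: "subfield_set K"
  proof -
    have "subring_set K" unfolding K_def
      by (rule subring_setI)
         (auto simp flip: h.hom_one \<phi>.hom_one h.hom_uminus \<phi>.hom_uminus h.hom_add \<phi>.hom_add h.hom_mult \<phi>.hom_mult)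
    moreover have "inverse (h (\<phi> c)) = h (\<phi> (inverse c))" for c
    proof (cases "c = 0")
      case False
      then have "h (\<phi> c) * h (\<phi> (inverse c)) = h (\<phi> 1)"
        by (simp flip: h.hom_mult \<phi>.hom_mult)
      then show ?thesis by (simp add: h.hom_one \<phi>.hom_one inverse_unique)
    qed (simp add: h.hom_zero \<phi>.hom_zero)
    ultimately show ?thesis unfolding subfield_set_def by (auto simp: K_def)
  qed
  have adj: "ring_adjoin K V = ?j ` range \<iota>"
  proof
    have "subring_set (?j ` range \<iota>)"
      by (rule subring_setI) (auto simp: image_image simp flip: h_def h.hom_one h.hom_uminus h.hom_add h.hom_mult)
    then show "ring_adjoin K V \<subseteq> ?j ` range \<iota>"
      by (rule ring_adjoin_least) (auto simp: K_def V_def h_def)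
    have "h a \<in> ring_adjoin K V" for a
    proof -
      have "a \<in> mpoly_eval \<phi> x ` mpoly_ring n" using pres by (simp add: affine_presentation_def)
      then show ?thesis unfolding K_def V_def using mpoly_eval_in_ring_adjoin[OF h] by blast
    qed
    then show "?j ` range \<iota> \<subseteq> ring_adjoin K V" by (auto simp: h_def)
  qed
  interpret localized_affine_domain ?j "poly_fract_embedding [:0, 1::'r:]" K V "range \<iota>" "\<iota> ` S"
  proof
    show "subfield_set K" by (rule K)
    show "\<exists>d\<in>K. d ^ q = c" if c: "c \<in> K" and q: "q > 0" for c q
    proof -
      obtain b where b: "c = h (\<phi> b)" using c unfolding K_def by auto
      obtain d where "d ^ q = b" using nth_root_exists[OF q] by blast
      then have "h (\<phi> d) ^ q = c" by (simp add: b flip: h.hom_power \<phi>.hom_power)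
      then show ?thesis unfolding K_def by blast
    qed
    show "finite V" unfolding V_def by simp
    show "ring_adjoin K V = ?j ` range \<iota>" by (rule adj)
    show "\<iota> ` S \<subseteq> range \<iota>" by auto
    show "1 \<in> \<iota> ` S" using assms(2) \<iota>.hom_one unfolding multiplicative_set_def by force
    show "u * v \<in> \<iota> ` S" if "u \<in> \<iota> ` S" "v \<in> \<iota> ` S" for u v
      using that assms(2) unfolding multiplicative_set_def by (auto simp flip: \<iota>.hom_mult)
    show "u dvd 1" if "u \<in> \<iota> ` S" for u using that assms(3) unfolding is_localization_def by blast
    show "\<exists>u\<in>\<iota> ` S. u * f \<in> range \<iota>" for f
      using assms(3) unfolding is_localization_def by (metis mult.commute image_eqI rangeI)
  qed
  show ?thesis by (rule rfg_type_R_saturation[OF assms(5)])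
qed

end
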